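(* Let $H$ be a Lie group, $q:M\to M/H$ an $H$-principal bundle, $\pi$ a Poisson structure on $M/H$, and $E=q^!\mathrm{gr}(\pi)$ the pullback Dirac structure on $M$ of the graph of $\pi$. If $(\mathcal G,\omega)$ is an $H$-admissible pre-symplectic groupoid integrating $E$, then there is a unique symplectic structure $\overline\omega$ on the quotient Lie groupoid $\overline{\mathcal G}=\mathcal G/(H\times H)$ over $M/H$ such that $p^*\overline\omega=\omega$, where $p:\mathcal G\to\overline{\mathcal G}$ is the quotient map, and $(\overline{\mathcal G},\overline\omega)$ is a symplectic groupoid integrating $(M/H,\pi)$.
   Context: Dirac structures: on $\mathbb TM=TM\oplus T^*M$ consider the pairing $\langle(X,\alpha),(Y,\beta)\rangle=\beta(X)+\alpha(Y)$ and the Courant–Dorfman bracket $[\![(X,\alpha),(Y,\beta)]\!]=([X,Y],\mathcal L_X\beta-i_Yd\alpha)$. A Dirac structure on $M$ is a vector subbundle $E\subset\mathbb TM$, lagrangian for $\langle\cdot,\cdot\rangle$ and involutive for $[\![\cdot,\cdot]\!]$; it is a Lie algebroid with anchor the projection to $TM$ and the restricted bracket. For a Poisson structure $\pi$, $\mathrm{gr}(\pi)=\{(\pi^\sharp(\alpha),\alpha)\}$, $\pi^\sharp(\alpha)=i_\alpha\pi$, is a Dirac structure. For a Dirac structure $F$ on $M/H$, $q^!F=\{(X,q^*\beta)\mid(dq(X),\beta)\in F\}\subset\mathbb TM$. Pre-symplectic groupoids: for a Lie groupoid $\mathcal G\rightrightarrows M$ with Lie algebroid $A=\ker(d\mathbf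 s)|_M$ (bracket via right-invariant vector fields, anchor $\rho=d\mathbf t|_A$) and $\omega\in\Omega^2(\mathcal G)$, put $\mu_\omega(a)=(i_a\omega)|_{TM}$ and $\delta_\omega=(\rho,\mu_\omega):A\to\mathbb TM$. $\omega$ is multiplicative if $m^*\omega=\mathrm p_1^*\omega+\mathrm p_2^*\omega$ on composable pairs. $(\mathcal G,\omega)$ is a pre-symplectic groupoid if $\omega$ is closed and multiplicative, $\dim\mathcal G=2\dim M$ and $\delta_\omega$ is injective. It integrates the Dirac structure $E=\delta_\omega(A)$ (and then $\delta_\omega:A\to E$ is a Lie algebroid isomorphism). A symplectic groupoid integrating a Poisson manifold $(N,\pi)$ is a Lie groupoid over $N$ with a multiplicative symplectic form such that the target map to $(N,\pi)$ is a Poisson map. $H$-admissibility: let $\mathfrak h=\mathrm{Lie}(H)$ (bracket via right-invariant vector fields), $u_M|_x=\frac{d}{d\epsilon}|_{0}\exp(\epsilon u)\cdot x$, $\mathfrak h\ltimes M$ the action Lie algebroid, and $\psi:\mathfrak h\ltimes M\to E$, $\psi(u,x)=(u_M|_x,0)$, a Lie algebroid morphism. A pre-symplectic groupoid $(\mathcal G,\omega)$ integrating $E=q^!\mathrm{gr}(\pi)$ is $H$-admissible if $\psi$ (with $A\cong E$ via $\delta_\omega$) integrates to a Lie groupoid morphism $\Psi:H\ltimes M\to\mathcal G$ over $\mathrm{id}_M$, where $H\ltimes M$ is the action groupoid (source $(h,x)\mapsto x$, target $(h,x)\mapsto h\cdot x$), and $\omega$ is invariant under the $(H\times H)$-action $(h_1,h_2)\cdot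 g=\Psi(h_1,\mathbf t(g))\,g\,\Psi(h_2,\mathbf s(g))^{-1}$ on $\mathcal G$. The orbit space $\overline{\mathcal G}=\mathcal G/(H\times H)$ carries the Lie groupoid structure over $M/H$ for which $p$ is a submersion and a groupoid morphism covering $q$. *)

theory Defs
  imports "HOL-Analysis.Analysis" "HOL-Algebra.Group"
begin

section \<open>Smooth maps between model spaces\<close>

(* Finite-dimensional Euclidean vector spaces, as models of manifolds. The library class
   euclidean_space demands a nonempty basis; dimension 0 is kept here because it is needed, e.g.,
   for discrete structure groups and for one-point or discrete bases. *)
class model_space = real_inner +
  assumes finite_dimensional: "\<exists>B. finite B \<and> (\<forall>x. \<exists>c. x = (\<Sum>b\<in>B. c b *\<^sub>R b))"

lemma model_space_iff_span:
  "(\<exists>B. finite B \<and> (\<forall>x :: 'a::real_inner. \<exists>c. x = (\<Sum>b\<in>B. c b *\<^sub>R b))) \<longleftrightarrow>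
   (\<exists>B. finite B \<and> span B = (UNIV :: 'a set))"
proof -
  have "(\<forall>x :: 'a. \<exists>c. x = (\<Sum>b\<in>B. c b *\<^sub>R b)) \<longleftrightarrow> span B = UNIV" if "finite B" for B
    using that by (auto simp: span_finite)
  then show ?thesis by blast
qed

instance euclidean_space \<subseteq> model_space
proof
  show "\<exists>B. finite B \<and> (\<forall>x :: 'a. \<exists>c. x = (\<Sum>b\<in>B. c b *\<^sub>R b))"
    unfolding model_space_iff_span by (intro exI[of _ Basis]) simp
qed

instance prod :: (model_space, model_space) model_space
proof
  obtain A :: "'a set" where A: "finite A" "span A = UNIV"
    using finite_dimensional unfolding model_space_iff_span by blast
  obtain B :: "'b set" where B: "finite B" "span B = UNIV"
    using finite_dimensional unfolding model_space_iff_span by blast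
  let ?C = "(\<lambda>x. (x, 0 :: 'b)) ` A \<union> (\<lambda>y. (0 :: 'a, y)) ` B"
  have l1: "linear (\<lambda>x :: 'a. (x, 0 :: 'b))" and l2: "linear (\<lambda>y :: 'b. (0 :: 'a, y))"
    by (auto intro!: linearI)
  have "(x, y) \<in> span ?C" for x y
  proof -
    have "(x, 0) \<in> span ((\<lambda>x. (x, 0 :: 'b)) ` A)"
      unfolding linear_span_image[OF l1] A(2) by (rule imageI) (rule UNIV_I)
    then have 1: "(x, 0) \<in> span ?C"
      by (rule subsetD[OF span_mono[OF Un_upper1]])
    have "(0, y) \<in> span ((\<lambda>y. (0 :: 'a, y)) ` B)"
      unfolding linear_span_image[OF l2] B(2) by (rule imageI) (rule UNIV_I)
    then have 2: "(0, y) \<in> span ?C"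
      by (rule subsetD[OF span_mono[OF Un_upper2]])
    show ?thesis using span_add[OF 1 2] by simp
  qed
  then have "span ?C = UNIV" by auto
  moreover have "finite ?C" using A(1) B(1) by simp
  ultimately show "\<exists>C. finite C \<and> (\<forall>x :: 'a \<times> 'b. \<exists>c. x = (\<Sum>b\<in>C. c b *\<^sub>R b))"
    unfolding model_space_iff_span by blast
qed

(* On open subsets of finite-dimensional spaces this is the usual notion of class C^k. *)
primrec C_k_on :: "nat \<Rightarrow> 'e::model_space set \<Rightarrow> ('e \<Rightarrow> 'f::model_space) \<Rightarrow> bool" where
  "C_k_on 0 S f \<longleftrightarrow> continuous_on S f"
| "C_k_on (Suc k) S f \<longleftrightarrow>
     (\<forall>x\<in>S. f differentiable (at x)) \<and> (\<forall>v. C_k_on k S (\<lambda>x. frechet_derivative f (at x) v))"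

definition smooth_on :: "'e::model_space set \<Rightarrow> ('e \<Rightarrow> 'f::model_space) \<Rightarrow> bool" where
  "smooth_on S f \<longleftrightarrow> (\<forall>k. C_k_on k S f)"

section \<open>Manifolds\<close>

type_synonym ('a, 'e) chart = "'a set \<times> ('a \<Rightarrow> 'e)"

(* chart_at x is a preferred chart around x. The tangent space at x is the model space 'e: a
   tangent vector is represented by its coordinates in the preferred chart at its base point. *)
record ('a, 'e) manifold =
  mtop :: "'a topology"
  atlas :: "('a, 'e) chart set"
  chart_at :: "'a \<Rightarrow> ('a, 'e) chart"

abbreviation points :: "('a, 'e) manifold \<Rightarrow> 'a set" where
  "points M \<equiv> topspace (mtop M)"

abbreviation chart_inv :: "('a, 'e) chart \<Rightarrow> 'e \<Rightarrow> 'a" where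
  "chart_inv c \<equiv> inv_into (fst c) (snd c)"

definition smooth_manifold :: "('a, 'e::model_space) manifold \<Rightarrow> bool" where
  "smooth_manifold M \<longleftrightarrow>
     Hausdorff_space (mtop M) \<and> second_countable (mtop M) \<and>
     (\<forall>(U, \<phi>) \<in> atlas M. openin (mtop M) U \<and> open (\<phi> ` U) \<and>
        homeomorphic_map (subtopology (mtop M) U) (top_of_set (\<phi> ` U)) \<phi>) \<and>
     (\<forall>(U, \<phi>) \<in> atlas M. \<forall>(V, \<psi>) \<in> atlas M.
        smooth_on (\<phi> ` (U \<inter> V)) (\<psi> \<circ> inv_into U \<phi>)) \<and>
     (\<forall>x\<in>points M. chart_at M x \<in> atlas M \<and> x \<in> fst (chart_at M x))"

definition model_manifold :: "('e::model_space, 'e) manifold" where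
  "model_manifold = \<lparr>mtop = euclidean, atlas = {(UNIV, id)}, chart_at = (\<lambda>_. (UNIV, id))\<rparr>"

abbreviation real_line :: "(real, real) manifold" where
  "real_line \<equiv> model_manifold"

definition prod_chart :: "('a, 'e) chart \<Rightarrow> ('b, 'f) chart \<Rightarrow> ('a \<times> 'b, 'e \<times> 'f) chart" where
  "prod_chart c d = (fst c \<times> fst d, map_prod (snd c) (snd d))"

definition prod_manifold ::
    "('a, 'e) manifold \<Rightarrow> ('b, 'f) manifold \<Rightarrow> ('a \<times> 'b, 'e \<times> 'f) manifold" where
  "prod_manifold M N =
     \<lparr>mtop = prod_topology (mtop M) (mtop N),
      atlas = {prod_chart c d | c d. c \<in> atlas M \<and> d \<in> atlas N},
      chart_at = (\<lambda>(x, y). prod_chart (chart_at M x) (chart_at N y))\<rparr>"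

definition open_submanifold :: "('a, 'e) manifold \<Rightarrow> 'a set \<Rightarrow> ('a, 'e) manifold" where
  "open_submanifold M W =
     \<lparr>mtop = subtopology (mtop M) W,
      atlas = {(U \<inter> W, \<phi>) | U \<phi>. (U, \<phi>) \<in> atlas M},
      chart_at = (\<lambda>x. (fst (chart_at M x) \<inter> W, snd (chart_at M x)))\<rparr>"

definition smooth_map ::
    "('a, 'e::model_space) manifold \<Rightarrow> ('b, 'f::model_space) manifold \<Rightarrow> ('a \<Rightarrow> 'b) \<Rightarrow> bool" where
  "smooth_map M N f \<longleftrightarrow>
     continuous_map (mtop M) (mtop N) f \<and>
     (\<forall>(U, \<phi>) \<in> atlas M. \<forall>(V, \<psi>) \<in> atlas N.
        smooth_on (\<phi> ` {x \<in> U. f x \<in> V}) (\<psi> \<circ> f \<circ> inv_into U \<phi>))"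

definition diffeomorphism ::
    "('a, 'e::model_space) manifold \<Rightarrow> ('b, 'f::model_space) manifold \<Rightarrow> ('a \<Rightarrow> 'b) \<Rightarrow> bool" where
  "diffeomorphism M N f \<longleftrightarrow> smooth_map M N f \<and>
     (\<exists>g. smooth_map N M g \<and> (\<forall>x\<in>points M. g (f x) = x) \<and> (\<forall>y\<in>points N. f (g y) = y))"

(* Smoothness of a map that is only given on a subset S: local extendability. For an embedded
   submanifold S this is smoothness for the induced manifold structure. *)
definition smooth_map_on_subset ::
    "('a, 'e::model_space) manifold \<Rightarrow> 'a set \<Rightarrow> ('b, 'f::model_space) manifold
      \<Rightarrow> ('a \<Rightarrow> 'b) \<Rightarrow> bool" where
  "smooth_map_on_subset M S N f \<longleftrightarrow>
     (\<forall>x\<in>S. \<exists>W F. openin (mtop M) W \<and> x \<in> W \<and> smooth_map (open_submanifold M W) N F \<and>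
        (\<forall>y\<in>S \<inter> W. F y = f y))"

definition mdiff ::
    "('a, 'e::model_space) manifold \<Rightarrow> ('b, 'f::model_space) manifold \<Rightarrow> ('a \<Rightarrow> 'b)
      \<Rightarrow> 'a \<Rightarrow> 'e \<Rightarrow> 'f" where
  "mdiff M N f x =
     frechet_derivative (snd (chart_at N (f x)) \<circ> f \<circ> chart_inv (chart_at M x))
       (at (snd (chart_at M x) x))"

(* The differential at x of a map that is only given on a subset S. It is determined on vectors
   tangent to S only, and is to be applied to such vectors only. *)
definition mdiff_within ::
    "('a, 'e::model_space) manifold \<Rightarrow> 'a set \<Rightarrow> ('b, 'f::model_space) manifold \<Rightarrow> ('a \<Rightarrow> 'b)
      \<Rightarrow> 'a \<Rightarrow> 'e \<Rightarrow> 'f" where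
  "mdiff_within M S N f x =
     frechet_derivative (snd (chart_at N (f x)) \<circ> f \<circ> chart_inv (chart_at M x))
       (at (snd (chart_at M x) x) within snd (chart_at M x) ` (S \<inter> fst (chart_at M x)))"

definition velocity :: "('a, 'e::model_space) manifold \<Rightarrow> (real \<Rightarrow> 'a) \<Rightarrow> real \<Rightarrow> 'e" where
  "velocity M \<gamma> t = vector_derivative (snd (chart_at M (\<gamma> t)) \<circ> \<gamma>) (at t)"

definition submersion ::
    "('a, 'e::model_space) manifold \<Rightarrow> ('b, 'f::model_space) manifold \<Rightarrow> ('a \<Rightarrow> 'b) \<Rightarrow> bool" where
  "submersion M N f \<longleftrightarrow> smooth_map M N f \<and> (\<forall>x\<in>points M. surj (mdiff M N f x))"

(* Change of coordinates of tangent vectors at x, from chart c to chart d. *)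
definition coord_change :: "('a, 'e::model_space) chart \<Rightarrow> ('a, 'e) chart \<Rightarrow> 'a \<Rightarrow> 'e \<Rightarrow> 'e" where
  "coord_change c d x = frechet_derivative (snd d \<circ> chart_inv c) (at (snd c x))"

section \<open>Differential 2-forms\<close>

definition local_form ::
    "('a, 'e::model_space) manifold \<Rightarrow> ('a \<Rightarrow> 'e \<Rightarrow> 'e \<Rightarrow> real) \<Rightarrow> ('a, 'e) chart
      \<Rightarrow> 'e \<Rightarrow> 'e \<Rightarrow> 'e \<Rightarrow> real" where
  "local_form M \<omega> c y u v =
     (let x = chart_inv c y in
        \<omega> x (coord_change c (chart_at M x) x u) (coord_change c (chart_at M x) x v))"

(* Forms vanish outside the set of points, so that equality of forms is equality of functions. *)
definition two_form :: "('a, 'e::model_space) manifold \<Rightarrow> ('a \<Rightarrow> 'e \<Rightarrow> 'e \<Rightarrow> real) \<Rightarrow> bool" where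
  "two_form M \<omega> \<longleftrightarrow>
     (\<forall>x\<in>points M. bilinear (\<omega> x) \<and> (\<forall>v. \<omega> x v v = 0)) \<and>
     (\<forall>x. x \<notin> points M \<longrightarrow> (\<forall>u v. \<omega> x u v = 0)) \<and>
     (\<forall>c\<in>atlas M. \<forall>u v. smooth_on (snd c ` fst c) (\<lambda>y. local_form M \<omega> c y u v))"

definition ext_deriv ::
    "('a, 'e::model_space) manifold \<Rightarrow> ('a \<Rightarrow> 'e \<Rightarrow> 'e \<Rightarrow> real) \<Rightarrow> 'a \<Rightarrow> 'e \<Rightarrow> 'e \<Rightarrow> 'e \<Rightarrow> real" where
  "ext_deriv M \<omega> x u v w =
     (let c = chart_at M x;
          D = (\<lambda>a b z. frechet_derivative (\<lambda>y. local_form M \<omega> c y b z) (at (snd c x)) a)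
      in D u v w - D v u w + D w u v)"

definition closed_form :: "('a, 'e::model_space) manifold \<Rightarrow> ('a \<Rightarrow> 'e \<Rightarrow> 'e \<Rightarrow> real) \<Rightarrow> bool" where
  "closed_form M \<omega> \<longleftrightarrow> (\<forall>x\<in>points M. \<forall>u v w. ext_deriv M \<omega> x u v w = 0)"

definition symplectic_form ::
    "('a, 'e::model_space) manifold \<Rightarrow> ('a \<Rightarrow> 'e \<Rightarrow> 'e \<Rightarrow> real) \<Rightarrow> bool" where
  "symplectic_form M \<omega> \<longleftrightarrow> two_form M \<omega> \<and> closed_form M \<omega> \<and>
     (\<forall>x\<in>points M. \<forall>u. (\<forall>v. \<omega> x u v = 0) \<longrightarrow> u = 0)"

definition pullback_form ::
    "('a, 'e::model_space) manifold \<Rightarrow> ('b, 'f::model_space) manifold \<Rightarrow> ('a \<Rightarrow> 'b)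
      \<Rightarrow> ('b \<Rightarrow> 'f \<Rightarrow> 'f \<Rightarrow> real) \<Rightarrow> ('a \<Rightarrow> 'e \<Rightarrow> 'e \<Rightarrow> real)" where
  "pullback_form M N f \<omega> =
     (\<lambda>x u v. if x \<in> points M then \<omega> (f x) (mdiff M N f x u) (mdiff M N f x v) else 0)"

section \<open>Poisson structures\<close>

(* Covectors are linear functionals on the model space; a bivector at a point is an alternating
   bilinear function of covectors (its value on nonlinear arguments is irrelevant). *)
definition bivector :: "(('e::model_space \<Rightarrow> real) \<Rightarrow> ('e \<Rightarrow> real) \<Rightarrow> real) \<Rightarrow> bool" where
  "bivector P \<longleftrightarrow>
     (\<forall>\<alpha> \<beta>. linear \<alpha> \<longrightarrow> linear \<beta> \<longrightarrow> P \<alpha> \<beta> = - P \<beta> \<alpha>) \<and>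
     (\<forall>\<alpha> \<beta> \<gamma> a b. linear \<alpha> \<longrightarrow> linear \<beta> \<longrightarrow> linear \<gamma> \<longrightarrow>
        P (\<lambda>v. a * \<alpha> v + b * \<beta> v) \<gamma> = a * P \<alpha> \<gamma> + b * P \<beta> \<gamma>)"

definition bivector_field ::
    "('a, 'e::model_space) manifold \<Rightarrow> ('a \<Rightarrow> ('e \<Rightarrow> real) \<Rightarrow> ('e \<Rightarrow> real) \<Rightarrow> real) \<Rightarrow> bool" where
  "bivector_field M \<pi> \<longleftrightarrow>
     (\<forall>x\<in>points M. bivector (\<pi> x)) \<and>
     (\<forall>c\<in>atlas M. \<forall>\<alpha> \<beta>. linear \<alpha> \<longrightarrow> linear \<beta> \<longrightarrow>
        smooth_on (snd c ` fst c)
          (\<lambda>y. let x = chart_inv c y in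
             \<pi> x (\<alpha> \<circ> coord_change (chart_at M x) c x) (\<beta> \<circ> coord_change (chart_at M x) c x)))"

definition poisson_bracket ::
    "('a, 'e::model_space) manifold \<Rightarrow> ('a \<Rightarrow> ('e \<Rightarrow> real) \<Rightarrow> ('e \<Rightarrow> real) \<Rightarrow> real)
      \<Rightarrow> ('a \<Rightarrow> real) \<Rightarrow> ('a \<Rightarrow> real) \<Rightarrow> 'a \<Rightarrow> real" where
  "poisson_bracket M \<pi> f g x = \<pi> x (mdiff M real_line f x) (mdiff M real_line g x)"

definition poisson_structure ::
    "('a, 'e::model_space) manifold \<Rightarrow> ('a \<Rightarrow> ('e \<Rightarrow> real) \<Rightarrow> ('e \<Rightarrow> real) \<Rightarrow> real) \<Rightarrow> bool" where
  "poisson_structure M \<pi> \<longleftrightarrow> bivector_field M \<pi> \<and>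
     (\<forall>f g h. smooth_map M real_line f \<longrightarrow> smooth_map M real_line g \<longrightarrow> smooth_map M real_line h \<longrightarrow>
        (\<forall>x\<in>points M.
           poisson_bracket M \<pi> f (poisson_bracket M \<pi> g h) x +
           poisson_bracket M \<pi> g (poisson_bracket M \<pi> h f) x +
           poisson_bracket M \<pi> h (poisson_bracket M \<pi> f g) x = 0))"

(* i_alpha pi, i.e. the vector v with beta(v) = pi(alpha, beta) *)
definition sharp :: "(('e::model_space \<Rightarrow> real) \<Rightarrow> ('e \<Rightarrow> real) \<Rightarrow> real) \<Rightarrow> ('e \<Rightarrow> real) \<Rightarrow> 'e" where
  "sharp P \<alpha> = (THE v. \<forall>\<beta>. linear \<beta> \<longrightarrow> \<beta> v = P \<alpha> \<beta>)"

(* Sign convention: the bivector of omega has sharp map inverse to v |-> omega(v, .), so that the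
   graphs {(v, i_v omega)} and {(sharp alpha, alpha)} coincide. *)
definition symplectic_bivector ::
    "('a \<Rightarrow> 'e::model_space \<Rightarrow> 'e \<Rightarrow> real) \<Rightarrow> 'a \<Rightarrow> ('e \<Rightarrow> real) \<Rightarrow> ('e \<Rightarrow> real) \<Rightarrow> real" where
  "symplectic_bivector \<omega> x \<alpha> \<beta> = \<beta> (THE v. \<forall>w. \<omega> x v w = \<alpha> w)"

definition poisson_map ::
    "('a, 'e::model_space) manifold \<Rightarrow> ('a \<Rightarrow> ('e \<Rightarrow> real) \<Rightarrow> ('e \<Rightarrow> real) \<Rightarrow> real)
      \<Rightarrow> ('b, 'f::model_space) manifold \<Rightarrow> ('b \<Rightarrow> ('f \<Rightarrow> real) \<Rightarrow> ('f \<Rightarrow> real) \<Rightarrow> real)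
      \<Rightarrow> ('a \<Rightarrow> 'b) \<Rightarrow> bool" where
  "poisson_map M \<pi>M N \<pi>N \<phi> \<longleftrightarrow> smooth_map M N \<phi> \<and>
     (\<forall>f g. smooth_map N real_line f \<longrightarrow> smooth_map N real_line g \<longrightarrow>
        (\<forall>x\<in>points M.
           poisson_bracket M \<pi>M (f \<circ> \<phi>) (g \<circ> \<phi>) x = poisson_bracket N \<pi>N f g (\<phi> x)))"

section \<open>Subsets of the generalized tangent bundle\<close>

(* A triple (x, X, alpha) stands for the element (X, alpha) of the fibre over x. *)
type_synonym ('a, 'e) gtangent = "'a \<times> 'e \<times> ('e \<Rightarrow> real)"

definition poisson_graph ::
    "('a, 'e::model_space) manifold \<Rightarrow> ('a \<Rightarrow> ('e \<Rightarrow> real) \<Rightarrow> ('e \<Rightarrow> real) \<Rightarrow> real)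
      \<Rightarrow> ('a, 'e) gtangent set" where
  "poisson_graph M \<pi> = {(x, sharp (\<pi> x) \<alpha>, \<alpha>) | x \<alpha>. x \<in> points M \<and> linear \<alpha>}"

definition dirac_pullback ::
    "('a, 'e::model_space) manifold \<Rightarrow> ('b, 'f::model_space) manifold \<Rightarrow> ('a \<Rightarrow> 'b)
      \<Rightarrow> ('b, 'f) gtangent set \<Rightarrow> ('a, 'e) gtangent set" where
  "dirac_pullback M N q F =
     {(x, X, \<beta> \<circ> mdiff M N q x) | x X \<beta>. x \<in> points M \<and> (q x, mdiff M N q x X, \<beta>) \<in> F}"

section \<open>Lie groups, actions and principal bundles\<close>

record ('h, 'eh) lie_grp = "'h monoid" +
  mfd :: "('h, 'eh) manifold"

definition lie_group :: "('h, 'eh::model_space) lie_grp \<Rightarrow> bool" where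
  "lie_group H \<longleftrightarrow> group H \<and> smooth_manifold (mfd H) \<and> points (mfd H) = carrier H \<and>
     smooth_map (prod_manifold (mfd H) (mfd H)) (mfd H) (\<lambda>(h, k). h \<otimes>\<^bsub>H\<^esub> k) \<and>
     smooth_map (mfd H) (mfd H) (\<lambda>h. inv\<^bsub>H\<^esub> h)"

definition one_parameter_subgroup ::
    "('h, 'eh::model_space) lie_grp \<Rightarrow> 'eh \<Rightarrow> (real \<Rightarrow> 'h) \<Rightarrow> bool" where
  "one_parameter_subgroup H u \<gamma> \<longleftrightarrow> smooth_map real_line (mfd H) \<gamma> \<and>
     (\<forall>s t. \<gamma> (s + t) = \<gamma> s \<otimes>\<^bsub>H\<^esub> \<gamma> t) \<and> velocity (mfd H) \<gamma> 0 = u"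

(* The Lie algebra is the tangent space at the identity, i.e. 'eh via the preferred chart. *)
definition lie_exp :: "('h, 'eh::model_space) lie_grp \<Rightarrow> 'eh \<Rightarrow> 'h" where
  "lie_exp H u = (THE \<gamma>. one_parameter_subgroup H u \<gamma>) 1"

definition smooth_action ::
    "('h, 'eh::model_space) lie_grp \<Rightarrow> ('m, 'em::model_space) manifold \<Rightarrow> ('h \<Rightarrow> 'm \<Rightarrow> 'm) \<Rightarrow> bool" where
  "smooth_action H M act \<longleftrightarrow>
     smooth_map (prod_manifold (mfd H) M) M (\<lambda>(h, x). act h x) \<and>
     (\<forall>x\<in>points M. act \<one>\<^bsub>H\<^esub> x = x) \<and>
     (\<forall>h\<in>carrier H. \<forall>k\<in>carrier H. \<forall>x\<in>points M. act (h \<otimes>\<^bsub>H\<^esub> k) x = act h (act k x))"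

definition fundamental_field ::
    "('h, 'eh::model_space) lie_grp \<Rightarrow> ('m, 'em::model_space) manifold \<Rightarrow> ('h \<Rightarrow> 'm \<Rightarrow> 'm)
      \<Rightarrow> 'eh \<Rightarrow> 'm \<Rightarrow> 'em" where
  "fundamental_field H M act u x = velocity M (\<lambda>\<epsilon>. act (lie_exp H (\<epsilon> *\<^sub>R u)) x) 0"

definition principal_bundle ::
    "('h, 'eh::model_space) lie_grp \<Rightarrow> ('m, 'em::model_space) manifold
      \<Rightarrow> ('n, 'en::model_space) manifold \<Rightarrow> ('h \<Rightarrow> 'm \<Rightarrow> 'm) \<Rightarrow> ('m \<Rightarrow> 'n) \<Rightarrow> bool" where
  "principal_bundle H M N act q \<longleftrightarrow>
     lie_group H \<and> smooth_manifold M \<and> smooth_manifold N \<and> smooth_action H M act \<and>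
     smooth_map M N q \<and> (\<forall>h\<in>carrier H. \<forall>x\<in>points M. q (act h x) = q x) \<and>
     (\<forall>y\<in>points N. \<exists>V \<tau>. openin (mtop N) V \<and> y \<in> V \<and>
        diffeomorphism (open_submanifold M {x \<in> points M. q x \<in> V})
          (prod_manifold (open_submanifold N V) (mfd H)) (\<lambda>x. (q x, \<tau> x)) \<and>
        (\<forall>h\<in>carrier H. \<forall>x\<in>points M. q x \<in> V \<longrightarrow> \<tau> (act h x) = h \<otimes>\<^bsub>H\<^esub> \<tau> x))"

section \<open>Lie groupoids\<close>

record ('g, 'eg, 'm, 'em) groupoid =
  arr :: "('g, 'eg) manifold"
  obj :: "('m, 'em) manifold"
  src :: "'g \<Rightarrow> 'm"
  tgt :: "'g \<Rightarrow> 'm"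
  mul :: "'g \<Rightarrow> 'g \<Rightarrow> 'g"
  idn :: "'m \<Rightarrow> 'g"
  ginv :: "'g \<Rightarrow> 'g"

definition composable :: "('g, 'eg, 'm, 'em) groupoid \<Rightarrow> ('g \<times> 'g) set" where
  "composable G = {(g, h). g \<in> points (arr G) \<and> h \<in> points (arr G) \<and> src G g = tgt G h}"

definition lie_groupoid :: "('g, 'eg::model_space, 'm, 'em::model_space) groupoid \<Rightarrow> bool" where
  "lie_groupoid G \<longleftrightarrow>
     smooth_manifold (arr G) \<and> smooth_manifold (obj G) \<and>
     submersion (arr G) (obj G) (src G) \<and> submersion (arr G) (obj G) (tgt G) \<and>
     smooth_map (obj G) (arr G) (idn G) \<and> smooth_map (arr G) (arr G) (ginv G) \<and>
     smooth_map_on_subset (prod_manifold (arr G) (arr G)) (composable G) (arr G)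
       (\<lambda>(g, h). mul G g h) \<and>
     (\<forall>(g, h)\<in>composable G. mul G g h \<in> points (arr G) \<and>
        src G (mul G g h) = src G h \<and> tgt G (mul G g h) = tgt G g) \<and>
     (\<forall>g h k. (g, h) \<in> composable G \<longrightarrow> (h, k) \<in> composable G \<longrightarrow>
        mul G (mul G g h) k = mul G g (mul G h k)) \<and>
     (\<forall>x\<in>points (obj G). src G (idn G x) = x \<and> tgt G (idn G x) = x) \<and>
     (\<forall>g\<in>points (arr G). mul G g (idn G (src G g)) = g \<and> mul G (idn G (tgt G g)) g = g) \<and>
     (\<forall>g\<in>points (arr G). src G (ginv G g) = tgt G g \<and> tgt G (ginv G g) = src G g \<and>
        mul G g (ginv G g) = idn G (tgt G g) \<and> mul G (ginv G g) g = idn G (src G g))"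

definition lie_groupoid_morphism ::
    "('g, 'eg::model_space, 'm, 'em::model_space) groupoid
      \<Rightarrow> ('k, 'ek::model_space, 'n, 'en::model_space) groupoid \<Rightarrow> ('g \<Rightarrow> 'k) \<Rightarrow> ('m \<Rightarrow> 'n) \<Rightarrow> bool" where
  "lie_groupoid_morphism G K \<Phi> f \<longleftrightarrow>
     smooth_map (arr G) (arr K) \<Phi> \<and> smooth_map (obj G) (obj K) f \<and>
     (\<forall>g\<in>points (arr G). src K (\<Phi> g) = f (src G g) \<and> tgt K (\<Phi> g) = f (tgt G g)) \<and>
     (\<forall>(g, h)\<in>composable G. \<Phi> (mul G g h) = mul K (\<Phi> g) (\<Phi> h)) \<and>
     (\<forall>x\<in>points (obj G). \<Phi> (idn G x) = idn K (f x))"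

definition action_groupoid ::
    "('h, 'eh) lie_grp \<Rightarrow> ('m, 'em) manifold \<Rightarrow> ('h \<Rightarrow> 'm \<Rightarrow> 'm)
      \<Rightarrow> ('h \<times> 'm, 'eh \<times> 'em, 'm, 'em) groupoid" where
  "action_groupoid H M act =
     \<lparr>arr = prod_manifold (mfd H) M,
      obj = M,
      src = snd,
      tgt = (\<lambda>(h, x). act h x),
      mul = (\<lambda>(k, y) (h, x). (k \<otimes>\<^bsub>H\<^esub> h, x)),
      idn = (\<lambda>x. (\<one>\<^bsub>H\<^esub>, x)),
      ginv = (\<lambda>(h, x). (inv\<^bsub>H\<^esub> h, act h x))\<rparr>"

definition algebroid :: "('g, 'eg::model_space, 'm, 'em::model_space) groupoid \<Rightarrow> 'm \<Rightarrow> 'eg set" where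
  "algebroid G x = {a. mdiff (arr G) (obj G) (src G) (idn G x) a = 0}"

definition anchor ::
    "('g, 'eg::model_space, 'm, 'em::model_space) groupoid \<Rightarrow> 'm \<Rightarrow> 'eg \<Rightarrow> 'em" where
  "anchor G x a = mdiff (arr G) (obj G) (tgt G) (idn G x) a"

section \<open>Pre-symplectic and symplectic groupoids\<close>

definition mu_map ::
    "('g, 'eg::model_space, 'm, 'em::model_space) groupoid \<Rightarrow> ('g \<Rightarrow> 'eg \<Rightarrow> 'eg \<Rightarrow> real)
      \<Rightarrow> 'm \<Rightarrow> 'eg \<Rightarrow> 'em \<Rightarrow> real" where
  "mu_map G \<omega> x a = (\<lambda>v. \<omega> (idn G x) a (mdiff (obj G) (arr G) (idn G) x v))"

definition delta_map ::
    "('g, 'eg::model_space, 'm, 'em::model_space) groupoid \<Rightarrow> ('g \<Rightarrow> 'eg \<Rightarrow> 'eg \<Rightarrow> real)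
      \<Rightarrow> 'm \<Rightarrow> 'eg \<Rightarrow> 'em \<times> ('em \<Rightarrow> real)" where
  "delta_map G \<omega> x a = (anchor G x a, mu_map G \<omega> x a)"

(* The tangent space of the submanifold of composable pairs at (g, h) consists of the (u, v) with
   ds(u) = dt(v). *)
definition multiplicative ::
    "('g, 'eg::model_space, 'm, 'em::model_space) groupoid \<Rightarrow> ('g \<Rightarrow> 'eg \<Rightarrow> 'eg \<Rightarrow> real) \<Rightarrow> bool" where
  "multiplicative G \<omega> \<longleftrightarrow>
     (\<forall>(g, h)\<in>composable G.
        let T = {(u, v). mdiff (arr G) (obj G) (src G) g u = mdiff (arr G) (obj G) (tgt G) h v};
            dm = mdiff_within (prod_manifold (arr G) (arr G)) (composable G) (arr G)
                   (\<lambda>(g, h). mul G g h) (g, h)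
        in \<forall>(u, v)\<in>T. \<forall>(u', v')\<in>T.
             \<omega> (mul G g h) (dm (u, v)) (dm (u', v')) = \<omega> g u u' + \<omega> h v v')"

definition presymplectic_groupoid ::
    "('g, 'eg::model_space, 'm, 'em::model_space) groupoid \<Rightarrow> ('g \<Rightarrow> 'eg \<Rightarrow> 'eg \<Rightarrow> real) \<Rightarrow> bool" where
  "presymplectic_groupoid G \<omega> \<longleftrightarrow>
     lie_groupoid G \<and> two_form (arr G) \<omega> \<and> closed_form (arr G) \<omega> \<and> multiplicative G \<omega> \<and>
     dim (UNIV :: 'eg set) = 2 * dim (UNIV :: 'em set) \<and>
     (\<forall>x\<in>points (obj G). inj_on (delta_map G \<omega> x) (algebroid G x))"

definition integrated_dirac ::
    "('g, 'eg::model_space, 'm, 'em::model_space) groupoid \<Rightarrow> ('g \<Rightarrow> 'eg \<Rightarrow> 'eg \<Rightarrow> real)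
      \<Rightarrow> ('m, 'em) gtangent set" where
  "integrated_dirac G \<omega> =
     {(x, delta_map G \<omega> x a) | x a. x \<in> points (obj G) \<and> a \<in> algebroid G x}"

definition symplectic_groupoid_integrating ::
    "('g, 'eg::model_space, 'm, 'em::model_space) groupoid \<Rightarrow> ('g \<Rightarrow> 'eg \<Rightarrow> 'eg \<Rightarrow> real)
      \<Rightarrow> ('m, 'em) manifold \<Rightarrow> ('m \<Rightarrow> ('em \<Rightarrow> real) \<Rightarrow> ('em \<Rightarrow> real) \<Rightarrow> real) \<Rightarrow> bool" where
  "symplectic_groupoid_integrating G \<omega> N \<pi> \<longleftrightarrow>
     lie_groupoid G \<and> obj G = N \<and> symplectic_form (arr G) \<omega> \<and> multiplicative G \<omega> \<and>
     poisson_map (arr G) (symplectic_bivector \<omega>) N \<pi> (tgt G)"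

section \<open>Admissibility and the quotient by the structure group\<close>

(* Psi integrates psi(u, x) = (u_M(x), 0): the Lie algebroid of the action groupoid at x consists of
   the vectors (u, 0) at (1, x), and Lie(Psi) is the restriction of the differential of Psi. *)
definition integrates_infinitesimal_action ::
    "('h, 'eh::model_space) lie_grp \<Rightarrow> ('m, 'em::model_space) manifold \<Rightarrow> ('h \<Rightarrow> 'm \<Rightarrow> 'm)
      \<Rightarrow> ('g, 'eg::model_space, 'm, 'em) groupoid \<Rightarrow> ('g \<Rightarrow> 'eg \<Rightarrow> 'eg \<Rightarrow> real)
      \<Rightarrow> ('h \<times> 'm \<Rightarrow> 'g) \<Rightarrow> bool" where
  "integrates_infinitesimal_action H M act G \<omega> \<Psi> \<longleftrightarrow>
     lie_groupoid_morphism (action_groupoid H M act) G \<Psi> id \<and>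
     (\<forall>x\<in>points M. \<forall>u.
        delta_map G \<omega> x (mdiff (prod_manifold (mfd H) M) (arr G) \<Psi> (\<one>\<^bsub>H\<^esub>, x) (u, 0)) =
          (fundamental_field H M act u x, (\<lambda>_. 0)))"

definition double_action ::
    "('g, 'eg, 'm, 'em) groupoid \<Rightarrow> ('h \<times> 'm \<Rightarrow> 'g) \<Rightarrow> 'h \<times> 'h \<Rightarrow> 'g \<Rightarrow> 'g" where
  "double_action G \<Psi> = (\<lambda>(h1, h2) g.
     mul G (mul G (\<Psi> (h1, tgt G g)) g) (ginv G (\<Psi> (h2, src G g))))"

(* H-admissibility, with the integrating morphism Psi as an explicit witness, since the action of
   H x H on G depends on it. *)
definition H_admissible ::
    "('h, 'eh::model_space) lie_grp \<Rightarrow> ('m, 'em::model_space) manifold \<Rightarrow> ('h \<Rightarrow> 'm \<Rightarrow> 'm)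
      \<Rightarrow> ('g, 'eg::model_space, 'm, 'em) groupoid \<Rightarrow> ('g \<Rightarrow> 'eg \<Rightarrow> 'eg \<Rightarrow> real)
      \<Rightarrow> ('h \<times> 'm \<Rightarrow> 'g) \<Rightarrow> bool" where
  "H_admissible H M act G \<omega> \<Psi> \<longleftrightarrow>
     integrates_infinitesimal_action H M act G \<omega> \<Psi> \<and>
     (\<forall>h1\<in>carrier H. \<forall>h2\<in>carrier H.
        pullback_form (arr G) (arr G) (double_action G \<Psi> (h1, h2)) \<omega> = \<omega>)"

definition orbit_map ::
    "('h, 'eh) lie_grp \<Rightarrow> ('g, 'eg, 'm, 'em) groupoid \<Rightarrow> ('h \<times> 'm \<Rightarrow> 'g) \<Rightarrow> 'g \<Rightarrow> 'g set" where
  "orbit_map H G \<Psi> g = (\<lambda>h. double_action G \<Psi> h g) ` (carrier H \<times> carrier H)"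

(* Q is the Lie groupoid structure over N carried by the set of (H x H)-orbits. The submersion
   property of the orbit map determines the topology and the smooth structure of Q, and the
   morphism property determines its structure maps. *)
definition quotient_groupoid ::
    "('h, 'eh::model_space) lie_grp \<Rightarrow> ('g, 'eg::model_space, 'm, 'em::model_space) groupoid
      \<Rightarrow> ('h \<times> 'm \<Rightarrow> 'g) \<Rightarrow> ('n, 'en::model_space) manifold \<Rightarrow> ('m \<Rightarrow> 'n)
      \<Rightarrow> ('g set, 'eq::model_space, 'n, 'en) groupoid \<Rightarrow> bool" where
  "quotient_groupoid H G \<Psi> N q Q \<longleftrightarrow>
     lie_groupoid Q \<and> obj Q = N \<and> points (arr Q) = orbit_map H G \<Psi> ` points (arr G) \<and>
     submersion (arr G) (arr Q) (orbit_map H G \<Psi>) \<and>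
     lie_groupoid_morphism G Q (orbit_map H G \<Psi>) q"

end

theory Submission
  imports Defs
begin

text \<open>
  Write \<open>p\<close> for the quotient map \<open>\<G> \<rightarrow> \<G>/(H \<times> H)\<close>. The form descends along \<open>p\<close> because it is basic:
  it is invariant, and the kernel of \<open>dp\<close> is contained in the kernel of \<open>\<omega>\<close>. For the second property,
  a vector in \<open>ker dp\<close> at \<open>g\<close> is the velocity of a curve \<open>h\<^sub>1 \<cdot> g \<cdot> h\<^sub>2\<^sup>-\<^sup>1\<close>; local trivializations of
  \<open>M \<rightarrow> M/H\<close> at the target and the source recover \<open>h\<^sub>1\<close> and \<open>h\<^sub>2\<close> smoothly from the curve. The vector
  is therefore a sum of a right translate of \<open>d\<Psi>(u\<^sub>1)\<close> and a left translate of the inverse of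
  \<open>d\<Psi>(u\<^sub>2)\<close>. Multiplicativity expresses \<open>\<omega>\<close> on translated vectors by \<open>\<mu>\<^sub>\<omega>\<close>, and \<open>\<mu>\<^sub>\<omega>(d\<Psi>(u)) = 0\<close>
  since \<open>d\<Psi>(u)\<close> corresponds to \<open>(u\<^sub>M, 0)\<close> (\<open>orbit_directions_in_kernel\<close>, \<open>form_descends\<close>). Smoothness
  and closedness of the descended form \<open>\<beta>\<close> are local; along a smooth local section \<open>s\<close> of the submersion
  \<open>p\<close> one has \<open>\<beta> = s\<^sup>*\<omega>\<close>, and pullbacks commute with \<open>d\<close> by the symmetry of second derivatives
  (\<open>submersion_section_in_charts\<close>, \<open>closed_pullback\<close>). Uniqueness holds since \<open>p\<close> and \<open>dp\<close> are onto.

  Multiplicativity of \<open>\<beta>\<close> follows from that of \<open>\<omega>\<close>, as composable pairs and their tangent vectors lift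
  through \<open>p\<close>. The Dirac structure enters through \<open>\<mu>\<^sub>\<beta> : A(\<G>/(H \<times> H)) \<rightarrow> T\<^sup>*(M/H)\<close>. Since
  \<open>\<delta>\<^sub>\<omega>(A) = q\<^sup>! gr(\<pi>)\<close>, every covector \<open>\<gamma>\<close> is \<open>\<mu>\<^sub>\<beta>(a)\<close> for some \<open>a\<close> with anchor \<open>\<pi>\<^sup>\<sharp>(\<gamma>)\<close>; and if
  \<open>\<mu>\<^sub>\<beta>(a) = 0\<close> then a lift of \<open>a\<close> has vertical anchor, so it equals \<open>d\<Psi>(u)\<close> by injectivity of
  \<open>\<delta>\<^sub>\<omega>\<close> and \<open>a = 0\<close> (\<open>mu_surjective\<close>, \<open>mu_injective\<close>). Hence \<open>\<mu>\<^sub>\<beta>\<close> is an isomorphism, and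
  translations propagate this to nondegeneracy of \<open>\<beta>\<close> at all arrows (\<open>multiplicative_form.nondegenerate\<close>).
  The Hamiltonian vector field of \<open>f \<circ> t\<close> is the right-invariant field of the section \<open>a\<close> with
  \<open>\<mu>\<^sub>\<beta>(a) = df\<close>; the target map sends it to the anchor \<open>\<pi>\<^sup>\<sharp>(df)\<close>, which is the Poisson property.

  Curves and tangent spaces of submanifolds are replaced throughout by maps with prescribed differential at
  one point. They come from maps that adjust the points near a given one so as to lie in prescribed fibres of
  a submersion, which rest on the inverse function theorem for smooth maps between model spaces
  (\<open>smooth_inverse_function\<close>, \<open>submersion_fibre_adjustment\<close>).
\<close>

section \<open>Linear algebra of model spaces\<close>

text \<open>Unlike \<open>Basis\<close>, this orthonormal basis exists for all model spaces: it is empty in dimension 0.\<close>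

definition onb :: "'e::model_space set" where
  "onb = (SOME B. finite B \<and> span B = UNIV \<and> (\<forall>b\<in>B. \<forall>b'\<in>B. b \<bullet> b' = (if b = b' then 1 else 0)))"

lemma onb: "finite (onb :: 'e::model_space set)" "span (onb :: 'e set) = UNIV"
  "\<And>b b'. b \<in> (onb :: 'e set) \<Longrightarrow> b' \<in> onb \<Longrightarrow> b \<bullet> b' = (if b = b' then 1 else 0)"
proof -
  obtain B0 :: "'e set" where "finite B0" "span B0 = UNIV"
    using finite_dimensional unfolding model_space_iff_span by blast
  then obtain C :: "'e set" where C: "finite C" "span C = UNIV" "pairwise orthogonal C"
    using basis_orthogonal by metis
  define B where "B = (\<lambda>c. c /\<^sub>R norm c) ` (C - {0})"
  have "finite B" using C(1) by (simp add: B_def)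
  moreover have "c \<in> span B" if "c \<in> C" for c
  proof (cases "c = 0")
    case False
    then have "c /\<^sub>R norm c \<in> B" using that by (auto simp: B_def)
    then have "norm c *\<^sub>R (c /\<^sub>R norm c) \<in> span B" by (intro span_scale span_base)
    with False show ?thesis by simp
  qed (simp add: span_zero)
  then have "span C \<subseteq> span B" by (intro span_minimal) auto
  then have "span B = UNIV" using C(2) by auto
  moreover have "b \<bullet> b' = (if b = b' then 1 else 0)" if bB: "b \<in> B" "b' \<in> B" for b b'
  proof -
    obtain c c' where c: "c \<in> C" "c \<noteq> 0" "b = c /\<^sub>R norm c" "c' \<in> C" "c' \<noteq> 0" "b' = c' /\<^sub>R norm c'"
      using bB unfolding B_def by blast
    show ?thesis
    proof (cases "c = c'")
      case True
      then show ?thesis using c by (simp add: field_simps dot_square_norm power2_eq_square)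
    next
      case False
      then have "c \<bullet> c' = 0" using C(3) c by (auto simp: pairwise_def orthogonal_def)
      then have "b \<bullet> b' = 0" by (simp add: c)
      moreover have "b \<bullet> b \<noteq> 0" using c by simp
      ultimately show ?thesis by metis
    qed
  qed
  ultimately have "\<exists>B. finite B \<and> span B = (UNIV :: 'e set) \<and>
      (\<forall>b\<in>B. \<forall>b'\<in>B. b \<bullet> b' = (if b = b' then 1 else 0))" by blast
  from someI_ex[OF this, folded onb_def]
  show "finite (onb :: 'e::model_space set)" "span (onb :: 'e set) = UNIV"
    "\<And>b b'. b \<in> (onb :: 'e set) \<Longrightarrow> b' \<in> onb \<Longrightarrow> b \<bullet> b' = (if b = b' then 1 else 0)"
    by blast+
qed

lemma onb_expansion: "(\<Sum>b\<in>onb. (x \<bullet> b) *\<^sub>R b) = (x :: 'e::model_space)"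
proof -
  have "x \<in> span onb" using onb(2) by auto
  then obtain c where x: "x = (\<Sum>b\<in>onb. c b *\<^sub>R b)"
    unfolding span_finite[OF onb(1)] by blast
  have "x \<bullet> b = c b" if "b \<in> onb" for b
  proof -
    have "x \<bullet> b = (\<Sum>a\<in>onb. c a * (a \<bullet> b))" by (simp add: x inner_sum_left)
    also have "\<dots> = (\<Sum>a\<in>onb. if a = b then c a else 0)"
      using that by (intro sum.cong) (auto simp: onb(3))
    also have "\<dots> = c b" using that by (simp add: onb(1))
    finally show ?thesis .
  qed
  then show ?thesis by (subst (2) x) (simp cong: sum.cong)
qed

lemma linear_expansion:
  assumes "linear (f :: 'e::model_space \<Rightarrow> 'f::real_vector)"
  shows "f x = (\<Sum>b\<in>onb. (x \<bullet> b) *\<^sub>R f b)"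
proof -
  have "f x = f (\<Sum>b\<in>onb. (x \<bullet> b) *\<^sub>R b)" by (simp add: onb_expansion)
  also have "\<dots> = (\<Sum>b\<in>onb. (x \<bullet> b) *\<^sub>R f b)"
    by (simp add: linear_sum[OF assms] linear_scale[OF assms])
  finally show ?thesis .
qed

lemma linear_bounded:
  assumes "linear (f :: 'e::model_space \<Rightarrow> 'f::real_normed_vector)"
  shows "bounded_linear f"
proof -
  have "bounded_linear (\<lambda>x. \<Sum>b\<in>onb. (x \<bullet> b) *\<^sub>R f b)"
    by (intro bounded_linear_sum bounded_linear_scaleR_left[THEN bounded_linear_compose]
        bounded_linear_inner_left)
  then show ?thesis by (simp add: linear_expansion[OF assms, symmetric])
qed

lemma linear_has_derivative:
  assumes "linear (f :: 'e::model_space \<Rightarrow> 'f::real_normed_vector)"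
  shows "(f has_derivative f) (at x within S)"
  using linear_bounded[OF assms] by (rule bounded_linear_imp_has_derivative)

lemma complete_model_space: "complete (UNIV :: 'e::model_space set)"
proof (unfold complete_def, intro allI impI)
  fix X :: "nat \<Rightarrow> 'e"
  assume "(\<forall>n. X n \<in> UNIV) \<and> Cauchy X"
  then have "Cauchy (\<lambda>n. X n \<bullet> b)" for b
    using bounded_linear.Cauchy[OF bounded_linear_inner_left] by blast
  then have "\<exists>l. (\<lambda>n. X n \<bullet> b) \<longlonglongrightarrow> l" for b
    using real_Cauchy_convergent convergent_def by blast
  then obtain l where l: "\<And>b. (\<lambda>n. X n \<bullet> b) \<longlonglongrightarrow> l b" by metis
  have "(\<lambda>n. \<Sum>b\<in>onb. (X n \<bullet> b) *\<^sub>R b) \<longlonglongrightarrow> (\<Sum>b\<in>onb. l b *\<^sub>R b)"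
    by (intro tendsto_intros l)
  then show "\<exists>l\<in>UNIV. X \<longlonglongrightarrow> l" by (auto simp: onb_expansion)
qed

text \<open>The values of a functional \<open>P\<close> at the coordinate functionals are the coordinates of the vector
  that represents it.\<close>

lemma reflexive_dual:
  fixes P :: "('e::model_space \<Rightarrow> real) \<Rightarrow> real"
  assumes P: "\<And>\<alpha> \<beta> a b. linear \<alpha> \<Longrightarrow> linear \<beta> \<Longrightarrow> P (\<lambda>v. a * \<alpha> v + b * \<beta> v) = a * P \<alpha> + b * P \<beta>"
  shows "\<exists>v. \<forall>\<beta>. linear \<beta> \<longrightarrow> \<beta> v = P \<beta>"
proof -
  have lin: "linear (\<lambda>v :: 'e. \<Sum>b\<in>B. c b * (v \<bullet> b))" for B c
    by (intro linearI)
      (auto simp: inner_add_left sum.distrib algebra_simps sum_distrib_left)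
  have z: "P (\<lambda>v. 0) = 0"
    using P[of "\<lambda>v. 0" "\<lambda>v. 0" 0 0] by (simp add: linear_zero)
  have sum: "P (\<lambda>v. \<Sum>b\<in>B. c b * (v \<bullet> b)) = (\<Sum>b\<in>B. c b * P (\<lambda>v. v \<bullet> b))"
    if "finite B" for B :: "'e set" and c
    using that
  proof (induction B)
    case (insert b B)
    have l1: "linear (\<lambda>v. v \<bullet> b)" by (rule bounded_linear.linear[OF bounded_linear_inner_left])
    show ?case using insert P[OF l1 lin[of c B], of "c b" 1] by simp
  qed (simp add: z)
  define v where "v = (\<Sum>b\<in>onb. P (\<lambda>v. v \<bullet> b) *\<^sub>R b)"
  have "\<beta> v = P \<beta>" if \<beta>: "linear \<beta>" for \<beta>
  proof -
    have "\<beta> = (\<lambda>v. \<Sum>b\<in>onb. \<beta> b * (v \<bullet> b))"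
    proof
      show "\<beta> v = (\<Sum>b\<in>onb. \<beta> b * (v \<bullet> b))" for v
        by (rule trans[OF linear_expansion[OF \<beta>]]) (simp add: mult.commute)
    qed
    then have "P \<beta> = P (\<lambda>v. \<Sum>b\<in>onb. \<beta> b * (v \<bullet> b))" by (rule arg_cong)
    also have "\<dots> = (\<Sum>b\<in>onb. \<beta> b * P (\<lambda>v. v \<bullet> b))" by (rule sum[OF onb(1)])
    also have "\<dots> = \<beta> v"
      by (simp add: v_def linear_sum[OF \<beta>] linear_scale[OF \<beta>] mult.commute)
    finally show ?thesis by (rule sym)
  qed
  then show ?thesis by blast
qed

lemma linear_functionals_separate:
  assumes "\<And>\<beta>. linear \<beta> \<Longrightarrow> \<beta> v = (\<beta> w :: real)"
  shows "v = (w :: 'e::model_space)"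
  using assms[OF bounded_linear.linear[OF bounded_linear_inner_left], of "v - w"]
  by (metis diff_self inner_eq_zero_iff inner_diff_left right_minus_eq)

section \<open>Calculus of smooth functions\<close>

lemma C_k_on_cong:
  assumes "open S" "\<And>x. x \<in> S \<Longrightarrow> f x = g x"
  shows "C_k_on k S f \<longleftrightarrow> C_k_on k S g"
  using assms(2)
proof (induction k arbitrary: f g)
  case 0
  then show ?case by (simp cong: continuous_on_cong)
next
  case (Suc k)
  have d: "(f has_derivative D) (at x) \<longleftrightarrow> (g has_derivative D) (at x)" if "x \<in> S" for x D
    using has_derivative_transform_within_open[OF _ assms(1) that] Suc.prems by metis
  then have "frechet_derivative f (at x) = frechet_derivative g (at x)" if "x \<in> S" for x
    using that by (simp add: frechet_derivative_def)
  then have "C_k_on k S (\<lambda>x. frechet_derivative f (at x) v) \<longleftrightarrow>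
      C_k_on k S (\<lambda>x. frechet_derivative g (at x) v)" for v
    by (intro Suc.IH) simp
  then show ?case using d by (simp add: differentiable_def)
qed

lemma C_k_on_Suc_D: "C_k_on (Suc k) S f \<Longrightarrow> C_k_on k S f"
proof (induction k arbitrary: f)
  case 0
  then have "f differentiable_on S" by (simp add: differentiable_on_def differentiable_at_withinI)
  then show ?case by (simp add: differentiable_imp_continuous_on)
next
  case (Suc k)
  then show ?case by (metis C_k_on.simps(2))
qed

lemma C_k_on_subset: "C_k_on k S f \<Longrightarrow> T \<subseteq> S \<Longrightarrow> C_k_on k T f"
  by (induction k arbitrary: f) (auto intro: continuous_on_subset)

lemma C_k_on_local:
  assumes "\<And>x. x \<in> S \<Longrightarrow> \<exists>T. open T \<and> x \<in> T \<and> C_k_on k T f"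
  shows "C_k_on k S f"
  using assms
proof (induction k arbitrary: f)
  case 0
  show ?case unfolding C_k_on.simps continuous_on_eq_continuous_within
  proof
    fix x assume "x \<in> S"
    then obtain T where "open T" "x \<in> T" "C_k_on 0 T f" using 0 by blast
    then have "isCont f x" by (auto simp: continuous_on_eq_continuous_at)
    then show "continuous (at x within S) f" by (rule continuous_at_imp_continuous_at_within)
  qed
next
  case (Suc k)
  have "f differentiable (at x)" if "x \<in> S" for x using Suc.prems[OF that] by auto
  moreover have "C_k_on k S (\<lambda>x. frechet_derivative f (at x) v)" for v
  proof (rule Suc.IH)
    fix x assume "x \<in> S"
    from Suc.prems[OF this] obtain T where "open T" "x \<in> T" "C_k_on (Suc k) T f" by blast
    then show "\<exists>T. open T \<and> x \<in> T \<and> C_k_on k T (\<lambda>x. frechet_derivative f (at x) v)" by auto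
  qed
  ultimately show ?case by simp
qed

lemma C_k_on_Suc_I:
  assumes "open S" "\<And>x. x \<in> S \<Longrightarrow> (f has_derivative D x) (at x)"
    and "\<And>v. C_k_on k S (\<lambda>x. D x v)"
  shows "C_k_on (Suc k) S f"
proof -
  have "frechet_derivative f (at x) = D x" if "x \<in> S" for x
    using frechet_derivative_at[OF assms(2)[OF that]] by simp
  then have "C_k_on k S (\<lambda>x. frechet_derivative f (at x) v)" for v
    using C_k_on_cong[OF assms(1), of "\<lambda>x. frechet_derivative f (at x) v" "\<lambda>x. D x v" k] assms(3)
    by simp
  moreover have "f differentiable (at x)" if "x \<in> S" for x
    using assms(2)[OF that] by (auto simp: differentiable_def)
  ultimately show ?thesis by simp
qed

lemma C_k_on_Suc_derivative:
  assumes "C_k_on (Suc k) S f" "x \<in> S"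
  shows "(f has_derivative frechet_derivative f (at x)) (at x)"
  using assms frechet_derivative_works by auto

lemma C_k_on_const: "C_k_on k S (\<lambda>x. c)"
  by (induction k arbitrary: c) (auto intro!: continuous_on_const continuous_on_add continuous_on_scaleR)

lemma C_k_on_linear:
  assumes "linear (L :: 'f::model_space \<Rightarrow> 'g::model_space)" "open S" "C_k_on k S f"
  shows "C_k_on k S (\<lambda>x. L (f x))"
  using assms(3)
proof (induction k arbitrary: f)
  case 0
  then show ?case
    using bounded_linear.continuous_on[OF linear_bounded[OF assms(1)]] by auto
next
  case (Suc k)
  show ?case
  proof (rule C_k_on_Suc_I[OF assms(2)])
    show "((\<lambda>x. L (f x)) has_derivative (\<lambda>v. L (frechet_derivative f (at x) v))) (at x)"
      if "x \<in> S" for x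
      using bounded_linear.has_derivative[OF linear_bounded[OF assms(1)]]
        C_k_on_Suc_derivative[OF Suc.prems that] by blast
  qed (use Suc in auto)
qed

lemma C_k_on_id: "open S \<Longrightarrow> C_k_on k S (\<lambda>x. x)"
  by (cases k) (auto intro!: C_k_on_Suc_I[where D = "\<lambda>x v. v"] C_k_on_const)

lemma C_k_on_add:
  assumes "open S" "C_k_on k S f" "C_k_on k S g"
  shows "C_k_on k S (\<lambda>x. f x + g x)"
  using assms(2,3)
proof (induction k arbitrary: f g)
  case 0
  then show ?case by (auto intro!: continuous_on_const continuous_on_add continuous_on_scaleR)
next
  case (Suc k)
  show ?case
    by (rule C_k_on_Suc_I[OF assms(1) has_derivative_add[OF C_k_on_Suc_derivative[OF Suc.prems(1)]
            C_k_on_Suc_derivative[OF Suc.prems(2)]]]) (use Suc in auto)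
qed

lemma C_k_on_sum:
  assumes "open S" "\<And>i. i \<in> I \<Longrightarrow> C_k_on k S (f i)"
  shows "C_k_on k S (\<lambda>x. \<Sum>i\<in>I. f i x)"
  using assms(2)
  by (induction I rule: infinite_finite_induct) (auto intro: C_k_on_const C_k_on_add[OF assms(1)])

lemma C_k_on_scaleR:
  assumes "open S" "C_k_on k S c" "C_k_on k S f"
  shows "C_k_on k S (\<lambda>x. c x *\<^sub>R f x)"
  using assms(2,3)
proof (induction k arbitrary: c f)
  case 0
  then show ?case by (auto intro!: continuous_on_const continuous_on_add continuous_on_scaleR)
next
  case (Suc k)
  have "C_k_on k S c" "C_k_on k S f" using C_k_on_Suc_D Suc.prems by blast+
  then show ?case
    by (intro C_k_on_Suc_I[OF assms(1) has_derivative_scaleR[OF C_k_on_Suc_derivative[OF Suc.prems(1)]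
            C_k_on_Suc_derivative[OF Suc.prems(2)]]])
      (use Suc in \<open>auto intro!: C_k_on_add[OF assms(1)]\<close>)
qed

lemma C_k_on_inner:
  assumes "open S" "C_k_on k S f"
  shows "C_k_on k S (\<lambda>x. f x \<bullet> b)"
  using C_k_on_linear[OF bounded_linear.linear[OF bounded_linear_inner_left] assms] .

text \<open>Expanding \<open>f' x v\<close> in the basis turns the chain rule into a sum of products
  \<open>(f' x v \<bullet> b) \<cdot> g' (f x) b\<close>, in which the directional derivatives \<open>g' b\<close> are again composed with
  \<open>f\<close> alone, so that the induction hypothesis applies to them.\<close>

lemma C_k_on_compose:
  fixes f :: "'a::model_space \<Rightarrow> 'b::model_space" and g :: "'b \<Rightarrow> 'c::model_space"
  assumes "open S" "open T" "f ` S \<subseteq> T" "C_k_on k S f" "C_k_on k T g"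
  shows "C_k_on k S (\<lambda>x. g (f x))"
  using assms(4,5)
proof (induction k arbitrary: g)
  case 0
  then show ?case using assms(3) by (auto intro: continuous_on_compose2)
next
  case (Suc k)
  note df = C_k_on_Suc_derivative[OF Suc.prems(1)] and dg = C_k_on_Suc_derivative[OF Suc.prems(2)]
  have lg: "linear (frechet_derivative g (at (f x)))" if "x \<in> S" for x
    using dg assms(3) that has_derivative_linear by blast
  show ?case
  proof (rule C_k_on_Suc_I[OF assms(1)])
    show "((\<lambda>x. g (f x)) has_derivative
        (\<lambda>v. frechet_derivative g (at (f x)) (frechet_derivative f (at x) v))) (at x)"
      if "x \<in> S" for x
      using diff_chain_at[OF df[OF that] dg] assms(3) that by (auto simp: o_def)
    fix v
    have "C_k_on k S (\<lambda>x. \<Sum>b\<in>onb. (frechet_derivative f (at x) v \<bullet> b) *\<^sub>R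
        frechet_derivative g (at (f x)) b)"
      by (intro C_k_on_sum C_k_on_scaleR C_k_on_inner assms(1) Suc.IH C_k_on_Suc_D[OF Suc.prems(1)])
        (use Suc.prems in auto)
    then show "C_k_on k S (\<lambda>x. frechet_derivative g (at (f x)) (frechet_derivative f (at x) v))"
      by (rule C_k_on_cong[OF assms(1), THEN iffD1, rotated]) (use linear_expansion[OF lg, symmetric] in simp)
  qed
qed

section \<open>The inverse function theorem and submersions\<close>

text \<open>A product rule for a factor \<open>c\<close> that is merely continuous: since \<open>f x = 0\<close>, the
  error term \<open>(c z - c x) f z\<close> is of lower order than \<open>z - x\<close>.\<close>

lemma has_derivative_vanishing_scaleR:
  fixes f :: "'a::real_normed_vector \<Rightarrow> 'b::real_normed_vector"
  assumes c: "continuous (at x) c" and f: "(f has_derivative f') (at x)" "f x = 0"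
  shows "((\<lambda>z. c z *\<^sub>R f z) has_derivative (\<lambda>h. c x *\<^sub>R f' h)) (at x)"
proof -
  interpret f': bounded_linear f' using f(1) by (rule has_derivative_bounded_linear)
  obtain K where K: "K > 0" "\<And>h. norm (f' h) \<le> norm h * K" using f'.pos_bounded by blast
  have "((\<lambda>z. (c z - c x) *\<^sub>R f z) has_derivative (\<lambda>h. 0)) (at x)"
    unfolding has_derivative_at_alt
  proof (intro conjI allI impI)
    fix e :: real assume e: "e > 0"
    obtain d1 where d1: "d1 > 0" "\<And>z. norm (z - x) < d1 \<Longrightarrow> norm (f z - f' (z - x)) \<le> 1 * norm (z - x)"
      using f unfolding has_derivative_at_alt by (metis diff_zero zero_less_one)
    obtain d2 where d2: "d2 > 0" "\<And>z. dist z x < d2 \<Longrightarrow> dist (c z) (c x) < e / (K + 1)"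
      using c e K(1) unfolding continuous_at_eps_delta
      by (metis add_pos_pos zero_less_divide_iff zero_less_one)
    have "norm ((c z - c x) *\<^sub>R f z) \<le> e * norm (z - x)" if "norm (z - x) < min d1 d2" for z
    proof -
      have "norm (f z) \<le> norm (f z - f' (z - x)) + norm (f' (z - x))"
        by (metis diff_add_cancel norm_triangle_ineq)
      also have "\<dots> \<le> (K + 1) * norm (z - x)"
        using d1(2)[of z] K(2)[of "z - x"] that by (simp add: algebra_simps)
      finally have "norm (f z) \<le> (K + 1) * norm (z - x)" .
      moreover have "\<bar>c z - c x\<bar> \<le> e / (K + 1)"
        using d2(2)[of z] that by (simp add: dist_norm)
      ultimately have "\<bar>c z - c x\<bar> * norm (f z) \<le> e / (K + 1) * ((K + 1) * norm (z - x))"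
        using e K(1) by (intro mult_mono) auto
      then show ?thesis using K(1) by simp
    qed
    then show "\<exists>d>0. \<forall>y. norm (y - x) < d \<longrightarrow>
        norm ((c y - c x) *\<^sub>R f y - (c x - c x) *\<^sub>R f x - 0) \<le> e * norm (y - x)"
      using d1(1) d2(1) by (intro exI[of _ "min d1 d2"]) auto
  qed simp
  from has_derivative_add[OF this has_derivative_scaleR_right[OF f(1), of "c x"]]
  show ?thesis by (simp add: scaleR_diff_left)
qed

text \<open>Subtracting the linear systems at \<open>z\<close> and \<open>z\<^sub>0\<close> writes \<open>w z v - w z\<^sub>0 v\<close> as a sum of products
  of the functions \<open>w z v \<bullet> b\<close>, which are continuous by the uniform bound on the inverse, with
  differentiable functions vanishing at \<open>z\<^sub>0\<close>. The resulting derivative involves only \<open>w\<close> itself and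
  derivatives of \<open>L\<close>, which drives the induction.\<close>

lemma C_k_on_solution:
  fixes L :: "'a::model_space \<Rightarrow> 'e::model_space \<Rightarrow> 'e"
  assumes "open Z" and "\<And>v. C_k_on k Z (\<lambda>z. L z v)"
    and lin: "\<And>z. z \<in> Z \<Longrightarrow> linear (L z)"
    and bnd: "\<And>z v. z \<in> Z \<Longrightarrow> norm v \<le> 2 * norm (L z v)"
    and sol: "\<And>z v. z \<in> Z \<Longrightarrow> L z (w z v) = v"
  shows "C_k_on k Z (\<lambda>z. w z v)"
  using assms(2)
proof (induction k arbitrary: v)
  case 0
  show ?case unfolding C_k_on.simps continuous_on_def
  proof
    fix z0 assume z0: "z0 \<in> Z"
    have "((\<lambda>z. L z (w z0 v)) \<longlongrightarrow> L z0 (w z0 v)) (at z0 within Z)"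
      using 0[of "w z0 v"] z0 by (simp add: continuous_on_def)
    then have "((\<lambda>z. 2 * norm (v - L z (w z0 v))) \<longlongrightarrow> 2 * norm (v - v)) (at z0 within Z)"
      unfolding sol[OF z0] by (intro tendsto_intros)
    then have lim: "((\<lambda>z. 2 * norm (v - L z (w z0 v))) \<longlongrightarrow> 0) (at z0 within Z)" by simp
    have "norm (w z v - w z0 v) \<le> 2 * norm (v - L z (w z0 v))" if "z \<in> Z" for z
      using bnd[OF that, of "w z v - w z0 v"] by (simp add: linear_diff[OF lin[OF that]] sol[OF that])
    then have "eventually (\<lambda>z. norm (w z v - w z0 v) \<le> 2 * norm (v - L z (w z0 v))) (at z0 within Z)"
      by (simp add: eventually_at_filter)
    then have "((\<lambda>z. w z v - w z0 v) \<longlongrightarrow> 0) (at z0 within Z)"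
      using lim by (rule Lim_null_comparison)
    then show "((\<lambda>z. w z v) \<longlongrightarrow> w z0 v) (at z0 within Z)" by (simp add: Lim_null[symmetric])
  qed
next
  case (Suc k)
  have IH: "C_k_on k Z (\<lambda>z. w z v)" for v
    by (rule Suc.IH) (use C_k_on_Suc_D Suc.prems in blast)
  have w_unique: "w z u = x" if "z \<in> Z" "L z x = u" for z u x
    using bnd[OF that(1), of "w z u - x"] that by (simp add: linear_diff[OF lin] sol)
  have w_lin: "linear (w z)" if z: "z \<in> Z" for z
    by (intro linearI w_unique[OF z])
      (simp_all add: linear_add[OF lin[OF z]] linear_scale[OF lin[OF z]] sol[OF z])
  let ?D = "\<lambda>z b. frechet_derivative (\<lambda>z. L z b) (at z)"
  have dL: "((\<lambda>z. L z b) has_derivative ?D z b) (at z)" if "z \<in> Z" for z b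
    using C_k_on_Suc_derivative[OF Suc.prems that] .
  show ?case
  proof (rule C_k_on_Suc_I[OF assms(1)])
    fix z0 assume z0: "z0 \<in> Z"
    have "C_k_on 0 Z (\<lambda>z. w z v)" using IH[of v] by (induction k) (use C_k_on_Suc_D in blast)+
    then have "isCont (\<lambda>z. w z v) z0"
      using z0 assms(1) by (simp add: continuous_on_eq_continuous_at)
    then have cont: "isCont (\<lambda>z. w z v \<bullet> b) z0" for b by (intro continuous_intros)
    have "((\<lambda>z. L z b - L z0 b) has_derivative ?D z0 b) (at z0)" for b
      using has_derivative_diff[OF dL[OF z0] has_derivative_const, of b "L z0 b"] by simp
    then have "((\<lambda>z. w z0 v - w z0 (\<Sum>b\<in>onb. (w z v \<bullet> b) *\<^sub>R (L z b - L z0 b))) has_derivative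
        (\<lambda>h. 0 - w z0 (\<Sum>b\<in>onb. (w z0 v \<bullet> b) *\<^sub>R ?D z0 b h))) (at z0)"
      by (intro has_derivative_diff has_derivative_const has_derivative_sum
          bounded_linear.has_derivative[OF linear_bounded[OF w_lin[OF z0]]]
          has_derivative_vanishing_scaleR cont) auto
    moreover have "w z0 v - w z0 (\<Sum>b\<in>onb. (w z v \<bullet> b) *\<^sub>R (L z b - L z0 b)) = w z v"
      if z: "z \<in> Z" for z
    proof -
      have "(\<Sum>b\<in>onb. (w z v \<bullet> b) *\<^sub>R (L z b - L z0 b)) = L z (w z v) - L z0 (w z v)"
        by (simp add: linear_expansion[OF lin[OF z], of "w z v"]
            linear_expansion[OF lin[OF z0], of "w z v"] scaleR_diff_right sum_subtractf)
      then have "w z0 (\<Sum>b\<in>onb. (w z v \<bullet> b) *\<^sub>R (L z b - L z0 b)) = w z0 v - w z0 (L z0 (w z v))"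
        by (simp add: sol[OF z] linear_diff[OF w_lin[OF z0]])
      then show ?thesis using w_unique[OF z0 refl] by simp
    qed
    ultimately have "((\<lambda>z. w z v) has_derivative
        (\<lambda>h. 0 - w z0 (\<Sum>b\<in>onb. (w z0 v \<bullet> b) *\<^sub>R ?D z0 b h))) (at z0)"
      by (rule has_derivative_transform_within_open[OF _ assms(1) z0])
    then show "((\<lambda>z. w z v) has_derivative
        (\<lambda>h. - (\<Sum>b\<in>onb. (w z0 v \<bullet> b) *\<^sub>R w z0 (?D z0 b h)))) (at z0)"
      by (simp add: linear_sum[OF w_lin[OF z0]] linear_scale[OF w_lin[OF z0]])
  next
    fix h
    have "C_k_on k Z (\<lambda>z. \<Sum>c\<in>onb. (?D z b h \<bullet> c) *\<^sub>R w z c)" for b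
      by (intro C_k_on_sum C_k_on_scaleR C_k_on_inner assms(1) IH) (use Suc.prems in simp)
    then have "C_k_on k Z (\<lambda>z. w z (?D z b h))" for b
      by (rule C_k_on_cong[OF assms(1), THEN iffD1, rotated])
        (simp add: linear_expansion[OF w_lin, symmetric])
    then have "C_k_on k Z (\<lambda>z. \<Sum>b\<in>onb. (w z v \<bullet> b) *\<^sub>R w z (?D z b h))"
      by (intro C_k_on_sum C_k_on_scaleR C_k_on_inner assms(1) IH)
    from C_k_on_linear[OF _ assms(1) this, of "\<lambda>x. - x"]
    show "C_k_on k Z (\<lambda>z. - (\<Sum>b\<in>onb. (w z v \<bullet> b) *\<^sub>R w z (?D z b h)))"
      by (simp add: bounded_linear.linear[OF bounded_linear_minus[OF bounded_linear_ident]])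
  qed
qed

lemma smooth_on_subset: "smooth_on S f \<Longrightarrow> T \<subseteq> S \<Longrightarrow> smooth_on T f"
  unfolding smooth_on_def using C_k_on_subset by blast

lemma smooth_on_cong:
  "open S \<Longrightarrow> (\<And>x. x \<in> S \<Longrightarrow> f x = g x) \<Longrightarrow> smooth_on S f \<longleftrightarrow> smooth_on S g"
  unfolding smooth_on_def using C_k_on_cong by metis

lemma smooth_on_compose:
  assumes "open S" "open T" "f ` S \<subseteq> T" "smooth_on S f" "smooth_on T g"
  shows "smooth_on S (\<lambda>x. g (f x))"
  using assms C_k_on_compose unfolding smooth_on_def by metis

lemma smooth_on_has_derivative:
  assumes "smooth_on S f" "x \<in> S"
  shows "(f has_derivative frechet_derivative f (at x)) (at x)"
  using assms C_k_on_Suc_derivative unfolding smooth_on_def by metis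

lemma smooth_on_derivative:
  "smooth_on S f \<Longrightarrow> smooth_on S (\<lambda>x. frechet_derivative f (at x) v)"
  unfolding smooth_on_def using C_k_on.simps(2) by blast

lemma smooth_on_continuous: "smooth_on S f \<Longrightarrow> continuous_on S f"
  unfolding smooth_on_def using C_k_on.simps(1) by blast

lemma smooth_on_affine:
  assumes "linear L" "open S"
  shows "smooth_on S (\<lambda>x. a + L (x - x0))"
proof -
  have "C_k_on k S (\<lambda>x. (a - L x0) + L x)" for k
    by (rule C_k_on_add[OF assms(2) C_k_on_const C_k_on_linear[OF assms C_k_on_id[OF assms(2)]]])
  then show ?thesis by (simp add: smooth_on_def linear_diff[OF assms(1)] algebra_simps)
qed

text \<open>A map with derivative close to the identity is the identity plus a contraction, so that
  \<open>F x = z\<close> is a fixed point problem \<open>x = z - (F x - x)\<close>.\<close>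

lemma near_identity_surjective:
  fixes F :: "'e::model_space \<Rightarrow> 'e"
  assumes "\<And>x y. x \<in> cball x0 r \<Longrightarrow> y \<in> cball x0 r \<Longrightarrow>
      norm ((F x - x) - (F y - y)) \<le> 1/2 * norm (x - y)"
    and "0 < r" "z \<in> ball (F x0) (r / 2)"
  shows "\<exists>x\<in>ball x0 r. F x = z"
proof -
  have est: "norm (z - (F x - x) - x0) < r" if "x \<in> cball x0 r" for x
  proof -
    have "z - (F x - x) - x0 = (z - F x0) - ((F x - x) - (F x0 - x0))" by simp
    also have "norm \<dots> \<le> norm (z - F x0) + norm ((F x - x) - (F x0 - x0))"
      by (rule norm_triangle_ineq4)
    also have "\<dots> < r / 2 + 1/2 * r"
      using assms(1)[OF that, of x0] assms(2,3) that
      by (intro add_less_le_mono) (auto simp: dist_norm norm_minus_commute)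
    finally show ?thesis by simp
  qed
  have "\<exists>!x\<in>cball x0 r. z - (F x - x) = x"
  proof (rule Banach_fix)
    show "complete (cball x0 r)"
      using complete_closed_subset[OF closed_cball _ complete_model_space] by simp
    show "(\<lambda>x. z - (F x - x)) ` cball x0 r \<subseteq> cball x0 r"
      using est by (force simp: dist_norm norm_minus_commute[of x0])
    show "dist (z - (F x - x)) (z - (F y - y)) \<le> 1/2 * dist x y"
      if "x \<in> cball x0 r" "y \<in> cball x0 r" for x y
      using assms(1)[OF that] by (simp add: dist_norm norm_minus_commute algebra_simps)
  qed (use assms(2) in auto)
  then obtain x where x: "x \<in> cball x0 r" "z - (F x - x) = x" by blast
  from x(2) have "F x = z" by (simp add: algebra_simps)
  moreover have "x \<in> ball x0 r"
    using est[OF x(1)] unfolding x(2) by (simp add: dist_norm norm_minus_commute)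
  ultimately show ?thesis by blast
qed

lemma near_identity_linear_surjective:
  fixes L :: "'e::model_space \<Rightarrow> 'e"
  assumes "linear L" "\<And>v. norm (L v - v) \<le> 1/2 * norm v"
  shows "\<exists>v. L v = y"
proof -
  \<comment> \<open>The radius is such that \<open>y\<close> lies in the ball of half the radius.\<close>
  have "\<exists>x\<in>ball 0 (2 * norm y + 1). L x = y"
  proof (rule near_identity_surjective)
    show "norm ((L x - x) - (L y - y)) \<le> 1/2 * norm (x - y)" for x y
      using assms(2)[of "x - y"] by (simp add: linear_diff[OF assms(1)] algebra_simps)
  qed (use norm_ge_zero[of y] in \<open>auto simp: linear_0[OF assms(1)] intro: add_nonneg_pos\<close>)
  then show ?thesis by blast
qed

text \<open>Smoothness gives continuity of \<open>x \<mapsto> F' x v\<close> for each fixed \<open>v\<close>. Over the finitely many basis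
  vectors this becomes an estimate that is uniform in \<open>v\<close>.\<close>

lemma smooth_derivative_near:
  fixes F :: "'e::model_space \<Rightarrow> 'f::model_space"
  assumes "open W" "x0 \<in> W" "smooth_on W F" "0 < e"
  shows "\<exists>r>0. cball x0 r \<subseteq> W \<and> (\<forall>x\<in>cball x0 r. \<forall>v.
      norm (frechet_derivative F (at x) v - frechet_derivative F (at x0) v) \<le> e * norm v)"
proof -
  let ?D = "\<lambda>x. frechet_derivative F (at x)"
  define e' where "e' = e / (real (card (onb :: 'e set)) + 1)"
  have e': "e' > 0" "real (card (onb :: 'e set)) * e' \<le> e"
    using assms(4) by (auto simp: e'_def field_simps)
  have "isCont (\<lambda>x. ?D x b) x0" for b
    using smooth_on_continuous[OF smooth_on_derivative[OF assms(3)]] assms(1,2)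
    by (simp add: continuous_on_eq_continuous_at)
  then have "eventually (\<lambda>x. dist (?D x b) (?D x0 b) < e') (nhds x0)" for b
    using e'(1) by (simp add: continuous_at tendsto_iff eventually_nhds_conv_at)
  then have "eventually (\<lambda>x. \<forall>b\<in>onb. dist (?D x b) (?D x0 b) < e') (nhds x0)"
    by (intro eventually_ball_finite onb(1)) simp
  moreover have "eventually (\<lambda>x. x \<in> W) (nhds x0)"
    using assms(1,2) by (rule eventually_nhds_in_open)
  ultimately have "eventually (\<lambda>x. x \<in> W \<and> (\<forall>b\<in>onb. dist (?D x b) (?D x0 b) < e')) (nhds x0)"
    by eventually_elim simp
  then obtain d where d: "d > 0"
    "\<And>x. dist x x0 < d \<Longrightarrow> x \<in> W \<and> (\<forall>b\<in>onb. dist (?D x b) (?D x0 b) < e')"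
    unfolding eventually_nhds_metric by blast
  have "norm (?D x v - ?D x0 v) \<le> e * norm v" if "x \<in> cball x0 (d / 2)" for x v
  proof -
    have dx: "dist x x0 < d" using that d(1) by (simp add: dist_commute)
    have l: "linear (?D x)" "linear (?D x0)"
      using smooth_on_has_derivative[OF assms(3)] d(2)[OF dx] assms(2) has_derivative_linear by blast+
    have "?D x v - ?D x0 v = (\<Sum>b\<in>onb. (v \<bullet> b) *\<^sub>R (?D x b - ?D x0 b))"
      by (simp add: linear_expansion[OF l(1), of v] linear_expansion[OF l(2), of v]
          scaleR_diff_right sum_subtractf)
    also have "norm \<dots> \<le> (\<Sum>b\<in>(onb :: 'e set). norm v * e')"
    proof (rule sum_norm_le)
      fix b :: 'e assume b: "b \<in> onb"
      have "norm b = 1" using onb(3)[OF b b] by (simp add: norm_eq_1)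
      then have "\<bar>v \<bullet> b\<bar> \<le> norm v" using Cauchy_Schwarz_ineq2[of v b] by simp
      moreover have "norm (?D x b - ?D x0 b) \<le> e'"
        using d(2)[OF dx] b by (auto simp: dist_norm intro: less_imp_le)
      ultimately show "norm ((v \<bullet> b) *\<^sub>R (?D x b - ?D x0 b)) \<le> norm v * e'"
        by (auto intro: mult_mono)
    qed
    also have "\<dots> = (real (card (onb :: 'e set)) * e') * norm v" by simp
    also have "\<dots> \<le> e * norm v" using e'(2) by (intro mult_right_mono) auto
    finally show ?thesis .
  qed
  moreover have "cball x0 (d / 2) \<subseteq> W" using d by (auto simp: dist_commute)
  ultimately show ?thesis using d(1) by (intro exI[of _ "d / 2"]) auto
qed

text \<open>Existence and the Lipschitz bound of \<open>\<Gamma>\<close> come from the contraction principle. Its derivative at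
  \<open>z\<close> solves the linear system with matrix \<open>F' (\<Gamma> z)\<close>, so that \<open>\<Gamma>\<close> being of class \<open>C\<^sup>k\<close> makes the
  derivative \<open>C\<^sup>k\<close>.\<close>

lemma smooth_inverse_function:
  fixes F :: "'e::model_space \<Rightarrow> 'e"
  assumes W: "open W" "x0 \<in> W" and F: "smooth_on W F"
    and id: "frechet_derivative F (at x0) = (\<lambda>v. v)"
  obtains Z \<Gamma> where "open Z" "F x0 \<in> Z" "smooth_on Z \<Gamma>" "\<Gamma> ` Z \<subseteq> W" "\<And>z. z \<in> Z \<Longrightarrow> F (\<Gamma> z) = z"
    "\<Gamma> (F x0) = x0" "(\<Gamma> has_derivative (\<lambda>v. v)) (at (F x0))"
proof -
  let ?D = "\<lambda>x. frechet_derivative F (at x)"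
  obtain r where r: "r > 0" "cball x0 r \<subseteq> W"
      "\<And>x v. x \<in> cball x0 r \<Longrightarrow> norm (?D x v - v) \<le> 1/2 * norm v"
    using smooth_derivative_near[OF W F, of "1/2"] unfolding id by auto
  have dF: "(F has_derivative ?D x) (at x)" if "x \<in> cball x0 r" for x
    using smooth_on_has_derivative[OF F] r(2) that by blast
  have lD: "linear (?D x)" if "x \<in> cball x0 r" for x using dF[OF that] has_derivative_linear by blast
  have lip: "norm ((F x - x) - (F y - y)) \<le> 1/2 * norm (x - y)"
    if "x \<in> cball x0 r" "y \<in> cball x0 r" for x y
  proof (rule differentiable_bound[OF convex_cball _ _ that])
    show "((\<lambda>x. F x - x) has_derivative (\<lambda>v. ?D x v - v)) (at x within cball x0 r)"
      if "x \<in> cball x0 r" for x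
      by (intro has_derivative_diff has_derivative_ident has_derivative_at_withinI[OF dF[OF that]])
    show "onorm (\<lambda>v. ?D x v - v) \<le> 1/2" if "x \<in> cball x0 r" for x
      using r(3)[OF that] by (rule onorm_bound[rotated]) simp
  qed
  have inj: "norm (x - y) \<le> 2 * norm (F x - F y)" if "x \<in> cball x0 r" "y \<in> cball x0 r" for x y
  proof -
    have "x - y = (F x - F y) - ((F x - x) - (F y - y))" by simp
    then have "norm (x - y) \<le> norm (F x - F y) + norm ((F x - x) - (F y - y))"
      by (metis norm_triangle_ineq4)
    then show ?thesis using lip[OF that] by simp
  qed
  define Z where "Z = ball (F x0) (r / 2)"
  define \<Gamma> where "\<Gamma> = (\<lambda>z. SOME x. x \<in> ball x0 r \<and> F x = z)"
  have "\<exists>x. x \<in> ball x0 r \<and> F x = z" if "z \<in> Z" for z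
    using near_identity_surjective[OF lip r(1)] that unfolding Z_def by blast
  then have \<Gamma>: "\<Gamma> z \<in> ball x0 r" "F (\<Gamma> z) = z" if "z \<in> Z" for z
    using someI_ex[of "\<lambda>x. x \<in> ball x0 r \<and> F x = z"] that unfolding \<Gamma>_def by blast+
  have \<Gamma>c: "\<Gamma> z \<in> cball x0 r" if "z \<in> Z" for z using \<Gamma>(1)[OF that] by auto
  have Z: "open Z" "F x0 \<in> Z" using r(1) by (auto simp: Z_def)
  have \<Gamma>0: "\<Gamma> (F x0) = x0"
    using inj[OF \<Gamma>c[OF Z(2)], of x0] \<Gamma>(2)[OF Z(2)] r(1) by simp
  have \<Gamma>lip: "dist (\<Gamma> z) (\<Gamma> z') \<le> 2 * dist z z'" if "z \<in> Z" "z' \<in> Z" for z z'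
    using inj[OF \<Gamma>c[OF that(1)] \<Gamma>c[OF that(2)]] \<Gamma>(2) that by (simp add: dist_norm)
  have cont: "continuous_on Z \<Gamma>"
  proof (unfold continuous_on_iff, intro ballI allI impI)
    fix z and e :: real assume "z \<in> Z" "e > 0"
    then show "\<exists>d>0. \<forall>z'\<in>Z. dist z' z < d \<longrightarrow> dist (\<Gamma> z') (\<Gamma> z) < e"
      using \<Gamma>lip by (intro exI[of _ "e / 2"]) fastforce
  qed
  define w where "w = (\<lambda>z v. SOME u. ?D (\<Gamma> z) u = v)"
  have sol: "?D (\<Gamma> z) (w z v) = v" if "z \<in> Z" for z v
    unfolding w_def
    by (rule someI_ex) (rule near_identity_linear_surjective[OF lD[OF \<Gamma>c[OF that]] r(3)[OF \<Gamma>c[OF that]]])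
  have bnd: "norm v \<le> 2 * norm (?D (\<Gamma> z) v)" if "z \<in> Z" for z v
  proof -
    have "v = ?D (\<Gamma> z) v - (?D (\<Gamma> z) v - v)" by simp
    then have "norm v \<le> norm (?D (\<Gamma> z) v) + norm (?D (\<Gamma> z) v - v)"
      by (metis norm_triangle_ineq4)
    then show ?thesis using r(3)[OF \<Gamma>c[OF that], of v] by simp
  qed
  have w_unique: "w z u = x" if "z \<in> Z" "?D (\<Gamma> z) x = u" for z u x
    using bnd[OF that(1), of "w z u - x"] that
    by (simp add: linear_diff[OF lD[OF \<Gamma>c]] sol)
  have d\<Gamma>: "(\<Gamma> has_derivative w z) (at z)" if z: "z \<in> Z" for z
  proof (rule has_derivative_inverse_basic[OF dF[OF \<Gamma>c[OF z]] _ _ _ Z(1) z \<Gamma>(2)])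
    have "linear (w z)"
      by (intro linearI w_unique[OF z])
        (simp_all add: linear_add[OF lD[OF \<Gamma>c[OF z]]] linear_scale[OF lD[OF \<Gamma>c[OF z]]] sol[OF z])
    then show "bounded_linear (w z)" by (rule linear_bounded)
    show "w z \<circ> ?D (\<Gamma> z) = id" using w_unique[OF z refl] by (simp add: fun_eq_iff)
    show "continuous (at z) \<Gamma>" using cont z Z(1) by (simp add: continuous_on_eq_continuous_at)
  qed
  have "C_k_on k Z \<Gamma>" for k
  proof (induction k)
    case (Suc k)
    show ?case
    proof (rule C_k_on_Suc_I[OF Z(1) d\<Gamma>], assumption, rule C_k_on_solution[OF Z(1) _ _ bnd sol])
      show "C_k_on k Z (\<lambda>z. ?D (\<Gamma> z) v)" for v
        using C_k_on_compose[OF Z(1) W(1) _ Suc smooth_on_derivative[OF F, unfolded smooth_on_def, rule_format]]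
          \<Gamma>c r(2) by blast
    qed (use lD \<Gamma>c in auto)
  qed (simp add: cont)
  then have "smooth_on Z \<Gamma>" by (simp add: smooth_on_def)
  moreover have "\<Gamma> ` Z \<subseteq> W" using \<Gamma>c r(2) by blast
  moreover have "w (F x0) = (\<lambda>v. v)"
    using w_unique[OF Z(2)] by (simp add: \<Gamma>0 id fun_eq_iff)
  ultimately show ?thesis using that[OF Z _ _ \<Gamma>(2) \<Gamma>0] d\<Gamma>[OF Z(2)] by simp
qed

text \<open>With a right inverse \<open>R\<close> of the derivative \<open>L\<close> at \<open>x0\<close>, the map
  \<open>F x = R (f x) + (x - R (L x))\<close> has derivative the identity at \<open>x0\<close>, and \<open>f \<circ> F\<^sup>-\<^sup>1 = L\<close>.
  In the coordinates given by \<open>F\<close>, the point \<open>\<zeta> (x, y)\<close> has the same component along \<open>ker L\<close> as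
  \<open>x - x0\<close>, up to a translation, and its image under \<open>L\<close> is \<open>y\<close>.\<close>

lemma submersion_adjustment:
  fixes f :: "'e::model_space \<Rightarrow> 'f::model_space"
  assumes W: "open W" "x0 \<in> W" and f: "smooth_on W f"
    and surj: "surj (frechet_derivative f (at x0))"
  obtains T \<zeta> where "open T" "(x0, f x0) \<in> T" "smooth_on T \<zeta>" "\<zeta> ` T \<subseteq> W"
    "\<And>x y. (x, y) \<in> T \<Longrightarrow> f (\<zeta> (x, y)) = y" "\<zeta> (x0, f x0) = x0"
    "\<And>u. frechet_derivative \<zeta> (at (x0, f x0)) (u, frechet_derivative f (at x0) u) = u"
proof -
  define L where "L = frechet_derivative f (at x0)"
  have df: "(f has_derivative L) (at x0)"
    unfolding L_def using smooth_on_has_derivative[OF f W(2)] .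
  then have L: "linear L" by (rule has_derivative_linear)
  obtain R where R: "linear R" "L \<circ> R = id"
    using linear_surjective_right_inverse[OF L] surj unfolding L_def by blast
  have LR: "L (R y) = y" for y using R(2) by (metis comp_apply id_apply)
  note lin = linear_add[OF L] linear_diff[OF L] linear_add[OF R(1)] linear_diff[OF R(1)]
  define P where "P = (\<lambda>x. x - R (L x))"
  have P: "linear P" unfolding P_def
    by (intro linear_compose_sub linear_ident linear_compose[OF L R(1), unfolded o_def])
  define F where "F = (\<lambda>x. R (f x) + P x)"
  have F: "smooth_on W F" unfolding smooth_on_def F_def
    using f C_k_on_add[OF W(1) C_k_on_linear[OF R(1) W(1)] C_k_on_linear[OF P W(1) C_k_on_id[OF W(1)]]]
    by (simp add: smooth_on_def)
  have "(F has_derivative (\<lambda>v. R (L v) + P v)) (at x0)"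
    unfolding F_def
    by (intro has_derivative_add bounded_linear.has_derivative[OF linear_bounded[OF R(1)] df]
        linear_has_derivative[OF P])
  then have "frechet_derivative F (at x0) = (\<lambda>v. v)"
    using frechet_derivative_at by (simp add: P_def) force
  from smooth_inverse_function[OF W F this]
  obtain Z \<Gamma> where \<Gamma>: "open Z" "F x0 \<in> Z" "smooth_on Z \<Gamma>" "\<Gamma> ` Z \<subseteq> W"
    "\<And>z. z \<in> Z \<Longrightarrow> F (\<Gamma> z) = z" "\<Gamma> (F x0) = x0" "(\<Gamma> has_derivative (\<lambda>v. v)) (at (F x0))"
    by blast
  have f\<Gamma>: "f (\<Gamma> z) = L z" if "z \<in> Z" for z
  proof -
    have "L (F (\<Gamma> z)) = f (\<Gamma> z)" by (simp add: F_def P_def lin LR)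
    then show ?thesis by (simp add: \<Gamma>(5)[OF that])
  qed
  define A where "A = (\<lambda>p. F x0 + ((P \<circ> fst) (p - (x0, f x0)) + (R \<circ> snd) (p - (x0, f x0))))"
  have lA: "linear (\<lambda>p. (P \<circ> fst) p + (R \<circ> snd) p)"
    by (intro linear_compose_add linear_compose[OF _ P] linear_compose[OF _ R(1)] linear_fst linear_snd)
  have A: "smooth_on UNIV A" unfolding A_def by (rule smooth_on_affine[OF lA]) simp
  have dA: "(A has_derivative (\<lambda>p. P (fst p) + R (snd p))) (at p)" for p
  proof -
    have "((\<lambda>p. p - (x0, f x0)) has_derivative (\<lambda>p. p - 0)) (at p)"
      by (intro has_derivative_diff has_derivative_ident has_derivative_const)
    then have "((\<lambda>p. p - (x0, f x0)) has_derivative (\<lambda>p. p)) (at p)" by simp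
    from has_derivative_add[OF has_derivative_const has_derivative_compose[OF this
          linear_has_derivative[OF lA]], of "F x0"]
    show ?thesis by (simp add: A_def)
  qed
  define T where "T = A -` Z"
  have "open T" unfolding T_def
    using continuous_open_vimage[OF \<Gamma>(1)] smooth_on_continuous[OF A] open_vimage[OF \<Gamma>(1)] by blast
  moreover have A0: "A (x0, f x0) = F x0" by (simp add: A_def linear_0[OF P] linear_0[OF R(1)])
  then have "(x0, f x0) \<in> T" by (simp add: T_def \<Gamma>(2))
  moreover have "smooth_on T (\<lambda>p. \<Gamma> (A p))"
    by (rule smooth_on_compose[OF \<open>open T\<close> \<Gamma>(1) _ smooth_on_subset[OF A] \<Gamma>(3)])
      (auto simp: T_def)
  moreover have "(\<lambda>p. \<Gamma> (A p)) ` T \<subseteq> W" using \<Gamma>(4) by (auto simp: T_def)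
  moreover have "f (\<Gamma> (A (x, y))) = y" if "(x, y) \<in> T" for x y
  proof -
    have "f (\<Gamma> (A (x, y))) = L (A (x, y))" using f\<Gamma> that by (simp add: T_def)
    also have "\<dots> = y" by (simp add: A_def F_def P_def lin LR)
    finally show ?thesis .
  qed
  moreover have "frechet_derivative (\<lambda>p. \<Gamma> (A p)) (at (x0, f x0)) (u, L u) = u" for u
  proof -
    have "((\<lambda>p. \<Gamma> (A p)) has_derivative (\<lambda>p. P (fst p) + R (snd p))) (at (x0, f x0))"
      using has_derivative_compose[OF dA, of \<Gamma> "\<lambda>v. v" "(x0, f x0)"] \<Gamma>(7) unfolding A0 by simp
    from frechet_derivative_at[OF this, symmetric] show ?thesis by (simp add: P_def)
  qed
  ultimately show ?thesis using that[of T "\<lambda>p. \<Gamma> (A p)"] A0 \<Gamma>(6) by (simp add: L_def)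
qed

section \<open>Closed forms in coordinates\<close>

text \<open>The mean value theorem, applied in the direction \<open>a\<close> and then in the direction \<open>b\<close>.\<close>

lemma second_difference:
  fixes \<phi> :: "'e::real_normed_vector \<Rightarrow> real"
  assumes "0 < e" and S: "\<And>s t. 0 \<le> s \<Longrightarrow> s \<le> e \<Longrightarrow> 0 \<le> t \<Longrightarrow> t \<le> e \<Longrightarrow> x + s *\<^sub>R a + t *\<^sub>R b \<in> S"
    and d1: "\<And>y. y \<in> S \<Longrightarrow> (\<phi> has_derivative \<phi>' y) (at y)"
    and d2: "\<And>y. y \<in> S \<Longrightarrow> ((\<lambda>y. \<phi>' y a) has_derivative D y) (at y)"
  shows "\<exists>s t. 0 \<le> s \<and> s \<le> e \<and> 0 \<le> t \<and> t \<le> e \<and>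
    \<phi> (x + e *\<^sub>R a + e *\<^sub>R b) - \<phi> (x + e *\<^sub>R a) - \<phi> (x + e *\<^sub>R b) + \<phi> x =
      e * (e * D (x + s *\<^sub>R a + t *\<^sub>R b) b)"
proof -
  have line: "((\<lambda>s. f (p + s *\<^sub>R v)) has_real_derivative f' v) (at s)"
    if "(f has_derivative f') (at (p + s *\<^sub>R v))" for f :: "'e \<Rightarrow> real" and f' p v s
  proof -
    have "((\<lambda>s. p + s *\<^sub>R v) has_derivative (\<lambda>h. h *\<^sub>R v)) (at s)"
      by (auto intro!: derivative_eq_intros)
    from has_derivative_compose[OF this that]
    show ?thesis
      by (simp add: has_field_derivative_def linear_scale[OF has_derivative_linear[OF that]] mult.commute)
        (simp add: mult_commute_abs)
  qed
  define k where "k = (\<lambda>s. \<phi> ((x + e *\<^sub>R b) + s *\<^sub>R a) - \<phi> (x + s *\<^sub>R a))"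
  have "(k has_real_derivative \<phi>' ((x + e *\<^sub>R b) + s *\<^sub>R a) a - \<phi>' (x + s *\<^sub>R a) a) (at s)"
    if "0 \<le> s" "s \<le> e" for s
    unfolding k_def using S[OF that, of e] S[OF that, of 0] assms(1)
    by (intro DERIV_diff line d1) (simp_all add: algebra_simps)
  from MVT2[OF assms(1) this] obtain s where s: "0 < s" "s < e"
    "k e - k 0 = e * (\<phi>' (x + e *\<^sub>R b + s *\<^sub>R a) a - \<phi>' (x + s *\<^sub>R a) a)" by auto
  have "((\<lambda>t. \<phi>' ((x + s *\<^sub>R a) + t *\<^sub>R b) a) has_real_derivative D (x + s *\<^sub>R a + t *\<^sub>R b) b) (at t)"
    if "0 \<le> t" "t \<le> e" for t
    by (rule line[OF d2]) (use S[of s t] s that in simp)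
  from MVT2[OF assms(1) this] obtain t where t: "0 < t" "t < e"
    "\<phi>' (x + s *\<^sub>R a + e *\<^sub>R b) a - \<phi>' (x + s *\<^sub>R a) a = e * D (x + s *\<^sub>R a + t *\<^sub>R b) b"
    by auto
  have "k e - k 0 = e * (e * D (x + s *\<^sub>R a + t *\<^sub>R b) b)"
    using s(3) t(3) by (simp add: algebra_simps)
  then have "\<phi> (x + e *\<^sub>R a + e *\<^sub>R b) - \<phi> (x + e *\<^sub>R a) - \<phi> (x + e *\<^sub>R b) + \<phi> x =
      e * (e * D (x + s *\<^sub>R a + t *\<^sub>R b) b)"
    by (simp add: k_def algebra_simps)
  then show ?thesis using s t by (intro exI[of _ s] exI[of _ t]) auto
qed

text \<open>The second difference of \<open>\<phi>\<close> in the directions \<open>a\<close> and \<open>b\<close> is symmetric, and the mean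
  value theorem expresses it by either mixed derivative at nearby points.\<close>

lemma second_derivative_symmetric_real:
  fixes \<phi> :: "'e::real_normed_vector \<Rightarrow> real"
  assumes S: "open S" "x \<in> S"
    and d: "\<And>y. y \<in> S \<Longrightarrow> (\<phi> has_derivative \<phi>' y) (at y)"
    and da: "\<And>y. y \<in> S \<Longrightarrow> ((\<lambda>y. \<phi>' y a) has_derivative Da y) (at y)"
    and db: "\<And>y. y \<in> S \<Longrightarrow> ((\<lambda>y. \<phi>' y b) has_derivative Db y) (at y)"
    and ca: "continuous_on S (\<lambda>y. Da y b)" and cb: "continuous_on S (\<lambda>y. Db y a)"
  shows "Da x b = Db x a"
proof (rule ccontr)
  assume "Da x b \<noteq> Db x a"
  define e where "e = \<bar>Da x b - Db x a\<bar> / 2"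
  have e: "e > 0" using \<open>Da x b \<noteq> Db x a\<close> by (simp add: e_def)
  have "isCont (\<lambda>y. Da y b) x" "isCont (\<lambda>y. Db y a) x"
    using ca cb S by (auto simp: continuous_on_eq_continuous_at)
  then have "eventually (\<lambda>y. dist (Da y b) (Da x b) < e) (nhds x)"
      "eventually (\<lambda>y. dist (Db y a) (Db x a) < e) (nhds x)"
    using e by (simp_all add: continuous_at tendsto_iff eventually_nhds_conv_at)
  then have "eventually (\<lambda>y. y \<in> S \<and> dist (Da y b) (Da x b) < e \<and> dist (Db y a) (Db x a) < e) (nhds x)"
    using eventually_nhds_in_open[OF S] by eventually_elim simp
  then obtain r where r: "r > 0" "\<And>y. dist y x < r \<Longrightarrow>
      y \<in> S \<and> dist (Da y b) (Da x b) < e \<and> dist (Db y a) (Db x a) < e"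
    unfolding eventually_nhds_metric by blast
  define n where "n = norm a + norm b + 1"
  define h where "h = r / n / 2"
  have h: "h > 0" "h * (norm a + norm b) < r"
  proof -
    have p: "n > 0" using norm_ge_zero[of a] norm_ge_zero[of b] unfolding n_def by linarith
    show "h > 0" using p r(1) by (simp add: h_def)
    then have "h * (norm a + norm b) \<le> h * n" by (simp add: n_def)
    also have "\<dots> = r / 2" using p by (simp add: h_def)
    finally show "h * (norm a + norm b) < r" using r(1) by simp
  qed
  have near: "dist (x + s *\<^sub>R a + t *\<^sub>R b) x < r" if "0 \<le> s" "s \<le> h" "0 \<le> t" "t \<le> h" for s t
  proof -
    have "norm (s *\<^sub>R a + t *\<^sub>R b) \<le> norm (s *\<^sub>R a) + norm (t *\<^sub>R b)" by (rule norm_triangle_ineq)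
    also have "\<dots> \<le> h * norm a + h * norm b"
      using that by (auto intro!: add_mono mult_right_mono)
    also have "\<dots> < r" using h(2) by (simp add: algebra_simps)
    finally show ?thesis by (simp add: dist_norm algebra_simps)
  qed
  have near_ab: "x + s *\<^sub>R a + t *\<^sub>R b \<in> S"
      and near_ba: "x + s *\<^sub>R b + t *\<^sub>R a \<in> S"
    if "0 \<le> s" "s \<le> h" "0 \<le> t" "t \<le> h" for s t
    using near[OF that] near[OF that(3,4,1,2)] r(2) by (simp_all add: algebra_simps)
  have "\<exists>s t. 0 \<le> s \<and> s \<le> h \<and> 0 \<le> t \<and> t \<le> h \<and>
    \<phi> (x + h *\<^sub>R a + h *\<^sub>R b) - \<phi> (x + h *\<^sub>R a) - \<phi> (x + h *\<^sub>R b) + \<phi> x =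
      h * (h * Da (x + s *\<^sub>R a + t *\<^sub>R b) b)"
    by (rule second_difference[OF h(1), where S = S and \<phi>' = \<phi>']; rule near_ab d da; assumption)
  then obtain s t where st: "0 \<le> s" "s \<le> h" "0 \<le> t" "t \<le> h"
    "\<phi> (x + h *\<^sub>R a + h *\<^sub>R b) - \<phi> (x + h *\<^sub>R a) - \<phi> (x + h *\<^sub>R b) + \<phi> x =
      h * (h * Da (x + s *\<^sub>R a + t *\<^sub>R b) b)" by blast
  have "\<exists>s t. 0 \<le> s \<and> s \<le> h \<and> 0 \<le> t \<and> t \<le> h \<and>
    \<phi> (x + h *\<^sub>R b + h *\<^sub>R a) - \<phi> (x + h *\<^sub>R b) - \<phi> (x + h *\<^sub>R a) + \<phi> x =
      h * (h * Db (x + s *\<^sub>R b + t *\<^sub>R a) a)"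
    by (rule second_difference[OF h(1), where S = S and \<phi>' = \<phi>']; rule near_ba d db; assumption)
  then obtain s' t' where st': "0 \<le> s'" "s' \<le> h" "0 \<le> t'" "t' \<le> h"
    "\<phi> (x + h *\<^sub>R b + h *\<^sub>R a) - \<phi> (x + h *\<^sub>R b) - \<phi> (x + h *\<^sub>R a) + \<phi> x =
      h * (h * Db (x + s' *\<^sub>R b + t' *\<^sub>R a) a)" by blast
  have "h * (h * Da (x + s *\<^sub>R a + t *\<^sub>R b) b) = h * (h * Db (x + s' *\<^sub>R b + t' *\<^sub>R a) a)"
    using st(5) st'(5) by (simp add: algebra_simps)
  then have "Da (x + s *\<^sub>R a + t *\<^sub>R b) b = Db (x + t' *\<^sub>R a + s' *\<^sub>R b) a"
    using h(1) by (simp add: algebra_simps)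
  moreover have "dist (Da (x + s *\<^sub>R a + t *\<^sub>R b) b) (Da x b) < e"
    using r(2)[OF near[OF st(1-4)]] by blast
  moreover have "dist (Db (x + t' *\<^sub>R a + s' *\<^sub>R b) a) (Db x a) < e"
    using r(2)[OF near[OF st'(3,4,1,2)]] by blast
  ultimately show False unfolding e_def dist_real_def by argo
qed

lemma second_derivative_symmetric:
  fixes f :: "'e::model_space \<Rightarrow> 'f::model_space"
  assumes S: "open S" "x \<in> S" and f: "smooth_on S f"
  shows "frechet_derivative (\<lambda>y. frechet_derivative f (at y) a) (at x) b =
    frechet_derivative (\<lambda>y. frechet_derivative f (at y) b) (at x) a"
proof -
  let ?D2 = "\<lambda>a y b. frechet_derivative (\<lambda>y. frechet_derivative f (at y) a) (at y) b"
  have "?D2 a x b \<bullet> c = ?D2 b x a \<bullet> c" for c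
  proof -
    have 1: "((\<lambda>y. f y \<bullet> c) has_derivative (\<lambda>v. frechet_derivative f (at y) v \<bullet> c)) (at y)"
      if "y \<in> S" for y
      by (rule has_derivative_inner_left[OF smooth_on_has_derivative[OF f that]])
    have 2: "((\<lambda>y. frechet_derivative f (at y) v \<bullet> c) has_derivative (\<lambda>b. ?D2 v y b \<bullet> c)) (at y)"
      if "y \<in> S" for y v
      by (rule has_derivative_inner_left[OF smooth_on_has_derivative[OF smooth_on_derivative[OF f] that]])
    have 3: "continuous_on S (\<lambda>y. ?D2 v y w \<bullet> c)" for v w
      using smooth_on_continuous[OF smooth_on_derivative[OF smooth_on_derivative[OF f]]]
      by (intro continuous_intros)
    show ?thesis by (rule second_derivative_symmetric_real[OF S 1 2 2 3 3])
  qed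
  from this[of "?D2 a x b - ?D2 b x a"]
  have "(?D2 a x b - ?D2 b x a) \<bullet> (?D2 a x b - ?D2 b x a) = 0" by (simp only: inner_diff_left)
  then show ?thesis by simp
qed

lemma bilinear_expansion:
  fixes B :: "'e::model_space \<Rightarrow> 'f::model_space \<Rightarrow> 'g::real_vector"
  assumes "bilinear B"
  shows "B u v = (\<Sum>b\<in>onb. \<Sum>c\<in>onb. ((u \<bullet> b) * (v \<bullet> c)) *\<^sub>R B b c)"
proof -
  have l: "linear (\<lambda>u. B u v)" "linear (B b)" for b v using assms by (auto simp: bilinear_def)
  have "B u v = (\<Sum>b\<in>onb. (u \<bullet> b) *\<^sub>R B b v)" by (rule linear_expansion[OF l(1)])
  also have "\<dots> = (\<Sum>b\<in>onb. (u \<bullet> b) *\<^sub>R (\<Sum>c\<in>onb. (v \<bullet> c) *\<^sub>R B b c))"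
    by (intro sum.cong refl arg_cong[where f = "scaleR _"]) (rule linear_expansion[OF l(2)])
  finally show ?thesis by (simp add: scaleR_sum_right)
qed

lemma smooth_on_pullback:
  fixes s :: "'f::model_space \<Rightarrow> 'e::model_space"
  assumes X: "open X" and Y: "open Y" and s: "smooth_on Y s" "s ` Y \<subseteq> X"
    and bil: "\<And>x. x \<in> X \<Longrightarrow> bilinear (\<Omega> x)" and \<Omega>: "\<And>u v. smooth_on X (\<lambda>x. \<Omega> x u v :: real)"
  shows "smooth_on Y (\<lambda>y. \<Omega> (s y) (frechet_derivative s (at y) u) (frechet_derivative s (at y) v))"
    (is "smooth_on Y (\<lambda>y. \<Omega> (s y) (?s y u) (?s y v))")
proof -
  have "C_k_on k Y (\<lambda>y. \<Sum>b\<in>onb. \<Sum>c\<in>onb. (?s y u \<bullet> b) *\<^sub>R (?s y v \<bullet> c) *\<^sub>R \<Omega> (s y) b c)" for k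
  proof -
    have 1: "C_k_on k Y (\<lambda>y. ?s y w)" for w
      using smooth_on_derivative[OF s(1)] unfolding smooth_on_def by blast
    have 2: "C_k_on k Y (\<lambda>y. \<Omega> (s y) b c)" for b c
      using smooth_on_compose[OF Y X s(2,1) \<Omega>] unfolding smooth_on_def by blast
    show ?thesis by (intro C_k_on_sum C_k_on_scaleR C_k_on_inner Y 1 2)
  qed
  then have "smooth_on Y (\<lambda>y. \<Sum>b\<in>onb. \<Sum>c\<in>onb. (?s y u \<bullet> b) *\<^sub>R (?s y v \<bullet> c) *\<^sub>R \<Omega> (s y) b c)"
    by (simp add: smooth_on_def)
  then show ?thesis
  proof (rule smooth_on_cong[OF Y, THEN iffD1, rotated])
    fix y assume "y \<in> Y"
    then have "bilinear (\<Omega> (s y))" using s(2) bil by blast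
    from bilinear_expansion[OF this, of "?s y u" "?s y v"]
    show "(\<Sum>b\<in>onb. \<Sum>c\<in>onb. (?s y u \<bullet> b) *\<^sub>R (?s y v \<bullet> c) *\<^sub>R \<Omega> (s y) b c) = \<Omega> (s y) (?s y u) (?s y v)"
      by (simp add: mult.assoc)
  qed
qed

text \<open>Differentiating the pullback \<open>s\<^sup>*\<Omega>\<close> gives the pullback of the derivative of \<open>\<Omega>\<close> and two terms
  with second derivatives of \<open>s\<close>. The latter cancel in the alternating sum, as second derivatives are
  symmetric and \<open>\<Omega>\<close> is alternating.\<close>

lemma closed_pullback:
  fixes s :: "'f::model_space \<Rightarrow> 'e::model_space"
  assumes X: "open X" and Y: "open Y" "y0 \<in> Y" and s: "smooth_on Y s" "s ` Y \<subseteq> X"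
    and bil: "\<And>x. x \<in> X \<Longrightarrow> bilinear (\<Omega> x)" and alt: "\<And>x v. x \<in> X \<Longrightarrow> \<Omega> x v v = 0"
    and \<Omega>: "\<And>u v. smooth_on X (\<lambda>x. \<Omega> x u v :: real)"
    and D: "D = (\<lambda>a b c. frechet_derivative (\<lambda>x. \<Omega> x b c) (at (s y0)) a)"
    and closed: "\<And>u v w. D u v w - D v u w + D w u v = 0"
    and D': "D' = (\<lambda>a b c. frechet_derivative (\<lambda>y. \<Omega> (s y) (frechet_derivative s (at y) b)
        (frechet_derivative s (at y) c)) (at y0) a)"
  shows "D' u v w - D' v u w + D' w u v = 0"
proof -
  let ?s = "\<lambda>y. frechet_derivative s (at y)"
  define s2 where "s2 = (\<lambda>a b. frechet_derivative (\<lambda>y. ?s y b) (at y0) a)"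
  let ?\<Omega> = "\<Omega> (s y0)"
  have x0: "s y0 \<in> X" using Y s(2) by auto
  have sym: "s2 a b = s2 b a" for a b
    unfolding s2_def by (rule second_derivative_symmetric[OF Y s(1)])
  have ds: "(s has_derivative ?s y0) (at y0)" using smooth_on_has_derivative[OF s(1) Y(2)] .
  have ds2: "((\<lambda>y. ?s y b) has_derivative (\<lambda>a. s2 a b)) (at y0)" for b
    unfolding s2_def using smooth_on_has_derivative[OF smooth_on_derivative[OF s(1)] Y(2)] .
  have d\<Omega>: "((\<lambda>x. \<Omega> x b c) has_derivative (\<lambda>a. D a b c)) (at (s y0))" for b c
    unfolding D using smooth_on_has_derivative[OF \<Omega> x0] .
  note bil0 = bil[OF x0]
  have D_bilinear: "D a b c = (\<Sum>i\<in>onb. \<Sum>j\<in>onb. ((b \<bullet> i) * (c \<bullet> j)) *\<^sub>R D a i j)" for a b c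
  proof -
    have "((\<lambda>x. \<Sum>i\<in>onb. \<Sum>j\<in>onb. ((b \<bullet> i) * (c \<bullet> j)) *\<^sub>R \<Omega> x i j) has_derivative
        (\<lambda>a. \<Sum>i\<in>onb. \<Sum>j\<in>onb. ((b \<bullet> i) * (c \<bullet> j)) *\<^sub>R D a i j)) (at (s y0))"
      by (intro has_derivative_sum has_derivative_scaleR_right d\<Omega>)
    then have *: "((\<lambda>x. \<Omega> x b c) has_derivative
        (\<lambda>a. \<Sum>i\<in>onb. \<Sum>j\<in>onb. ((b \<bullet> i) * (c \<bullet> j)) *\<^sub>R D a i j)) (at (s y0))"
      by (rule has_derivative_transform_within_open[OF _ X x0])
        (rule bilinear_expansion[OF bil, symmetric])
    show ?thesis by (rule fun_cong[OF has_derivative_unique[OF d\<Omega> *]])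
  qed
  have D'_eq: "D' a b c = D (?s y0 a) (?s y0 b) (?s y0 c) + ?\<Omega> (s2 a b) (?s y0 c) + ?\<Omega> (?s y0 b) (s2 a c)"
    for a b c
  proof -
    let ?f' = "\<lambda>a. \<Sum>i\<in>onb. \<Sum>j\<in>onb.
        ((?s y0 b \<bullet> i) * (?s y0 c \<bullet> j)) *\<^sub>R D (?s y0 a) i j +
        ((?s y0 b \<bullet> i) * (s2 a c \<bullet> j) + (s2 a b \<bullet> i) * (?s y0 c \<bullet> j)) *\<^sub>R ?\<Omega> i j"
    have "((\<lambda>y. \<Sum>i\<in>onb. \<Sum>j\<in>onb. ((?s y b \<bullet> i) * (?s y c \<bullet> j)) *\<^sub>R \<Omega> (s y) i j)
        has_derivative ?f') (at y0)"
      by (intro has_derivative_sum has_derivative_scaleR has_derivative_mult has_derivative_inner_left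
          ds2 has_derivative_compose[OF ds d\<Omega>])
    then have "((\<lambda>y. \<Omega> (s y) (?s y b) (?s y c)) has_derivative ?f') (at y0)"
      by (rule has_derivative_transform_within_open[OF _ Y])
        (rule bilinear_expansion[OF bil, symmetric], use s(2) in blast)
    then have "D' a b c = ?f' a"
      unfolding D' by (rule fun_cong[OF frechet_derivative_at[symmetric]])
    also have "\<dots> = D (?s y0 a) (?s y0 b) (?s y0 c) + ?\<Omega> (s2 a b) (?s y0 c) + ?\<Omega> (?s y0 b) (s2 a c)"
      by (simp add: D_bilinear[of "?s y0 a" "?s y0 b" "?s y0 c"]
          bilinear_expansion[OF bil0, of "s2 a b" "?s y0 c"]
          bilinear_expansion[OF bil0, of "?s y0 b" "s2 a c"] sum.distrib algebra_simps)
    finally show ?thesis .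
  qed
  have anti: "?\<Omega> a b = - ?\<Omega> b a" for a b
  proof -
    have "?\<Omega> (a + b) (a + b) = ?\<Omega> a a + ?\<Omega> a b + ?\<Omega> b a + ?\<Omega> b b"
      by (simp add: bilinear_ladd[OF bil0] bilinear_radd[OF bil0])
    then show ?thesis by (simp add: alt[OF x0])
  qed
  have "D' u v w - D' v u w + D' w u v =
      (D (?s y0 u) (?s y0 v) (?s y0 w) - D (?s y0 v) (?s y0 u) (?s y0 w) + D (?s y0 w) (?s y0 u) (?s y0 v))
      + (?\<Omega> (s2 u v) (?s y0 w) - ?\<Omega> (s2 v u) (?s y0 w))
      + (?\<Omega> (?s y0 v) (s2 u w) + ?\<Omega> (s2 w u) (?s y0 v))
      + (?\<Omega> (?s y0 u) (s2 w v) - ?\<Omega> (?s y0 u) (s2 v w))"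
    unfolding D'_eq by simp
  also have "\<dots> = 0"
    using anti[of "?s y0 v" "s2 u w"] by (simp add: closed sym[of v u] sym[of w u] sym[of w v])
  finally show ?thesis .
qed

section \<open>Differentials of maps between manifolds\<close>

definition is_chart :: "('a, 'e::model_space) manifold \<Rightarrow> ('a, 'e) chart \<Rightarrow> bool" where
  "is_chart M c \<longleftrightarrow> openin (mtop M) (fst c) \<and> open (snd c ` fst c) \<and>
     homeomorphic_map (subtopology (mtop M) (fst c)) (top_of_set (snd c ` fst c)) (snd c)"

text \<open>The differential at a point refers to the preferred charts at that point and its image only. Its
  calculus rests on the property that each preferred chart is a homeomorphism onto an open set.\<close>

definition charted :: "('a, 'e::model_space) manifold \<Rightarrow> bool" where
  "charted M \<longleftrightarrow> (\<forall>x\<in>points M. chart_at M x \<in> atlas M \<and> is_chart M (chart_at M x) \<and> x \<in> fst (chart_at M x))"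

lemma smooth_manifold_chart: "smooth_manifold M \<Longrightarrow> c \<in> atlas M \<Longrightarrow> is_chart M c"
  unfolding smooth_manifold_def is_chart_def by (cases c) auto

lemma smooth_manifold_charted: "smooth_manifold M \<Longrightarrow> charted M"
  using smooth_manifold_chart unfolding charted_def smooth_manifold_def by blast

lemma chart_subset_points: "is_chart M c \<Longrightarrow> fst c \<subseteq> points M"
  unfolding is_chart_def by (simp add: openin_subset)

lemma topspace_chart: "is_chart M c \<Longrightarrow> topspace (subtopology (mtop M) (fst c)) = fst c"
  by (rule topspace_subtopology_subset[OF chart_subset_points])

lemma chart_inj: "is_chart M c \<Longrightarrow> inj_on (snd c) (fst c)"
  using topspace_chart[of M c] homeomorphic_imp_injective_map unfolding is_chart_def by metis

lemma chart_inv_left: "is_chart M c \<Longrightarrow> x \<in> fst c \<Longrightarrow> chart_inv c (snd c x) = x"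
  by (rule inv_into_f_f[OF chart_inj])

lemma chart_inv_right: "y \<in> snd c ` fst c \<Longrightarrow> snd c (chart_inv c y) = y"
  by (rule f_inv_into_f)

lemma chart_inv_in: "y \<in> snd c ` fst c \<Longrightarrow> chart_inv c y \<in> fst c"
  by (rule inv_into_into)

lemma chart_image_open:
  assumes c: "is_chart M c" and U: "openin (mtop M) U" "U \<subseteq> fst c"
  shows "open (snd c ` U)"
proof -
  have "openin (subtopology (mtop M) (fst c)) U"
    using U openin_subtopology_Int2 by (metis inf.absorb_iff2)
  then have "openin (top_of_set (snd c ` fst c)) (snd c ` U)"
    using c homeomorphic_imp_open_map unfolding is_chart_def open_map_def by blast
  then show ?thesis using c openin_open_trans unfolding is_chart_def by blast
qed

lemma chart_preimage_open:
  assumes c: "is_chart M c" and V: "open V"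
  shows "openin (mtop M) {x \<in> fst c. snd c x \<in> V}"
proof -
  note t = topspace_chart[OF c]
  have "continuous_map (subtopology (mtop M) (fst c)) euclidean (snd c)"
    using c homeomorphic_imp_continuous_map unfolding is_chart_def
    by (metis continuous_map_in_subtopology)
  from openin_continuous_map_preimage[OF this, of V] V
  have "openin (subtopology (mtop M) (fst c)) {x \<in> fst c. snd c x \<in> V}" unfolding t by simp
  then show ?thesis using c openin_trans_full unfolding is_chart_def by blast
qed

lemma is_chart_prod:
  assumes c: "is_chart M c" and d: "is_chart N d"
  shows "is_chart (prod_manifold M N) (prod_chart c d)"
proof -
  let ?X = "subtopology (mtop M) (fst c)" and ?Y = "subtopology (mtop N) (fst d)"
  obtain c' d' where "homeomorphic_maps ?X (top_of_set (snd c ` fst c)) (snd c) c'"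
      "homeomorphic_maps ?Y (top_of_set (snd d ` fst d)) (snd d) d'"
    using c d unfolding is_chart_def homeomorphic_map_maps by blast
  then have "homeomorphic_maps (prod_topology ?X ?Y)
      (prod_topology (top_of_set (snd c ` fst c)) (top_of_set (snd d ` fst d)))
      (\<lambda>(x, y). (snd c x, snd d y)) (\<lambda>(x, y). (c' x, d' y))"
    by (simp only: homeomorphic_maps_prod) simp
  moreover have "(\<lambda>(x, y). (snd c x, snd d y)) = map_prod (snd c) (snd d)" by auto
  ultimately have "homeomorphic_map (subtopology (prod_topology (mtop M) (mtop N)) (fst c \<times> fst d))
      (top_of_set ((snd c ` fst c) \<times> (snd d ` fst d))) (map_prod (snd c) (snd d))"
    unfolding homeomorphic_map_maps subtopology_Times prod_topology_subtopology_eu by auto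
  moreover have "map_prod (snd c) (snd d) ` (fst c \<times> fst d) = (snd c ` fst c) \<times> (snd d ` fst d)"
    by (simp add: map_prod_surj_on)
  moreover have "open ((snd c ` fst c) \<times> (snd d ` fst d))"
    using c d by (intro open_Times) (auto simp: is_chart_def)
  ultimately show ?thesis
    using c d unfolding is_chart_def prod_chart_def prod_manifold_def
    by (simp add: openin_prod_Times_iff)
qed

lemma chart_inv_prod:
  assumes "is_chart M c" "is_chart N d" "u \<in> snd c ` fst c" "v \<in> snd d ` fst d"
  shows "chart_inv (prod_chart c d) (u, v) = (chart_inv c u, chart_inv d v)"
proof -
  have "map_prod (snd c) (snd d) (chart_inv c u, chart_inv d v) = (u, v)"
    using assms(3,4) by (simp add: chart_inv_right)
  moreover have "(chart_inv c u, chart_inv d v) \<in> fst c \<times> fst d"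
    using assms(3,4) by (simp add: chart_inv_in)
  moreover have "inj_on (map_prod (snd c) (snd d)) (fst c \<times> fst d)"
    by (rule map_prod_inj_on[OF chart_inj[OF assms(1)] chart_inj[OF assms(2)]])
  ultimately have "inv_into (fst c \<times> fst d) (map_prod (snd c) (snd d)) (u, v) =
      (chart_inv c u, chart_inv d v)"
    using inv_into_f_f[of "map_prod (snd c) (snd d)" "fst c \<times> fst d" "(chart_inv c u, chart_inv d v)"]
    by simp
  then show ?thesis by (simp add: prod_chart_def)
qed

lemma points_prod [simp]: "points (prod_manifold M N) = points M \<times> points N"
  by (simp add: prod_manifold_def)

lemma charted_prod: "charted M \<Longrightarrow> charted N \<Longrightarrow> charted (prod_manifold M N)"
proof -
  assume M: "charted M" and N: "charted N"
  have "chart_at (prod_manifold M N) (x, y) \<in> atlas (prod_manifold M N) \<and>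
      is_chart (prod_manifold M N) (chart_at (prod_manifold M N) (x, y)) \<and>
      (x, y) \<in> fst (chart_at (prod_manifold M N) (x, y))"
    if "x \<in> points M" "y \<in> points N" for x y
  proof -
    have e: "chart_at (prod_manifold M N) (x, y) = prod_chart (chart_at M x) (chart_at N y)"
      by (simp add: prod_manifold_def)
    have "prod_chart (chart_at M x) (chart_at N y) \<in> atlas (prod_manifold M N)"
      using M N that unfolding charted_def prod_manifold_def manifold.simps by blast
    moreover have "is_chart (prod_manifold M N) (prod_chart (chart_at M x) (chart_at N y))"
      using M N that by (intro is_chart_prod) (auto simp: charted_def)
    moreover have "(x, y) \<in> fst (prod_chart (chart_at M x) (chart_at N y))"
      using M N that by (auto simp: charted_def prod_chart_def)
    ultimately show ?thesis unfolding e by blast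
  qed
  then show ?thesis unfolding charted_def points_prod by blast
qed

lemma model_manifold_simps [simp]:
  "points model_manifold = UNIV" "mtop model_manifold = euclidean" "chart_at model_manifold x = (UNIV, id)"
  "atlas model_manifold = {(UNIV, id)}"
  by (simp_all add: model_manifold_def)

lemma model_chart: "is_chart model_manifold (UNIV, id :: 'e::model_space \<Rightarrow> 'e)"
  by (simp add: is_chart_def)

lemma charted_model: "charted (model_manifold :: ('e::model_space, 'e) manifold)"
  by (simp add: charted_def model_chart)

definition cont_at ::
    "('a, 'e) manifold \<Rightarrow> ('b, 'f) manifold \<Rightarrow> ('a \<Rightarrow> 'b) \<Rightarrow> 'a \<Rightarrow> bool" where
  "cont_at M N f x \<longleftrightarrow> x \<in> points M \<and> f x \<in> points N \<and>
     (\<forall>V. openin (mtop N) V \<and> f x \<in> V \<longrightarrow> (\<exists>U. openin (mtop M) U \<and> x \<in> U \<and> (\<forall>x'\<in>U. f x' \<in> V)))"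

text \<open>A relation in the style of \<open>has_derivative\<close>, rather than the function \<open>mdiff\<close>, lets the chain
  rule apply to maps with good properties near one point only, such as local sections of a submersion.\<close>

definition has_mderiv ::
    "('a, 'e::model_space) manifold \<Rightarrow> ('b, 'f::model_space) manifold \<Rightarrow> ('a \<Rightarrow> 'b)
      \<Rightarrow> 'a \<Rightarrow> ('e \<Rightarrow> 'f) \<Rightarrow> bool" where
  "has_mderiv M N f x D \<longleftrightarrow> charted M \<and> charted N \<and> cont_at M N f x \<and>
     ((snd (chart_at N (f x)) \<circ> f \<circ> chart_inv (chart_at M x)) has_derivative D) (at (snd (chart_at M x) x))"

lemma mderiv_points: "has_mderiv M N f x D \<Longrightarrow> x \<in> points M" "has_mderiv M N f x D \<Longrightarrow> f x \<in> points N"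
  by (auto simp: has_mderiv_def cont_at_def)

lemma mderiv_cont_at: "has_mderiv M N f x D \<Longrightarrow> cont_at M N f x"
  by (simp add: has_mderiv_def)

lemma mderiv_charted: "has_mderiv M N f x D \<Longrightarrow> charted M" "has_mderiv M N f x D \<Longrightarrow> charted N"
  by (simp_all add: has_mderiv_def)

lemma mderiv_mdiff: "has_mderiv M N f x D \<Longrightarrow> mdiff M N f x = D"
  unfolding has_mderiv_def mdiff_def using frechet_derivative_at by metis

lemma mderiv_unique: "has_mderiv M N f x D \<Longrightarrow> has_mderiv M N f x D' \<Longrightarrow> D = D'"
  using mderiv_mdiff by metis

lemma mderiv_linear: "has_mderiv M N f x D \<Longrightarrow> linear D"
  unfolding has_mderiv_def using has_derivative_linear by blast

lemma continuous_map_cont_at: "continuous_map (mtop M) (mtop N) f \<Longrightarrow> x \<in> points M \<Longrightarrow> cont_at M N f x"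
proof -
  assume f: "continuous_map (mtop M) (mtop N) f" and x: "x \<in> points M"
  have "\<exists>U. openin (mtop M) U \<and> x \<in> U \<and> (\<forall>x'\<in>U. f x' \<in> V)" if "openin (mtop N) V" "f x \<in> V" for V
    using openin_continuous_map_preimage[OF f that(1)] x that(2)
    by (intro exI[of _ "{x \<in> points M. f x \<in> V}"]) auto
  then show ?thesis using f x by (auto simp: cont_at_def continuous_map_def)
qed

lemma cont_at_open_nbhd:
  assumes "cont_at M N f x" "openin (mtop N) V" "f x \<in> V"
  obtains U where "openin (mtop M) U" "x \<in> U" "\<And>x'. x' \<in> U \<Longrightarrow> f x' \<in> V"
  using assms unfolding cont_at_def by blast

lemma chart_nbhd:
  assumes "is_chart M c" "x \<in> fst c" "openin (mtop M) U" "x \<in> U"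
  obtains T where "open T" "snd c x \<in> T" "T \<subseteq> snd c ` fst c" "\<And>y. y \<in> T \<Longrightarrow> chart_inv c y \<in> U"
proof
  have o: "openin (mtop M) (U \<inter> fst c)" using assms unfolding is_chart_def by blast
  show "open (snd c ` (U \<inter> fst c))" using chart_image_open[OF assms(1) o] by simp
  show "chart_inv c y \<in> U" if "y \<in> snd c ` (U \<inter> fst c)" for y
    using that chart_inv_left[OF assms(1)] by auto
qed (use assms in auto)

lemma mderiv_cong:
  assumes f: "has_mderiv M N f x D"
    and U: "openin (mtop M) U" "x \<in> U" "\<And>x'. x' \<in> U \<Longrightarrow> f x' = g x'"
  shows "has_mderiv M N g x D"
proof -
  note x = mderiv_points(1)[OF f] and M = mderiv_charted(1)[OF f]
  let ?c = "chart_at M x"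
  have c: "is_chart M ?c" "x \<in> fst ?c" using M x by (auto simp: charted_def)
  have fx: "f x = g x" using U by blast
  obtain T where T: "open T" "snd ?c x \<in> T" "\<And>y. y \<in> T \<Longrightarrow> chart_inv ?c y \<in> U"
    using chart_nbhd[OF c U(1,2)] by metis
  have "cont_at M N g x" unfolding cont_at_def
  proof (intro conjI allI impI)
    fix V assume V: "openin (mtop N) V \<and> g x \<in> V"
    then obtain U' where "openin (mtop M) U'" "x \<in> U'" "\<And>x'. x' \<in> U' \<Longrightarrow> f x' \<in> V"
      using cont_at_open_nbhd f unfolding has_mderiv_def fx[symmetric] by metis
    then show "\<exists>U. openin (mtop M) U \<and> x \<in> U \<and> (\<forall>x'\<in>U. g x' \<in> V)"
      using U(1,2) by (intro exI[of _ "U \<inter> U'"]) (auto simp: U(3)[symmetric])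
  qed (use f fx in \<open>auto simp: has_mderiv_def cont_at_def\<close>)
  moreover have "((snd (chart_at N (g x)) \<circ> g \<circ> chart_inv ?c) has_derivative D) (at (snd ?c x))"
  proof (rule has_derivative_transform_within_open[OF _ T(1,2)])
    show "((snd (chart_at N (g x)) \<circ> f \<circ> chart_inv ?c) has_derivative D) (at (snd ?c x))"
      using f by (simp add: has_mderiv_def fx)
  qed (simp add: T(3) U(3))
  ultimately show ?thesis using f by (simp add: has_mderiv_def)
qed

text \<open>Identities between differentials are read off from identities between maps by this rule.\<close>

lemma mderiv_germ_unique:
  assumes "has_mderiv M N f x D" "has_mderiv M N g x E"
    and "openin (mtop M) U" "x \<in> U" "\<And>x'. x' \<in> U \<Longrightarrow> f x' = g x'"
  shows "D v = E v"
  by (rule fun_cong[OF mderiv_unique[OF mderiv_cong[OF assms(1,3,4,5)] assms(2)]])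

lemma mderiv_compose:
  assumes f: "has_mderiv M N f x D" and g: "has_mderiv N P g (f x) E"
  shows "has_mderiv M P (\<lambda>x. g (f x)) x (\<lambda>v. E (D v))"
proof -
  note M = mderiv_charted(1)[OF f] and N = mderiv_charted(2)[OF f]
  let ?c = "chart_at M x" and ?d = "chart_at N (f x)"
  note x = mderiv_points[OF f]
  have c: "is_chart M ?c" "x \<in> fst ?c" and d: "is_chart N ?d" "f x \<in> fst ?d"
    using M N x by (auto simp: charted_def)
  have cont: "cont_at M N f x" "cont_at N P g (f x)" using f g by (auto simp: has_mderiv_def)
  obtain U where U: "openin (mtop M) U" "x \<in> U" "\<And>x'. x' \<in> U \<Longrightarrow> f x' \<in> fst ?d"
    using cont_at_open_nbhd[OF cont(1) _ d(2)] d(1) unfolding is_chart_def by metis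
  obtain T where T: "open T" "snd ?c x \<in> T" "\<And>y. y \<in> T \<Longrightarrow> chart_inv ?c y \<in> U"
    using chart_nbhd[OF c U(1,2)] by metis
  let ?r = "snd ?d \<circ> f \<circ> chart_inv ?c" and ?s = "snd (chart_at P (g (f x))) \<circ> g \<circ> chart_inv ?d"
  have r: "(?r has_derivative D) (at (snd ?c x))" using f by (simp add: has_mderiv_def)
  have "?r (snd ?c x) = snd ?d (f x)" using chart_inv_left[OF c] by simp
  then have "(?s has_derivative E) (at (?r (snd ?c x)))" using g by (simp add: has_mderiv_def)
  from diff_chain_at[OF r this]
  have "((snd (chart_at P (g (f x))) \<circ> (\<lambda>x. g (f x)) \<circ> chart_inv ?c) has_derivative E \<circ> D) (at (snd ?c x))"
    by (rule has_derivative_transform_within_open[OF _ T(1,2)])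
      (simp add: chart_inv_left[OF d(1)] U(3) T(3))
  moreover have "cont_at M P (\<lambda>x. g (f x)) x" unfolding cont_at_def
  proof (intro conjI allI impI)
    fix V assume "openin (mtop P) V \<and> g (f x) \<in> V"
    then obtain V' where V': "openin (mtop N) V'" "f x \<in> V'" "\<And>x'. x' \<in> V' \<Longrightarrow> g x' \<in> V"
      using cont_at_open_nbhd[OF cont(2)] by metis
    obtain U' where "openin (mtop M) U'" "x \<in> U'" "\<And>x'. x' \<in> U' \<Longrightarrow> f x' \<in> V'"
      using cont_at_open_nbhd[OF cont(1) V'(1,2)] by metis
    then show "\<exists>U. openin (mtop M) U \<and> x \<in> U \<and> (\<forall>x'\<in>U. g (f x') \<in> V)" using V'(3) by blast
  qed (use x mderiv_points[OF g] in auto)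
  ultimately show ?thesis using f g by (simp add: has_mderiv_def o_def)
qed

lemma mderiv_const:
  "charted M \<Longrightarrow> charted N \<Longrightarrow> x \<in> points M \<Longrightarrow> k \<in> points N \<Longrightarrow> has_mderiv M N (\<lambda>x. k) x (\<lambda>v. 0)"
  unfolding has_mderiv_def cont_at_def
  by (auto simp: o_def intro: exI[of _ "points M"])

lemma mderiv_ident:
  assumes "charted M" "x \<in> points M"
  shows "has_mderiv M M (\<lambda>x. x) x (\<lambda>v. v)"
proof -
  let ?c = "chart_at M x"
  have c: "is_chart M ?c" "x \<in> fst ?c" using assms by (auto simp: charted_def)
  have "((snd ?c \<circ> (\<lambda>x. x) \<circ> chart_inv ?c) has_derivative (\<lambda>v. v)) (at (snd ?c x))"
    by (rule has_derivative_transform_within_open[OF has_derivative_ident, of "snd ?c ` fst ?c"])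
      (use c in \<open>auto simp: is_chart_def chart_inv_right\<close>)
  then show ?thesis using assms by (auto simp: has_mderiv_def cont_at_def)
qed

lemma mderiv_Pair:
  assumes f: "has_mderiv M N f x D" and g: "has_mderiv M P g x E"
  shows "has_mderiv M (prod_manifold N P) (\<lambda>x. (f x, g x)) x (\<lambda>v. (D v, E v))"
proof -
  have "cont_at M (prod_manifold N P) (\<lambda>x. (f x, g x)) x" unfolding cont_at_def
  proof (intro conjI allI impI)
    fix V assume V: "openin (mtop (prod_manifold N P)) V \<and> (f x, g x) \<in> V"
    then obtain A B where AB: "openin (mtop N) A" "openin (mtop P) B" "f x \<in> A" "g x \<in> B" "A \<times> B \<subseteq> V"
      unfolding prod_manifold_def manifold.simps openin_prod_topology_alt by blast
    obtain U where "openin (mtop M) U" "x \<in> U" "\<And>x'. x' \<in> U \<Longrightarrow> f x' \<in> A"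
      using cont_at_open_nbhd f AB unfolding has_mderiv_def by metis
    moreover obtain U' where "openin (mtop M) U'" "x \<in> U'" "\<And>x'. x' \<in> U' \<Longrightarrow> g x' \<in> B"
      using cont_at_open_nbhd g AB unfolding has_mderiv_def by metis
    ultimately show "\<exists>U. openin (mtop M) U \<and> x \<in> U \<and> (\<forall>x'\<in>U. (f x', g x') \<in> V)"
      using AB(5) by (intro exI[of _ "U \<inter> U'"]) auto
  qed (use mderiv_points[OF f] mderiv_points[OF g] in auto)
  moreover have "((snd (chart_at (prod_manifold N P) (f x, g x)) \<circ> (\<lambda>x. (f x, g x)) \<circ>
      chart_inv (chart_at M x)) has_derivative (\<lambda>v. (D v, E v))) (at (snd (chart_at M x) x))"
    using has_derivative_Pair f g unfolding has_mderiv_def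
    by (fastforce simp: prod_manifold_def prod_chart_def o_def)
  ultimately show ?thesis using f g by (simp add: has_mderiv_def charted_prod)
qed

lemma mderiv_projections:
  assumes M: "charted M" "x \<in> points M" and N: "charted N" "y \<in> points N"
  shows mderiv_fst: "has_mderiv (prod_manifold M N) M fst (x, y) fst"
    and mderiv_snd: "has_mderiv (prod_manifold M N) N snd (x, y) snd"
proof -
  let ?c = "chart_at M x" and ?d = "chart_at N y" and ?P = "prod_manifold M N"
  have c: "is_chart M ?c" "x \<in> fst ?c" and d: "is_chart N ?d" "y \<in> fst ?d"
    using assms by (auto simp: charted_def)
  have "open ((snd ?c ` fst ?c) \<times> (snd ?d ` fst ?d))"
    using c d by (intro open_Times) (auto simp: is_chart_def)
  note tr = has_derivative_transform_within_open[OF _ this]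
  have cp: "chart_at ?P (x, y) = prod_chart ?c ?d" by (simp add: prod_manifold_def)
  have at: "snd (prod_chart ?c ?d) (x, y) = (snd ?c x, snd ?d y)" by (simp add: prod_chart_def)
  have "((snd ?c \<circ> fst \<circ> chart_inv (prod_chart ?c ?d)) has_derivative fst) (at (snd ?c x, snd ?d y))"
    by (rule tr[OF has_derivative_fst[OF has_derivative_ident]])
      (use c d in \<open>auto simp: chart_inv_prod[OF c(1) d(1)] chart_inv_left[OF c(1)]\<close>)
  moreover have "((snd ?d \<circ> snd \<circ> chart_inv (prod_chart ?c ?d)) has_derivative snd) (at (snd ?c x, snd ?d y))"
    by (rule tr[OF has_derivative_snd[OF has_derivative_ident]])
      (use c d in \<open>auto simp: chart_inv_prod[OF c(1) d(1)] chart_inv_left[OF d(1)]\<close>)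
  moreover have "continuous_map (mtop ?P) (mtop M) fst" "continuous_map (mtop ?P) (mtop N) snd"
    by (simp_all add: prod_manifold_def continuous_map_fst continuous_map_snd)
  ultimately show "has_mderiv ?P M fst (x, y) fst" "has_mderiv ?P N snd (x, y) snd"
    using assms by (auto simp: has_mderiv_def cp at charted_prod intro!: continuous_map_cont_at)
qed

lemma smooth_map_charts:
  assumes "smooth_map M N f" "c \<in> atlas M" "d \<in> atlas N"
  shows "smooth_on (snd c ` {x \<in> fst c. f x \<in> fst d}) (snd d \<circ> f \<circ> chart_inv c)"
  using assms unfolding smooth_map_def by (cases c, cases d) auto

lemma smooth_map_chart_domain_open:
  assumes f: "smooth_map M N f" and c: "is_chart M c" and d: "is_chart N d"
  shows "openin (mtop M) {x \<in> fst c. f x \<in> fst d}" "open (snd c ` {x \<in> fst c. f x \<in> fst d})"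
proof -
  have "openin (mtop M) {x \<in> points M. f x \<in> fst d}"
    using f d openin_continuous_map_preimage unfolding smooth_map_def is_chart_def by blast
  moreover have "{x \<in> fst c. f x \<in> fst d} = fst c \<inter> {x \<in> points M. f x \<in> fst d}"
    using chart_subset_points[OF c] by auto
  ultimately show "openin (mtop M) {x \<in> fst c. f x \<in> fst d}" using c unfolding is_chart_def by auto
  from chart_image_open[OF c this] show "open (snd c ` {x \<in> fst c. f x \<in> fst d})" by auto
qed

lemma smooth_map_has_mderiv:
  assumes M: "charted M" and N: "charted N" and f: "smooth_map M N f" and x: "x \<in> points M"
  shows "has_mderiv M N f x (mdiff M N f x)"
proof -
  have fx: "cont_at M N f x" by (rule continuous_map_cont_at[OF _ x]) (use f in \<open>simp add: smooth_map_def\<close>)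
  then have "f x \<in> points N" by (simp add: cont_at_def)
  then have "snd (chart_at M x) x \<in> snd (chart_at M x) ` {x' \<in> fst (chart_at M x). f x' \<in> fst (chart_at N (f x))}"
    using M N x by (auto simp: charted_def)
  moreover have "chart_at M x \<in> atlas M" "chart_at N (f x) \<in> atlas N"
    using M N x \<open>f x \<in> points N\<close> by (auto simp: charted_def)
  ultimately show ?thesis
    using smooth_on_has_derivative[OF smooth_map_charts[OF f]] fx M N
    by (simp add: has_mderiv_def mdiff_def)
qed

lemma open_submanifold_simps [simp]:
  "mtop (open_submanifold M W) = subtopology (mtop M) W"
  "chart_at (open_submanifold M W) x = (fst (chart_at M x) \<inter> W, snd (chart_at M x))"
  by (simp_all add: open_submanifold_def)

lemma is_chart_Int:
  assumes c: "is_chart M c" and W: "openin (mtop M) W"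
  shows "is_chart (open_submanifold M W) (fst c \<inter> W, snd c)"
proof -
  note t = topspace_chart[OF c]
  have "homeomorphic_map (subtopology (subtopology (mtop M) (fst c)) (fst c \<inter> W))
      (subtopology (top_of_set (snd c ` fst c)) (snd c ` (fst c \<inter> W))) (snd c)"
  proof (rule homeomorphic_map_subtopologies_alt)
    show "homeomorphic_map (subtopology (mtop M) (fst c)) (top_of_set (snd c ` fst c)) (snd c)"
      using c by (simp add: is_chart_def)
    show "snd c x \<in> snd c ` (fst c \<inter> W) \<longleftrightarrow> x \<in> fst c \<inter> W"
      if "x \<in> topspace (subtopology (mtop M) (fst c))" "snd c x \<in> topspace (top_of_set (snd c ` fst c))" for x
      using chart_inj[OF c] that unfolding t by (auto dest: inj_onD)
  qed
  moreover have "subtopology (subtopology (mtop M) (fst c)) (fst c \<inter> W) = subtopology (subtopology (mtop M) W) (fst c \<inter> W)"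
    by (simp add: subtopology_subtopology Int_ac Int_absorb1 Int_absorb2)
  moreover have "subtopology (top_of_set (snd c ` fst c)) (snd c ` (fst c \<inter> W)) = top_of_set (snd c ` (fst c \<inter> W))"
    by (simp add: subtopology_subtopology Int_absorb1 image_mono)
  moreover have "openin (subtopology (mtop M) W) (fst c \<inter> W)"
    using c unfolding is_chart_def by (simp add: openin_subtopology_Int)
  moreover have "open (snd c ` (fst c \<inter> W))"
    using chart_image_open[OF c, of "fst c \<inter> W"] c W unfolding is_chart_def by auto
  ultimately show ?thesis by (simp add: is_chart_def)
qed

lemma charted_open_submanifold:
  assumes "charted M" "openin (mtop M) W"
  shows "charted (open_submanifold M W)"
proof -
  have "(fst (chart_at M x) \<inter> W, snd (chart_at M x)) \<in> atlas (open_submanifold M W)"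
    if "x \<in> points M" for x
    using assms(1) that unfolding open_submanifold_def charted_def
    by simp (metis surjective_pairing)
  then show ?thesis using assms is_chart_Int[OF _ assms(2)] by (simp add: charted_def del: split_paired_All)
qed

lemma mderiv_open_submanifold:
  assumes M: "charted M" and W: "openin (mtop M) W" and f: "has_mderiv (open_submanifold M W) N f x D"
  shows "has_mderiv M N f x D"
proof -
  have x: "x \<in> points M" "x \<in> W" using mderiv_points[OF f] by auto
  let ?c = "chart_at M x"
  have c: "is_chart M ?c" "x \<in> fst ?c" using M x by (auto simp: charted_def)
  have c': "is_chart (open_submanifold M W) (fst ?c \<inter> W, snd ?c)" by (rule is_chart_Int[OF c(1) W])
  have "\<exists>U. openin (mtop M) U \<and> x \<in> U \<and> (\<forall>x'\<in>U. f x' \<in> V)" if "openin (mtop N) V" "f x \<in> V" for V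
  proof -
    have "cont_at (open_submanifold M W) N f x" using f by (simp add: has_mderiv_def)
    from cont_at_open_nbhd[OF this that]
    obtain U where "openin (subtopology (mtop M) W) U" "x \<in> U" "\<And>x'. x' \<in> U \<Longrightarrow> f x' \<in> V"
      unfolding open_submanifold_simps by blast
    then show ?thesis using W openin_trans_full by blast
  qed
  then have "cont_at M N f x" using x mderiv_points[OF f] by (auto simp: cont_at_def)
  moreover have "((snd (chart_at N (f x)) \<circ> f \<circ> chart_inv ?c) has_derivative D) (at (snd ?c x))"
  proof (rule has_derivative_transform_within_open)
    show "((snd (chart_at N (f x)) \<circ> f \<circ> chart_inv (fst ?c \<inter> W, snd ?c)) has_derivative D) (at (snd ?c x))"
      using f by (simp add: has_mderiv_def)
    show "open (snd ?c ` (fst ?c \<inter> W))" using c' by (simp add: is_chart_def)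
    show "(snd (chart_at N (f x)) \<circ> f \<circ> chart_inv (fst ?c \<inter> W, snd ?c)) y =
        (snd (chart_at N (f x)) \<circ> f \<circ> chart_inv ?c) y" if "y \<in> snd ?c ` (fst ?c \<inter> W)" for y
      using that chart_inv_left[OF c'] chart_inv_left[OF c(1)] by auto
  qed (use x c in auto)
  ultimately show ?thesis using M f by (simp add: has_mderiv_def)
qed

lemma mderiv_open_submanifold_target:
  assumes N: "charted N" and V: "openin (mtop N) V" and f: "has_mderiv M (open_submanifold N V) f x D"
  shows "has_mderiv M N f x D"
proof -
  have "f x \<in> V" using mderiv_points[OF f] by simp
  have "\<exists>U. openin (mtop M) U \<and> x \<in> U \<and> (\<forall>x'\<in>U. f x' \<in> V')" if "openin (mtop N) V'" "f x \<in> V'" for V'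
  proof -
    have "cont_at M (open_submanifold N V) f x" using f by (simp add: has_mderiv_def)
    moreover have "openin (mtop (open_submanifold N V)) (V \<inter> V')"
      using that by (simp add: openin_subtopology_Int2)
    moreover have "f x \<in> V \<inter> V'" using \<open>f x \<in> V\<close> that by simp
    ultimately obtain U where "openin (mtop M) U" "x \<in> U" "\<And>x'. x' \<in> U \<Longrightarrow> f x' \<in> V \<inter> V'"
      by (rule cont_at_open_nbhd) blast
    then show ?thesis by blast
  qed
  then show ?thesis using f N by (auto simp: has_mderiv_def cont_at_def)
qed

lemma continuous_rep_cont_at:
  assumes c: "is_chart M c" "x \<in> fst c" and d: "is_chart N d" and T: "open T" "snd c x \<in> T"
    and r: "continuous_on T r" "r ` T \<subseteq> snd d ` fst d"
    and f: "\<And>x'. x' \<in> fst c \<Longrightarrow> snd c x' \<in> T \<Longrightarrow> f x' = chart_inv d (r (snd c x'))"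
  shows "cont_at M N f x"
proof -
  have fd: "f x' \<in> fst d" if "x' \<in> fst c" "snd c x' \<in> T" for x'
    using f[OF that] r(2) that chart_inv_in by (metis image_subset_iff)
  have "\<exists>U. openin (mtop M) U \<and> x \<in> U \<and> (\<forall>x'\<in>U. f x' \<in> V)" if V: "openin (mtop N) V" "f x \<in> V" for V
  proof -
    have o: "openin (mtop N) (V \<inter> fst d)" using V d by (auto simp: is_chart_def)
    have "open (snd d ` (V \<inter> fst d))" using chart_image_open[OF d o] by simp
    then have "open (T \<inter> r -` (snd d ` (V \<inter> fst d)))"
      using continuous_open_preimage[OF r(1) T(1)] by blast
    note op = chart_preimage_open[OF c(1) this]
    have "snd d (f x) = r (snd c x)"
      using f[OF c(2) T(2)] r(2) T(2) chart_inv_right by (metis image_subset_iff)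
    then have "r (snd c x) \<in> snd d ` (V \<inter> fst d)" using V(2) fd[OF c(2) T(2)] by (metis IntI imageI)
    moreover have "f x' \<in> V" if "x' \<in> fst c" "snd c x' \<in> T \<inter> r -` (snd d ` (V \<inter> fst d))" for x'
      using that f[OF that(1)] chart_inv_left[OF d] by auto
    ultimately show ?thesis using op c(2) T(2) by blast
  qed
  then show ?thesis
    using fd[OF c(2) T(2)] c d chart_subset_points[OF c(1)] chart_subset_points[OF d]
    by (auto simp: cont_at_def)
qed

lemma mderiv_model:
  "(f has_derivative D) (at x) \<Longrightarrow> has_mderiv model_manifold model_manifold f x D"
proof -
  assume f: "(f has_derivative D) (at x)"
  have "\<exists>U. open U \<and> x \<in> U \<and> (\<forall>x'\<in>U. f x' \<in> V)" if "open V" "f x \<in> V" for V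
    using has_derivative_continuous[OF f] that continuous_at_open by blast
  then show ?thesis using f by (auto simp: has_mderiv_def cont_at_def inv_id o_def charted_model)
qed

lemma mderiv_coord_change:
  assumes M: "smooth_manifold M" and c: "c \<in> atlas M" "d \<in> atlas M" and x: "x \<in> fst c" "x \<in> fst d"
  shows "((snd d \<circ> chart_inv c) has_derivative coord_change c d x) (at (snd c x))"
proof -
  have "smooth_on (snd c ` (fst c \<inter> fst d)) (snd d \<circ> chart_inv c)"
    using M c unfolding smooth_manifold_def by (cases c, cases d) auto
  from smooth_on_has_derivative[OF this] x show ?thesis unfolding coord_change_def by blast
qed

lemma coord_change_inverse:
  assumes M: "smooth_manifold M" and c: "c \<in> atlas M" "d \<in> atlas M" and x: "x \<in> fst c" "x \<in> fst d"
  shows "coord_change c d x (coord_change d c x v) = v"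
proof -
  note ch = smooth_manifold_chart[OF M c(1)] smooth_manifold_chart[OF M c(2)]
  have xc: "(snd c \<circ> chart_inv d) (snd d x) = snd c x" using chart_inv_left[OF ch(2) x(2)] by simp
  have "((snd d \<circ> chart_inv c) \<circ> (snd c \<circ> chart_inv d) has_derivative
      coord_change c d x \<circ> coord_change d c x) (at (snd d x))"
    using mderiv_coord_change[OF M c x] mderiv_coord_change[OF M c(2,1) x(2,1)]
    by (intro diff_chain_at) (simp_all only: xc)
  moreover have "open (snd d ` (fst c \<inter> fst d))"
    using chart_image_open[OF ch(2), of "fst c \<inter> fst d"] ch by (auto simp: is_chart_def)
  ultimately have "((\<lambda>v. v) has_derivative coord_change c d x \<circ> coord_change d c x) (at (snd d x))"
    by (rule has_derivative_transform_within_open)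
      (use x in \<open>auto simp: chart_inv_left[OF ch(1)] chart_inv_left[OF ch(2)]\<close>)
  from has_derivative_unique[OF this has_derivative_ident] show ?thesis by (metis comp_apply)
qed

text \<open>A change of coordinates into the preferred chart is the differential of a parametrization.\<close>

lemma mderiv_chart_inv:
  assumes M: "smooth_manifold M" and c: "c \<in> atlas M" and y: "y \<in> snd c ` fst c"
  shows "has_mderiv model_manifold M (chart_inv c) y
    (coord_change c (chart_at M (chart_inv c y)) (chart_inv c y))"
proof -
  have ch: "is_chart M c" by (rule smooth_manifold_chart[OF M c])
  have x: "chart_inv c y \<in> fst c" using chart_inv_in[OF y] .
  then have "chart_inv c y \<in> points M" using chart_subset_points[OF ch] by blast
  then have "((snd (chart_at M (chart_inv c y)) \<circ> chart_inv c) has_derivative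
      coord_change c (chart_at M (chart_inv c y)) (chart_inv c y)) (at (snd c (chart_inv c y)))"
    using M by (intro mderiv_coord_change[OF M c _ x]) (auto simp: smooth_manifold_def)
  then have "((snd (chart_at M (chart_inv c y)) \<circ> chart_inv c \<circ> chart_inv (UNIV, id)) has_derivative
      coord_change c (chart_at M (chart_inv c y)) (chart_inv c y)) (at y)"
    by (simp add: chart_inv_right[OF y] inv_id)
  moreover have "cont_at model_manifold M (chart_inv c) y"
    by (rule continuous_rep_cont_at[OF model_chart _ ch, of _ "snd c ` fst c" "\<lambda>y. y"])
      (use y ch in \<open>auto simp: is_chart_def continuous_on_id\<close>)
  ultimately show ?thesis by (simp add: has_mderiv_def charted_model smooth_manifold_charted[OF M])
qed

section \<open>Local structure of submersions\<close>

text \<open>The chart \<open>d\<close> is not required to be the preferred one, because smoothness of a form is tested in all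
  charts of the atlas.\<close>

lemma submersion_adjustment_in_charts:
  assumes M: "charted M" and N: "smooth_manifold N" and f: "submersion M N f" and x: "x \<in> points M"
    and d: "d \<in> atlas N" "f x \<in> fst d"
  obtains T \<zeta> where "open T" "(snd (chart_at M x) x, snd d (f x)) \<in> T" "smooth_on T \<zeta>"
    "\<zeta> ` T \<subseteq> snd (chart_at M x) ` fst (chart_at M x)" "\<zeta> (snd (chart_at M x) x, snd d (f x)) = snd (chart_at M x) x"
    "\<And>y z. (y, z) \<in> T \<Longrightarrow> z \<in> snd d ` fst d \<and> f (chart_inv (chart_at M x) (\<zeta> (y, z))) = chart_inv d z"
    "\<And>u. frechet_derivative \<zeta> (at (snd (chart_at M x) x, snd d (f x)))
      (u, frechet_derivative (snd d \<circ> f \<circ> chart_inv (chart_at M x)) (at (snd (chart_at M x) x)) u) = u"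
proof -
  let ?c = "chart_at M x" and ?d = "chart_at N (f x)"
  have fs: "smooth_map M N f" using f by (simp add: submersion_def)
  have ch: "is_chart N d" by (rule smooth_manifold_chart[OF N d(1)])
  have fx: "f x \<in> points N" using chart_subset_points[OF ch] d(2) by blast
  have c: "?c \<in> atlas M" "is_chart M ?c" "x \<in> fst ?c" and d': "?d \<in> atlas N" "is_chart N ?d" "f x \<in> fst ?d"
    using M smooth_manifold_charted[OF N] x fx by (auto simp: charted_def)
  let ?W = "snd ?c ` {x' \<in> fst ?c. f x' \<in> fst d}" and ?f = "snd d \<circ> f \<circ> chart_inv ?c"
  have W: "open ?W" "snd ?c x \<in> ?W" "smooth_on ?W ?f" "?W \<subseteq> snd ?c ` fst ?c"
    using smooth_map_chart_domain_open[OF fs c(2) ch] c d smooth_map_charts[OF fs c(1) d(1)] by auto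
  have f0: "?f (snd ?c x) = snd d (f x)" using chart_inv_left[OF c(2,3)] by simp
  let ?C = "coord_change ?d d (f x)"
  have D: "frechet_derivative ?f (at (snd ?c x)) = ?C \<circ> mdiff M N f x"
  proof -
    let ?g = "snd ?d \<circ> f \<circ> chart_inv ?c"
    have "has_mderiv M N f x (mdiff M N f x)"
      by (rule smooth_map_has_mderiv[OF M smooth_manifold_charted[OF N] fs x])
    then have g: "(?g has_derivative mdiff M N f x) (at (snd ?c x))" by (simp add: has_mderiv_def)
    have g0: "?g (snd ?c x) = snd ?d (f x)" using chart_inv_left[OF c(2,3)] by simp
    have "((snd d \<circ> chart_inv ?d) \<circ> ?g has_derivative ?C \<circ> mdiff M N f x) (at (snd ?c x))"
      using mderiv_coord_change[OF N d'(1) d(1) d'(3) d(2)]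
      by (intro diff_chain_at[OF g]) (simp only: g0)
    moreover have "open (snd ?c ` {x' \<in> fst ?c. f x' \<in> fst ?d})"
      by (rule smooth_map_chart_domain_open(2)[OF fs c(2) d'(2)])
    ultimately have "(?f has_derivative ?C \<circ> mdiff M N f x) (at (snd ?c x))"
      by (rule has_derivative_transform_within_open)
        (use c d' in \<open>auto simp: chart_inv_left[OF c(2)] chart_inv_left[OF d'(2)]\<close>)
    then show ?thesis by (rule frechet_derivative_at[symmetric])
  qed
  have "surj ?C" using coord_change_inverse[OF N d'(1) d(1) d'(3) d(2)] by (metis surjI)
  then have "surj (frechet_derivative ?f (at (snd ?c x)))"
    unfolding D by (rule comp_surj[rotated]) (use f x in \<open>simp add: submersion_def\<close>)
  note r = submersion_adjustment[OF W(1-3) this, unfolded f0]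
  obtain T \<zeta> where T: "open T" "(snd ?c x, snd d (f x)) \<in> T" "smooth_on T \<zeta>" "\<zeta> ` T \<subseteq> ?W"
    "\<And>y z. (y, z) \<in> T \<Longrightarrow> ?f (\<zeta> (y, z)) = z" "\<zeta> (snd ?c x, snd d (f x)) = snd ?c x"
    "\<And>u. frechet_derivative \<zeta> (at (snd ?c x, snd d (f x))) 
      (u, frechet_derivative ?f (at (snd ?c x)) u) = u"
    by (rule r) (rule that)
  have 1: "z \<in> snd d ` fst d \<and> f (chart_inv ?c (\<zeta> (y, z))) = chart_inv d z" if yz: "(y, z) \<in> T" for y z
  proof -
    obtain x' where x': "\<zeta> (y, z) = snd ?c x'" "x' \<in> fst ?c" "f x' \<in> fst d" using T(4) yz by blast
    then have "z = snd d (f x')" using T(5)[OF yz] by (simp add: chart_inv_left[OF c(2)])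
    then show ?thesis using x' by (simp add: chart_inv_left[OF c(2)] chart_inv_left[OF ch])
  qed
  show ?thesis by (rule that[OF T(1-3) order_trans[OF T(4) W(4)] T(6) 1 T(7)])
qed

text \<open>The map \<open>\<zeta>\<close> adjusts points near \<open>x\<close> to lie in prescribed fibres. With \<open>y\<close> depending on a
  parameter, it realizes each vector at \<open>x\<close> by a family of points over prescribed base points.\<close>

lemma submersion_fibre_adjustment:
  assumes M: "charted M" and Nm: "smooth_manifold N" and f: "submersion M N f" and x: "x \<in> points M"
  obtains \<zeta> U D where "\<zeta> (x, f x) = x" "has_mderiv (prod_manifold M N) M \<zeta> (x, f x) D"
    "\<And>u. D (u, mdiff M N f x u) = u"
    "openin (mtop (prod_manifold M N)) U" "(x, f x) \<in> U"
    "\<And>x' y. (x', y) \<in> U \<Longrightarrow> \<zeta> (x', y) \<in> points M \<and> f (\<zeta> (x', y)) = y"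
proof -
  let ?c = "chart_at M x" and ?d = "chart_at N (f x)" and ?P = "prod_manifold M N"
  note N = smooth_manifold_charted[OF Nm]
  have "f x \<in> points N" using f x unfolding submersion_def smooth_map_def continuous_map_def by blast
  then have c: "is_chart M ?c" "x \<in> fst ?c" and d: "?d \<in> atlas N" "is_chart N ?d" "f x \<in> fst ?d"
    using M N x by (auto simp: charted_def)
  obtain T \<zeta>0 where T: "open T" "(snd ?c x, snd ?d (f x)) \<in> T" "smooth_on T \<zeta>0"
    "\<zeta>0 ` T \<subseteq> snd ?c ` fst ?c" "\<zeta>0 (snd ?c x, snd ?d (f x)) = snd ?c x"
    "\<And>y z. (y, z) \<in> T \<Longrightarrow> z \<in> snd ?d ` fst ?d \<and> f (chart_inv ?c (\<zeta>0 (y, z))) = chart_inv ?d z"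
    "\<And>u. frechet_derivative \<zeta>0 (at (snd ?c x, snd ?d (f x)))
      (u, frechet_derivative (snd ?d \<circ> f \<circ> chart_inv ?c) (at (snd ?c x)) u) = u"
    by (rule submersion_adjustment_in_charts[OF M Nm f x d(1,3)]) (rule that)
  define \<zeta> where "\<zeta> = (\<lambda>(x', y). chart_inv ?c (\<zeta>0 (snd ?c x', snd ?d y)))"
  let ?p = "prod_chart ?c ?d"
  have p: "is_chart ?P ?p" "(x, f x) \<in> fst ?p"
    using is_chart_prod[OF c(1) d(2)] c d by (auto simp: prod_chart_def)
  define U where "U = {k \<in> fst ?p. snd ?p k \<in> T}"
  have U: "openin (mtop ?P) U" "(x, f x) \<in> U"
    unfolding U_def using chart_preimage_open[OF p(1) T(1)] p T(2) by (auto simp: prod_chart_def)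
  have \<zeta>x: "\<zeta> (x, f x) = x" by (simp add: \<zeta>_def T(5) chart_inv_left[OF c])
  have \<zeta>U: "\<zeta> (x', y) \<in> points M \<and> f (\<zeta> (x', y)) = y" if "(x', y) \<in> U" for x' y
  proof -
    have k: "(snd ?c x', snd ?d y) \<in> T" "y \<in> fst ?d" using that by (auto simp: U_def prod_chart_def)
    have "\<zeta>0 (snd ?c x', snd ?d y) \<in> snd ?c ` fst ?c" using T(4) k(1) by blast
    from chart_inv_in[OF this] have "\<zeta> (x', y) \<in> fst ?c" by (simp add: \<zeta>_def)
    then show ?thesis
      using T(6)[OF k(1)] chart_inv_left[OF d(2) k(2)] chart_subset_points[OF c(1)] by (auto simp: \<zeta>_def)
  qed
  have "cont_at ?P M \<zeta> (x, f x)"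
    by (rule continuous_rep_cont_at[OF p c(1) T(1) _ smooth_on_continuous[OF T(3)] T(4)])
      (use T(2) in \<open>auto simp: prod_chart_def \<zeta>_def\<close>)
  moreover have "((snd ?c \<circ> \<zeta> \<circ> chart_inv ?p) has_derivative frechet_derivative \<zeta>0 (at (snd ?c x, snd ?d (f x))))
      (at (snd ?c x, snd ?d (f x)))"
  proof (rule has_derivative_transform_within_open[OF smooth_on_has_derivative[OF T(3,2)]])
    show "open (T \<inter> snd ?p ` fst ?p)" using T(1) p(1) by (auto simp: is_chart_def)
    show "(snd ?c x, snd ?d (f x)) \<in> T \<inter> snd ?p ` fst ?p"
      using T(2) c d by (force simp: prod_chart_def)
    fix k assume k: "k \<in> T \<inter> snd ?p ` fst ?p"
    then obtain x' y where "k = (snd ?c x', snd ?d y)" "x' \<in> fst ?c" "y \<in> fst ?d"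
      by (auto simp: prod_chart_def)
    moreover then have "chart_inv ?p k = (x', y)"
      using chart_inv_left[OF p(1), of "(x', y)"] by (simp add: prod_chart_def)
    ultimately show "\<zeta>0 k = (snd ?c \<circ> \<zeta> \<circ> chart_inv ?p) k"
      using k T(4) chart_inv_right[of "\<zeta>0 k" ?c] by (auto simp: \<zeta>_def)
  qed
  ultimately have "has_mderiv ?P M \<zeta> (x, f x) (frechet_derivative \<zeta>0 (at (snd ?c x, snd ?d (f x))))"
    by (simp add: has_mderiv_def \<zeta>x M N charted_prod) (simp add: prod_manifold_def prod_chart_def)
  then show ?thesis using that[OF \<zeta>x _ T(7)[folded mdiff_def] U \<zeta>U] by blast
qed

text \<open>Freezing \<open>y = f x\<close> gives a map into the fibre through \<open>x\<close> whose differential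
  fixes the vectors tangent to the fibre. It takes the place of curves in the fibre.\<close>

lemma submersion_map_into_fibre:
  assumes M: "charted M" and Nm: "smooth_manifold N" and f: "submersion M N f" and x: "x \<in> points M"
  obtains c D U where "c x = x" "has_mderiv M M c x D" "\<And>u. mdiff M N f x u = 0 \<Longrightarrow> D u = u"
    "openin (mtop M) U" "x \<in> U" "\<And>k. k \<in> U \<Longrightarrow> c k \<in> points M \<and> f (c k) = f x"
proof -
  note N = smooth_manifold_charted[OF Nm]
  obtain \<zeta> U D where \<zeta>: "\<zeta> (x, f x) = x" "has_mderiv (prod_manifold M N) M \<zeta> (x, f x) D"
    "\<And>u. D (u, mdiff M N f x u) = u" "openin (mtop (prod_manifold M N)) U" "(x, f x) \<in> U"
    "\<And>k y. (k, y) \<in> U \<Longrightarrow> \<zeta> (k, y) \<in> points M \<and> f (\<zeta> (k, y)) = y"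
    by (rule submersion_fibre_adjustment[OF assms]) (rule that)
  have "f x \<in> points N" using mderiv_points(1)[OF \<zeta>(2)] by simp
  note pair = mderiv_Pair[OF mderiv_ident[OF M x] mderiv_const[OF M N x this]]
  obtain V where V: "openin (mtop M) V" "x \<in> V" "\<And>k. k \<in> V \<Longrightarrow> (k, f x) \<in> U"
    by (rule cont_at_open_nbhd[OF mderiv_cont_at[OF pair] \<zeta>(4,5)]) (rule that)
  have D: "D (u, 0) = u" if "mdiff M N f x u = 0" for u using \<zeta>(3)[of u] that by simp
  show ?thesis
    by (rule that[of "\<lambda>k. \<zeta> (k, f x)", OF \<zeta>(1) mderiv_compose[OF pair \<zeta>(2)] D V(1,2) \<zeta>(6)[OF V(3)]])
qed

lemma submersion_section_in_charts:
  assumes M: "charted M" and N: "smooth_manifold N" and f: "submersion M N f" and x: "x \<in> points M"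
    and d: "d \<in> atlas N" "f x \<in> fst d"
  obtains Y s where "open Y" "snd d (f x) \<in> Y" "Y \<subseteq> snd d ` fst d" "smooth_on Y s"
    "s ` Y \<subseteq> snd (chart_at M x) ` fst (chart_at M x)" "s (snd d (f x)) = snd (chart_at M x) x"
    "\<And>y. y \<in> Y \<Longrightarrow> f (chart_inv (chart_at M x) (s y)) = chart_inv d y"
proof -
  let ?c = "chart_at M x"
  obtain T \<zeta> where T: "open T" "(snd ?c x, snd d (f x)) \<in> T" "smooth_on T \<zeta>"
    "\<zeta> ` T \<subseteq> snd ?c ` fst ?c" "\<zeta> (snd ?c x, snd d (f x)) = snd ?c x"
    "\<And>y z. (y, z) \<in> T \<Longrightarrow> z \<in> snd d ` fst d \<and> f (chart_inv ?c (\<zeta> (y, z))) = chart_inv d z"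
    "\<And>u. frechet_derivative \<zeta> (at (snd ?c x, snd d (f x)))
      (u, frechet_derivative (snd d \<circ> f \<circ> chart_inv ?c) (at (snd ?c x)) u) = u"
    by (rule submersion_adjustment_in_charts[OF assms]) (rule that)
  define Y where "Y = (\<lambda>y. (snd ?c x, y)) -` T"
  have Y: "open Y" unfolding Y_def by (intro open_vimage T(1) continuous_intros)
  have "linear (\<lambda>y :: 'd. (0 :: 'b, y))" by (intro linearI) auto
  from smooth_on_affine[OF this Y, of "(snd ?c x, 0)" 0]
  have "smooth_on Y (\<lambda>y. (snd ?c x, y))" by simp
  from smooth_on_compose[OF Y T(1) _ this T(3)]
  have s: "smooth_on Y (\<lambda>y. \<zeta> (snd ?c x, y))" by (auto simp: Y_def)
  show ?thesis by (rule that[OF Y _ _ s _ T(5)]) (use T(2,4,6) in \<open>auto simp: Y_def\<close>)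
qed

section \<open>Differential calculus on Lie groupoids\<close>

locale groupoid_calculus =
  fixes G :: "('g, 'eg::model_space, 'm, 'em::model_space) groupoid"
  assumes lie: "lie_groupoid G"
begin

abbreviation "Arr \<equiv> points (arr G)"
abbreviation "Obj \<equiv> points (obj G)"
abbreviation "dS \<equiv> mdiff (arr G) (obj G) (src G)"
abbreviation "dT \<equiv> mdiff (arr G) (obj G) (tgt G)"
abbreviation "dI \<equiv> mdiff (obj G) (arr G) (idn G)"
abbreviation "dV \<equiv> mdiff (arr G) (arr G) (ginv G)"
abbreviation "dM g h \<equiv> mdiff_within (prod_manifold (arr G) (arr G)) (composable G) (arr G)
  (\<lambda>(g, h). mul G g h) (g, h)"

lemma arr_manifold: "smooth_manifold (arr G)" and obj_manifold: "smooth_manifold (obj G)"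
  using lie unfolding lie_groupoid_def by blast+

lemmas charted_arr = smooth_manifold_charted[OF arr_manifold]
  and charted_obj = smooth_manifold_charted[OF obj_manifold]

lemma charted_arr2: "charted (prod_manifold (arr G) (arr G))"
  by (rule charted_prod[OF charted_arr charted_arr])

lemma src_submersion: "submersion (arr G) (obj G) (src G)"
  and tgt_submersion: "submersion (arr G) (obj G) (tgt G)"
  using lie unfolding lie_groupoid_def by blast+

lemma src_deriv: "g \<in> Arr \<Longrightarrow> has_mderiv (arr G) (obj G) (src G) g (dS g)"
  using smooth_map_has_mderiv[OF charted_arr charted_obj] src_submersion unfolding submersion_def by blast

lemma tgt_deriv: "g \<in> Arr \<Longrightarrow> has_mderiv (arr G) (obj G) (tgt G) g (dT g)"
  using smooth_map_has_mderiv[OF charted_arr charted_obj] tgt_submersion unfolding submersion_def by blast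

lemma idn_deriv: "x \<in> Obj \<Longrightarrow> has_mderiv (obj G) (arr G) (idn G) x (dI x)"
  using smooth_map_has_mderiv[OF charted_obj charted_arr] lie unfolding lie_groupoid_def by blast

lemma ginv_deriv: "g \<in> Arr \<Longrightarrow> has_mderiv (arr G) (arr G) (ginv G) g (dV g)"
  using smooth_map_has_mderiv[OF charted_arr charted_arr] lie unfolding lie_groupoid_def by blast

lemma src_in: "g \<in> Arr \<Longrightarrow> src G g \<in> Obj"
  using src_deriv mderiv_points(2) by metis

lemma tgt_in: "g \<in> Arr \<Longrightarrow> tgt G g \<in> Obj"
  using tgt_deriv mderiv_points(2) by metis

lemma idn_in: "x \<in> Obj \<Longrightarrow> idn G x \<in> Arr"
  using idn_deriv mderiv_points(2) by metis

lemma ginv_in: "g \<in> Arr \<Longrightarrow> ginv G g \<in> Arr"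
  using ginv_deriv mderiv_points(2) by metis

lemma composableI:
  "g \<in> Arr \<Longrightarrow> h \<in> Arr \<Longrightarrow> src G g = tgt G h \<Longrightarrow> (g, h) \<in> composable G"
  by (simp add: composable_def)

lemma composableD: "(g, h) \<in> composable G \<Longrightarrow> g \<in> Arr \<and> h \<in> Arr \<and> src G g = tgt G h"
  by (simp add: composable_def)

lemma mul_closed:
  assumes "(g, h) \<in> composable G"
  shows "mul G g h \<in> Arr" "src G (mul G g h) = src G h" "tgt G (mul G g h) = tgt G g"
  using lie assms unfolding lie_groupoid_def by blast+

lemma mul_assoc:
  "(g, h) \<in> composable G \<Longrightarrow> (h, k) \<in> composable G \<Longrightarrow> mul G (mul G g h) k = mul G g (mul G h k)"
  using lie unfolding lie_groupoid_def by blast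

lemma src_idn: "x \<in> Obj \<Longrightarrow> src G (idn G x) = x"
  and tgt_idn: "x \<in> Obj \<Longrightarrow> tgt G (idn G x) = x"
  using lie unfolding lie_groupoid_def by blast+

lemma mul_idn_right: "g \<in> Arr \<Longrightarrow> mul G g (idn G (src G g)) = g"
  and mul_idn_left: "g \<in> Arr \<Longrightarrow> mul G (idn G (tgt G g)) g = g"
  using lie unfolding lie_groupoid_def by blast+

lemma inverse_laws:
  assumes "g \<in> Arr"
  shows "src G (ginv G g) = tgt G g" "tgt G (ginv G g) = src G g"
    "mul G g (ginv G g) = idn G (tgt G g)" "mul G (ginv G g) g = idn G (src G g)"
  using lie assms unfolding lie_groupoid_def by blast+

lemma idn_right: "x \<in> Obj \<Longrightarrow> g \<in> Arr \<Longrightarrow> src G g = x \<Longrightarrow> mul G g (idn G x) = g"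
  using mul_idn_right by blast

lemma idn_left: "x \<in> Obj \<Longrightarrow> g \<in> Arr \<Longrightarrow> tgt G g = x \<Longrightarrow> mul G (idn G x) g = g"
  using mul_idn_left by blast

lemma composable_idn_right: "g \<in> Arr \<Longrightarrow> (g, idn G (src G g)) \<in> composable G"
  by (intro composableI) (auto simp: tgt_idn src_in idn_in)

lemma composable_idn_left: "g \<in> Arr \<Longrightarrow> (idn G (tgt G g), g) \<in> composable G"
  by (intro composableI) (auto simp: src_idn tgt_in idn_in)

lemma composable_idn: "x \<in> Obj \<Longrightarrow> (idn G x, idn G x) \<in> composable G"
  by (intro composableI) (auto simp: src_idn tgt_idn idn_in)

lemma composable_ginv: "g \<in> Arr \<Longrightarrow> (g, ginv G g) \<in> composable G"
    "g \<in> Arr \<Longrightarrow> (ginv G g, g) \<in> composable G"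
  by (auto intro!: composableI simp: inverse_laws ginv_in)

lemma ginv_idn: "x \<in> Obj \<Longrightarrow> ginv G (idn G x) = idn G x"
  using inverse_laws[OF idn_in] idn_left[OF _ ginv_in[OF idn_in]] by (simp add: src_idn tgt_idn)

lemma dS_dI:
  assumes x: "x \<in> Obj"
  shows "dS (idn G x) (dI x v) = v"
  by (rule mderiv_germ_unique[OF mderiv_compose[OF idn_deriv[OF x] src_deriv[OF idn_in[OF x]]]
        mderiv_ident[OF charted_obj x] openin_topspace x src_idn])

lemma dT_dI:
  assumes x: "x \<in> Obj"
  shows "dT (idn G x) (dI x v) = v"
  by (rule mderiv_germ_unique[OF mderiv_compose[OF idn_deriv[OF x] tgt_deriv[OF idn_in[OF x]]]
        mderiv_ident[OF charted_obj x] openin_topspace x tgt_idn])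

lemma dT_dV:
  assumes g: "g \<in> Arr"
  shows "dT (ginv G g) (dV g v) = dS g v"
  by (rule mderiv_germ_unique[OF mderiv_compose[OF ginv_deriv[OF g] tgt_deriv[OF ginv_in[OF g]]]
        src_deriv[OF g] openin_topspace g inverse_laws(2)])

lemma linear_dS: "g \<in> Arr \<Longrightarrow> linear (dS g)" using src_deriv mderiv_linear by metis
lemma linear_dT: "g \<in> Arr \<Longrightarrow> linear (dT g)" using tgt_deriv mderiv_linear by metis
lemma linear_dI: "x \<in> Obj \<Longrightarrow> linear (dI x)" using idn_deriv mderiv_linear by metis

text \<open>Near a composable pair the first factor can be moved into the source fibre prescribed by the
  second one. This realizes each tangent vector of the space of composable pairs by a map into it.\<close>

lemma composable_adjustment:
  assumes gh: "(g, h) \<in> composable G"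
  obtains f D U where "has_mderiv (prod_manifold (arr G) (arr G)) (arr G) f (g, h) D" "f (g, h) = g"
    "openin (mtop (prod_manifold (arr G) (arr G))) U" "(g, h) \<in> U"
    "\<And>k. k \<in> U \<Longrightarrow> (f k, snd k) \<in> composable G"
    "\<And>u v. dS g u = dT h v \<Longrightarrow> D (u, v) = u"
proof -
  let ?A = "arr G" and ?P = "prod_manifold (arr G) (arr G)"
  have g: "g \<in> points ?A" and h: "h \<in> points ?A" and st: "src G g = tgt G h"
    using composableD[OF gh] by auto
  obtain \<zeta> U D where \<zeta>: "\<zeta> (g, src G g) = g" "has_mderiv (prod_manifold ?A (obj G)) ?A \<zeta> (g, src G g) D"
    "\<And>u. D (u, dS g u) = u" "openin (mtop (prod_manifold ?A (obj G))) U" "(g, src G g) \<in> U"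
    "\<And>x y. (x, y) \<in> U \<Longrightarrow> \<zeta> (x, y) \<in> points ?A \<and> src G (\<zeta> (x, y)) = y"
    by (rule submersion_fibre_adjustment[OF charted_arr obj_manifold src_submersion g]) (rule that)
  define j where "j = (\<lambda>k :: 'g \<times> 'g. (fst k, tgt G (snd k)))"
  have "has_mderiv ?P (obj G) (\<lambda>k. tgt G (snd k)) (g, h) (\<lambda>w. dT h (snd w))"
    by (rule mderiv_compose[OF mderiv_snd[OF charted_arr g charted_arr h]]) (simp add: tgt_deriv[OF h])
  from mderiv_Pair[OF mderiv_fst[OF charted_arr g charted_arr h] this]
  have j: "has_mderiv ?P (prod_manifold ?A (obj G)) j (g, h) (\<lambda>w. (fst w, dT h (snd w)))"
    by (simp add: j_def)
  have j0: "j (g, h) = (g, src G g)" by (simp add: j_def st)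
  have "has_mderiv ?P ?A (\<lambda>k. \<zeta> (j k)) (g, h) (\<lambda>w. D (fst w, dT h (snd w)))"
    by (rule mderiv_compose[OF j]) (simp add: j0 \<zeta>(2))
  moreover obtain U' where U': "openin (mtop ?P) U'" "(g, h) \<in> U'" "\<And>k. k \<in> U' \<Longrightarrow> j k \<in> U"
    by (rule cont_at_open_nbhd[OF mderiv_cont_at[OF j] \<zeta>(4)])
      (use \<zeta>(5) j0 in auto)
  moreover have "(\<zeta> (j k), snd k) \<in> composable G" if "k \<in> U'" for k
  proof -
    have "k \<in> points ?P" using U'(1) that openin_subset by blast
    then show ?thesis using \<zeta>(6) U'(3)[OF that] unfolding j_def by (intro composableI) auto
  qed
  moreover have "D (fst (u, v), dT h (snd (u, v))) = u" if "dS g u = dT h v" for u v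
    using \<zeta>(3)[of u] that by simp
  moreover have "\<zeta> (j (g, h)) = g" by (simp add: j0 \<zeta>(1))
  ultimately show ?thesis using that[of "\<lambda>k. \<zeta> (j k)" _ U'] by blast
qed

text \<open>On the space of composable pairs, a derivative of the multiplication is determined on tangent vectors
  only, and \<open>mdiff_within\<close> selects one of the candidates. Composition with a map into the composable pairs
  that fixes the tangent vectors to first order shows that all candidates agree there with the differential
  of a local extension.\<close>

lemma mul_local_extension:
  assumes gh: "(g, h) \<in> composable G"
  obtains F D U where "has_mderiv (prod_manifold (arr G) (arr G)) (arr G) F (g, h) D"
    "openin (mtop (prod_manifold (arr G) (arr G))) U" "(g, h) \<in> U"
    "\<And>g' h'. (g', h') \<in> U \<Longrightarrow> (g', h') \<in> composable G \<Longrightarrow> F (g', h') = mul G g' h'"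
    "\<And>u v. dS g u = dT h v \<Longrightarrow> dM g h (u, v) = D (u, v)"
proof -
  let ?A = "arr G" and ?P = "prod_manifold (arr G) (arr G)" and ?m = "\<lambda>(g, h). mul G g h"
  let ?c = "chart_at ?P (g, h)" and ?d = "chart_at ?A (mul G g h)"
  have pt: "(g, h) \<in> points ?P" using composableD[OF gh] by simp
  have c: "is_chart ?P ?c" "(g, h) \<in> fst ?c" using charted_arr2 pt unfolding charted_def by blast+
  have "smooth_map_on_subset ?P (composable G) ?A ?m" using lie unfolding lie_groupoid_def by blast
  from this[unfolded smooth_map_on_subset_def, THEN bspec, OF gh]
  obtain W F where W: "openin (mtop ?P) W" "(g, h) \<in> W" and F: "smooth_map (open_submanifold ?P W) ?A F"
      and Fm: "\<And>k. k \<in> composable G \<inter> W \<Longrightarrow> F k = ?m k"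
    by (elim exE conjE) (rule that, assumption+, erule bspec)
  have "(g, h) \<in> points (open_submanifold ?P W)" using pt W(2) by simp
  note D = mderiv_open_submanifold[OF charted_arr2 W(1)
      smooth_map_has_mderiv[OF charted_open_submanifold[OF charted_arr2 W(1)] charted_arr F this]]
  define D where "D = mdiff (open_submanifold ?P W) ?A F (g, h)"
  note D = D[folded D_def]
  have F0: "F (g, h) = mul G g h" using Fm gh W(2) by auto
  let ?S = "snd ?c ` (composable G \<inter> fst ?c)" and ?r = "snd ?d \<circ> ?m \<circ> chart_inv ?c"
  have y0: "snd ?c (g, h) \<in> ?S" using gh c(2) by blast
  have "((snd ?d \<circ> F \<circ> chart_inv ?c) has_derivative D) (at (snd ?c (g, h)))"
    using D by (simp add: has_mderiv_def F0)
  then have Fd: "((snd ?d \<circ> F \<circ> chart_inv ?c) has_derivative D) (at (snd ?c (g, h)) within ?S)"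
    by (rule has_derivative_at_withinI)
  have "open (snd ?c ` (W \<inter> fst ?c))"
    using chart_image_open[OF c(1), of "W \<inter> fst ?c"] c(1) W(1) by (auto simp: is_chart_def)
  then obtain e where e: "e > 0" "ball (snd ?c (g, h)) e \<subseteq> snd ?c ` (W \<inter> fst ?c)"
    using W(2) c(2) by (metis IntI imageI openE)
  have rD: "(?r has_derivative D) (at (snd ?c (g, h)) within ?S)"
  proof (rule has_derivative_transform_within[OF Fd e(1) y0])
    fix y assume y: "y \<in> ?S" "dist y (snd ?c (g, h)) < e"
    then obtain k where k: "k \<in> composable G" "k \<in> fst ?c" "y = snd ?c k" by blast
    have "y \<in> snd ?c ` (W \<inter> fst ?c)" using y(2) e(2) by (auto simp: dist_commute)
    then have "k \<in> W" using chart_inj[OF c(1)] k by (auto dest: inj_onD)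
    then show "(snd ?d \<circ> F \<circ> chart_inv ?c) y = ?r y"
      using Fm[of k] k chart_inv_left[OF c(1) k(2)] by simp
  qed
  define E where "E = dM g h"
  have "?r differentiable (at (snd ?c (g, h)) within ?S)" using rD by (rule differentiableI)
  then have rE: "(?r has_derivative E) (at (snd ?c (g, h)) within ?S)"
    unfolding E_def mdiff_within_def frechet_derivative_works by simp
  obtain f Df U where f: "has_mderiv ?P ?A f (g, h) Df" "f (g, h) = g"
    "openin (mtop ?P) U" "(g, h) \<in> U" "\<And>k. k \<in> U \<Longrightarrow> (f k, snd k) \<in> composable G"
    "\<And>u v. dS g u = dT h v \<Longrightarrow> Df (u, v) = u"
    by (rule composable_adjustment[OF gh]) (rule that)
  define \<rho> where "\<rho> = (\<lambda>k. (f k, snd k))"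
  have \<rho>: "has_mderiv ?P ?P \<rho> (g, h) (\<lambda>w. (Df w, snd w))"
    unfolding \<rho>_def using composableD[OF gh]
    by (intro mderiv_Pair f(1) mderiv_snd charted_arr) auto
  have \<rho>0: "\<rho> (g, h) = (g, h)" by (simp add: \<rho>_def f(2))
  have "openin (mtop ?P) (fst ?c)" "\<rho> (g, h) \<in> fst ?c" using c \<rho>0 by (simp_all add: is_chart_def)
  note nbhd = cont_at_open_nbhd[OF mderiv_cont_at[OF \<rho>] this]
  obtain U' where U': "openin (mtop ?P) U'" "(g, h) \<in> U'" "\<And>k. k \<in> U' \<Longrightarrow> \<rho> k \<in> fst ?c"
    by (rule nbhd) (rule that)
  have UU': "openin (mtop ?P) (U \<inter> U')" "(g, h) \<in> U \<inter> U'" using f(3,4) U'(1,2) by auto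
  note nbhd' = chart_nbhd[OF c UU']
  obtain T where T: "open T" "snd ?c (g, h) \<in> T" "T \<subseteq> snd ?c ` fst ?c" "\<And>y. y \<in> T \<Longrightarrow> chart_inv ?c y \<in> U \<inter> U'"
    by (rule nbhd') (rule that)
  let ?\<rho> = "snd ?c \<circ> \<rho> \<circ> chart_inv ?c"
  have d\<rho>: "(?\<rho> has_derivative (\<lambda>w. (Df w, snd w))) (at (snd ?c (g, h)) within T)"
    using \<rho> by (rule_tac has_derivative_at_withinI) (simp add: has_mderiv_def \<rho>0)
  have \<rho>T: "?\<rho> ` T \<subseteq> ?S"
  proof
    fix z assume "z \<in> ?\<rho> ` T"
    then obtain y where y: "y \<in> T" "z = snd ?c (\<rho> (chart_inv ?c y))" by auto
    have "\<rho> (chart_inv ?c y) \<in> composable G" "\<rho> (chart_inv ?c y) \<in> fst ?c"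
      using T(4)[OF y(1)] f(5) U'(3) by (auto simp: \<rho>_def)
    then show "z \<in> ?S" using y(2) by blast
  qed
  have \<rho>y: "?\<rho> (snd ?c (g, h)) = snd ?c (g, h)" using chart_inv_left[OF c] by (simp add: \<rho>0)
  have chain: "(?r \<circ> ?\<rho> has_derivative K \<circ> (\<lambda>w. (Df w, snd w))) (at (snd ?c (g, h)))"
    if "(?r has_derivative K) (at (snd ?c (g, h)) within ?S)" for K
  proof -
    have "(?r has_derivative K) (at (?\<rho> (snd ?c (g, h))) within ?\<rho> ` T)"
      unfolding \<rho>y by (rule has_derivative_subset[OF that \<rho>T])
    from diff_chain_within[OF d\<rho> this] show ?thesis unfolding at_within_open[OF T(2,1)] .
  qed
  have ED: "E (Df w, snd w) = D (Df w, snd w)" for w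
    using fun_cong[OF has_derivative_unique[OF chain[OF rE] chain[OF rD]], of w] by simp
  have "dM g h (u, v) = D (u, v)" if "dS g u = dT h v" for u v
    using ED[of "(u, v)"] f(6)[OF that] by (simp add: E_def)
  moreover have "F (g', h') = mul G g' h'" if "(g', h') \<in> W" "(g', h') \<in> composable G" for g' h'
    using Fm that by simp
  ultimately show ?thesis by (rule that[OF D W, rotated])
qed

text \<open>The chain rule for products: \<open>dM g h (u, v)\<close> is the velocity of every product of two maps
  with velocities \<open>u\<close> and \<open>v\<close>.\<close>

lemma mul_deriv:
  assumes f1: "has_mderiv X (arr G) f1 x D1" and f2: "has_mderiv X (arr G) f2 x D2"
    and U: "openin (mtop X) U" "x \<in> U" and comp: "\<And>y. y \<in> U \<Longrightarrow> (f1 y, f2 y) \<in> composable G"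
  shows mul_deriv_compatible: "dS (f1 x) (D1 w) = dT (f2 x) (D2 w)"
    and mul_has_mderiv:
      "has_mderiv X (arr G) (\<lambda>y. mul G (f1 y) (f2 y)) x (\<lambda>w. dM (f1 x) (f2 x) (D1 w, D2 w))"
proof -
  let ?A = "arr G" and ?P = "prod_manifold (arr G) (arr G)"
  have gh: "(f1 x, f2 x) \<in> composable G" using comp U(2) by blast
  have pts: "f1 x \<in> points ?A" "f2 x \<in> points ?A" using composableD[OF gh] by auto
  have st: "src G (f1 y) = tgt G (f2 y)" if "y \<in> U" for y using composableD[OF comp[OF that]] by blast
  show compat: "dS (f1 x) (D1 w) = dT (f2 x) (D2 w)" for w
    by (rule mderiv_germ_unique[OF mderiv_compose[OF f1 src_deriv[OF pts(1)]]
          mderiv_compose[OF f2 tgt_deriv[OF pts(2)]] U st])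
  obtain F D V where F: "has_mderiv ?P ?A F (f1 x, f2 x) D" "openin (mtop ?P) V" "(f1 x, f2 x) \<in> V"
    "\<And>g' h'. (g', h') \<in> V \<Longrightarrow> (g', h') \<in> composable G \<Longrightarrow> F (g', h') = mul G g' h'"
    "\<And>u v. dS (f1 x) u = dT (f2 x) v \<Longrightarrow> dM (f1 x) (f2 x) (u, v) = D (u, v)"
    by (rule mul_local_extension[OF gh]) (rule that)
  note f12 = mderiv_Pair[OF f1 f2]
  obtain U' where U': "openin (mtop X) U'" "x \<in> U'" "\<And>y. y \<in> U' \<Longrightarrow> (f1 y, f2 y) \<in> V"
    by (rule cont_at_open_nbhd[OF mderiv_cont_at[OF f12] F(2,3)]) (rule that)
  have UU': "openin (mtop X) (U \<inter> U')" "x \<in> U \<inter> U'" using U U' by auto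
  have "has_mderiv X ?A (\<lambda>y. mul G (f1 y) (f2 y)) x (\<lambda>w. D (D1 w, D2 w))"
    by (rule mderiv_cong[OF mderiv_compose[OF f12 F(1)] UU']) (use F(4) comp U'(3) in blast)
  then show "has_mderiv X ?A (\<lambda>y. mul G (f1 y) (f2 y)) x (\<lambda>w. dM (f1 x) (f2 x) (D1 w, D2 w))"
    by (simp add: F(5)[OF compat])
qed

lemma dM_zero:
  assumes gh: "(g, h) \<in> composable G"
  shows "dM g h (0, 0) = 0"
proof -
  have g: "g \<in> Arr" and h: "h \<in> Arr" using composableD[OF gh] by auto
  note const = mderiv_const[OF charted_arr charted_arr g]
  show ?thesis
    by (rule mderiv_germ_unique[OF mul_has_mderiv[OF const[OF g] const[OF h] openin_topspace g gh]
          const[OF mul_closed(1)[OF gh]] openin_topspace g refl])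
qed

lemma dT_dM:
  assumes gh: "(g, h) \<in> composable G" and uv: "dS g u = dT h v"
  shows "dT (mul G g h) (dM g h (u, v)) = dT g u"
    and "dS (mul G g h) (dM g h (u, v)) = dS h v"
proof -
  let ?A = "arr G" and ?P = "prod_manifold (arr G) (arr G)"
  note pts = composableD[OF gh]
  obtain f D U where f: "has_mderiv ?P ?A f (g, h) D" "f (g, h) = g" "openin (mtop ?P) U" "(g, h) \<in> U"
    "\<And>k. k \<in> U \<Longrightarrow> (f k, snd k) \<in> composable G" "\<And>u v. dS g u = dT h v \<Longrightarrow> D (u, v) = u"
    by (rule composable_adjustment[OF gh]) (rule that)
  have s: "has_mderiv ?P ?A snd (g, h) snd" using pts by (intro mderiv_snd charted_arr) auto
  have m: "has_mderiv ?P ?A (\<lambda>k. mul G (f k) (snd k)) (g, h) (\<lambda>w. dM g h (D w, snd w))"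
    using mul_has_mderiv[OF f(1) s f(3,4,5)] by (simp add: f(2))
  have t: "has_mderiv ?A (obj G) (tgt G) (mul G (f (g, h)) (snd (g, h))) (dT (mul G g h))"
      "has_mderiv ?A (obj G) (tgt G) (f (g, h)) (dT g)"
    and r: "has_mderiv ?A (obj G) (src G) (mul G (f (g, h)) (snd (g, h))) (dS (mul G g h))"
      "has_mderiv ?A (obj G) (src G) (snd (g, h)) (dS h)"
    by (simp_all add: f(2) tgt_deriv src_deriv mul_closed(1)[OF gh] pts)
  have "dT (mul G g h) (dM g h (D (u, v), snd (u, v))) = dT g (D (u, v))"
    by (rule mderiv_germ_unique[OF mderiv_compose[OF m t(1)] mderiv_compose[OF f(1) t(2)] f(3,4)
          mul_closed(3)[OF f(5)]])
  then show "dT (mul G g h) (dM g h (u, v)) = dT g u" by (simp add: f(6)[OF uv])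
  have "dS (mul G g h) (dM g h (D (u, v), snd (u, v))) = dS h (snd (u, v))"
    by (rule mderiv_germ_unique[OF mderiv_compose[OF m r(1)] mderiv_compose[OF s r(2)] f(3,4)
          mul_closed(2)[OF f(5)]])
  then show "dS (mul G g h) (dM g h (u, v)) = dS h v" by (simp add: f(6)[OF uv])
qed

lemma dM_idn_left:
  assumes g: "g \<in> Arr"
  shows "dM (idn G (tgt G g)) g (dI (tgt G g) (dT g u), u) = u"
  by (rule mderiv_germ_unique[OF mul_has_mderiv[OF mderiv_compose[OF tgt_deriv[OF g]
          idn_deriv[OF tgt_in[OF g]]] mderiv_ident[OF charted_arr g] openin_topspace g composable_idn_left]
        mderiv_ident[OF charted_arr g] openin_topspace g mul_idn_left])

lemma dM_idn_right:
  assumes g: "g \<in> Arr"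
  shows "dM g (idn G (src G g)) (u, dI (src G g) (dS g u)) = u"
  by (rule mderiv_germ_unique[OF mul_has_mderiv[OF mderiv_ident[OF charted_arr g]
          mderiv_compose[OF src_deriv[OF g] idn_deriv[OF src_in[OF g]]] openin_topspace g composable_idn_right]
        mderiv_ident[OF charted_arr g] openin_topspace g mul_idn_right])

lemma dM_ginv:
  assumes x: "x \<in> Obj"
  shows "dM (idn G x) (idn G x) (u, dV (idn G x) u) = dI x (dT (idn G x) u)"
proof -
  note i = idn_in[OF x]
  have "dM (idn G x) (ginv G (idn G x)) (u, dV (idn G x) u) = dI (tgt G (idn G x)) (dT (idn G x) u)"
    by (rule mderiv_germ_unique[OF mul_has_mderiv[OF mderiv_ident[OF charted_arr i] ginv_deriv[OF i]
            openin_topspace i composable_ginv(1)]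
          mderiv_compose[OF tgt_deriv[OF i] idn_deriv[OF tgt_in[OF i]]] openin_topspace i inverse_laws(3)])
  then show ?thesis by (simp add: ginv_idn[OF x] tgt_idn[OF x])
qed

text \<open>A vector tangent to a source fibre is the right translate of a vector at a unit: translate a curve
  in the source fibre to the unit and back.\<close>

lemma right_translation:
  assumes g: "g \<in> Arr" and u: "dS g u = 0"
  obtains a where "a \<in> algebroid G (tgt G g)" "dM (idn G (tgt G g)) g (a, 0) = u"
proof -
  let ?A = "arr G" and ?h = "ginv G g"
  note h = ginv_in[OF g] and il = inverse_laws[OF g]
  obtain c D V where cg: "c g = g" and c: "has_mderiv ?A ?A c g D" "\<And>u. dS g u = 0 \<Longrightarrow> D u = u"
    and V: "openin (mtop ?A) V" "g \<in> V" "\<And>k. k \<in> V \<Longrightarrow> c k \<in> points ?A \<and> src G (c k) = src G g"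
    by (rule submersion_map_into_fibre[OF charted_arr obj_manifold src_submersion g]) (rule that)
  have cV: "c k \<in> points ?A" "src G (c k) = src G g" if "k \<in> V" for k using V(3)[OF that] by auto
  have comp1: "(c k, ?h) \<in> composable G" if "k \<in> V" for k
    using cV[OF that] h il by (intro composableI) auto
  have comp2: "(mul G (c k) ?h, g) \<in> composable G" if "k \<in> V" for k
    using mul_closed[OF comp1[OF that]] g il by (intro composableI) auto
  have undo: "mul G (mul G (c k) ?h) g = c k" if "k \<in> V" for k
    using mul_assoc[OF comp1[OF that] composable_ginv(2)[OF g]] mul_idn_right[OF cV(1)[OF that]]
    by (simp add: il cV(2)[OF that])
  note const = mderiv_const[OF charted_arr charted_arr g]
  have m1: "has_mderiv ?A ?A (\<lambda>k. mul G (c k) ?h) g (\<lambda>v. dM g ?h (D v, 0))"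
    using mul_has_mderiv[OF c(1) const[OF h] V(1,2) comp1] by (simp add: cg)
  define a where "a = dM g ?h (u, 0)"
  have "dM (mul G (c g) ?h) g (dM g ?h (D u, 0), 0) = D u"
    by (rule mderiv_germ_unique[OF mul_has_mderiv[OF m1 const[OF g] V(1,2) comp2] c(1) V(1,2) undo])
  then have au: "dM (idn G (tgt G g)) g (a, 0) = u" by (simp add: c(2)[OF u] a_def cg il)
  have "dS g u = dT ?h 0" by (simp add: u linear_0[OF linear_dT[OF h]])
  from dT_dM(2)[OF composable_ginv(1)[OF g] this]
  have "a \<in> algebroid G (tgt G g)"
    by (simp add: a_def algebroid_def il linear_0[OF linear_dS[OF h]])
  then show ?thesis using au by (rule that)
qed

lemma algebroid_composable:
  assumes "g \<in> Arr" "a \<in> algebroid G (tgt G g)"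
  shows "dS (idn G (tgt G g)) a = dT g 0"
  using assms by (simp add: algebroid_def linear_0[OF linear_dT])

end

section \<open>Multiplicative forms\<close>

text \<open>At a unit, a multiplicative form is determined by its values on an algebroid element and a vector
  tangent to the units. If the map \<open>\<mu>\<close> that encodes these values is an isomorphism from the algebroid
  to the cotangent bundle of the base, translations spread the nondegeneracy to all arrows.\<close>

locale multiplicative_form = groupoid_calculus G
  for G :: "('g, 'eg::model_space, 'm, 'em::model_space) groupoid" +
  fixes \<omega> :: "'g \<Rightarrow> 'eg \<Rightarrow> 'eg \<Rightarrow> real"
  assumes form: "two_form (arr G) \<omega>" and mult: "multiplicative G \<omega>"
begin

lemma form_bilinear: "g \<in> Arr \<Longrightarrow> bilinear (\<omega> g)"
  and form_alt: "g \<in> Arr \<Longrightarrow> \<omega> g v v = 0"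
  using form unfolding two_form_def by blast+

lemma form_anti: "g \<in> Arr \<Longrightarrow> \<omega> g u v = - \<omega> g v u"
proof -
  assume g: "g \<in> Arr"
  have "\<omega> g (u + v) (u + v) = \<omega> g u u + \<omega> g u v + \<omega> g v u + \<omega> g v v"
    by (simp add: bilinear_ladd[OF form_bilinear[OF g]] bilinear_radd[OF form_bilinear[OF g]])
  then show ?thesis by (simp add: form_alt[OF g])
qed

lemma form_zero: "g \<in> Arr \<Longrightarrow> \<omega> g 0 v = 0" "g \<in> Arr \<Longrightarrow> \<omega> g v 0 = 0"
  using bilinear_lzero[OF form_bilinear] bilinear_rzero[OF form_bilinear] by blast+

lemma multD:
  assumes "(g, h) \<in> composable G" "dS g u = dT h v" "dS g u' = dT h v'"
  shows "\<omega> (mul G g h) (dM g h (u, v)) (dM g h (u', v')) = \<omega> g u u' + \<omega> h v v'"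
  using mult assms unfolding multiplicative_def Let_def by fastforce

text \<open>Differentiating \<open>1\<^sub>x \<cdot> 1\<^sub>x = 1\<^sub>x\<close> turns multiplicativity into \<open>\<omega> = \<omega> + \<omega>\<close> on vectors tangent to
  the units.\<close>

lemma units_isotropic:
  assumes x: "x \<in> Obj"
  shows "\<omega> (idn G x) (dI x v) (dI x v') = 0"
proof -
  have m: "dM (idn G x) (idn G x) (dI x v, dI x v) = dI x v" for v
    using dM_idn_left[OF idn_in[OF x], of "dI x v"] by (simp add: tgt_idn[OF x] dT_dI[OF x])
  have "dS (idn G x) (dI x v) = dT (idn G x) (dI x v)" for v
    by (simp add: dS_dI[OF x] dT_dI[OF x])
  from multD[OF composable_idn[OF x] this this, of v v'] show ?thesis
    using idn_left[OF x idn_in[OF x]] by (simp add: m tgt_idn[OF x])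
qed

text \<open>By \<open>1 \<cdot> g = g\<close>, every vector \<open>w\<close> at \<open>g\<close> is the product of a vector tangent to the units and
  \<open>w\<close> itself.\<close>

lemma right_translate_form:
  assumes g: "g \<in> Arr" and a: "a \<in> algebroid G (tgt G g)"
  shows "\<omega> g (dM (idn G (tgt G g)) g (a, 0)) w = mu_map G \<omega> (tgt G g) a (dT g w)"
proof -
  have "dS (idn G (tgt G g)) (dI (tgt G g) (dT g w)) = dT g w" by (rule dS_dI[OF tgt_in[OF g]])
  from multD[OF composable_idn_left[OF g] algebroid_composable[OF g a] this]
  show ?thesis by (simp add: dM_idn_left[OF g] mul_idn_left[OF g] form_zero[OF g] mu_map_def)
qed

lemma left_translate_form:
  assumes g: "g \<in> Arr" and b: "dT (idn G (src G g)) b = 0"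
  shows "\<omega> g (dM g (idn G (src G g)) (0, b)) w = \<omega> (idn G (src G g)) b (dI (src G g) (dS g w))"
proof -
  have "dT (idn G (src G g)) (dI (src G g) (dS g w)) = dS g w" by (rule dT_dI[OF src_in[OF g]])
  then have 1: "dS g w = dT (idn G (src G g)) (dI (src G g) (dS g w))" by simp
  have "dS g 0 = dT (idn G (src G g)) b" by (simp add: b linear_0[OF linear_dS[OF g]])
  from multD[OF composable_idn_right[OF g] this 1]
  show ?thesis by (simp add: dM_idn_right[OF g] mul_idn_right[OF g] form_zero[OF g])
qed

text \<open>Differentiating \<open>g \<cdot> g\<^sup>-\<^sup>1 = 1\<close> at a unit shows that \<open>a\<close> and its image under the inversion have
  a product tangent to the units, where \<open>\<omega>\<close> vanishes.\<close>

lemma ginv_form: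
  assumes x: "x \<in> Obj"
  shows "\<omega> (idn G x) (dV (idn G x) a) (dI x v) = - mu_map G \<omega> x a v"
proof -
  note i = idn_in[OF x]
  have 1: "dS (idn G x) a = dT (idn G x) (dV (idn G x) a)"
    using dT_dV[OF i] by (simp add: ginv_idn[OF x])
  have 2: "dS (idn G x) (dI x v) = dT (idn G x) (dI x v)" by (simp add: dS_dI[OF x] dT_dI[OF x])
  have m: "dM (idn G x) (idn G x) (dI x v, dI x v) = dI x v"
    using dM_idn_left[OF i, of "dI x v"] by (simp add: tgt_idn[OF x] dT_dI[OF x])
  have "\<omega> (idn G x) (dI x (dT (idn G x) a)) (dI x v) =
      \<omega> (idn G x) a (dI x v) + \<omega> (idn G x) (dV (idn G x) a) (dI x v)"
    using multD[OF composable_idn[OF x] 1 2] idn_left[OF x i]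
    by (simp add: dM_ginv[OF x] m tgt_idn[OF x])
  then show ?thesis by (simp add: units_isotropic[OF x] mu_map_def)
qed

text \<open>Pairing \<open>u\<close> with left translates shows \<open>ds(u) = 0\<close>. So \<open>u\<close> is the right translate of some \<open>a\<close>,
  and pairing \<open>u\<close> with arbitrary vectors shows \<open>\<mu>(a) = 0\<close>.\<close>

lemma nondegenerate:
  assumes inj: "\<And>x a. x \<in> Obj \<Longrightarrow> a \<in> algebroid G x \<Longrightarrow>
      (\<And>v. mu_map G \<omega> x a v = 0) \<Longrightarrow> a = 0"
    and surj: "\<And>x \<beta>. x \<in> Obj \<Longrightarrow> linear \<beta> \<Longrightarrow>
      \<exists>a\<in>algebroid G x. \<forall>v. mu_map G \<omega> x a v = \<beta> v"
    and g: "g \<in> Arr" and u: "\<And>w. \<omega> g u w = 0"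
  shows "u = 0"
proof -
  let ?x = "src G g"
  note x = src_in[OF g] and i = idn_in[OF src_in[OF g]]
  have u': "\<omega> g w u = 0" for w using form_anti[OF g, of w u] u[of w] by simp
  have "\<beta> (dS g u) = \<beta> 0" if \<beta>: "linear \<beta>" for \<beta> :: "'em \<Rightarrow> real"
  proof -
    obtain a where a: "a \<in> algebroid G ?x" "\<And>v. mu_map G \<omega> ?x a v = \<beta> v"
      using surj[OF x \<beta>] by blast
    \<comment> \<open>\<open>b\<close> corrects \<open>a\<close> by a vector tangent to the units, on which \<open>\<omega>\<close> vanishes, so as to be tangent
      to the target fibre.\<close>
    define b where "b = a - dI ?x (dT (idn G ?x) a)"
    have "dT (idn G ?x) b = 0" by (simp add: b_def linear_diff[OF linear_dT[OF i]] dT_dI[OF x])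
    from left_translate_form[OF g this, of u]
    have "\<omega> (idn G ?x) b (dI ?x (dS g u)) = 0" by (simp add: u')
    then have "\<omega> (idn G ?x) a (dI ?x (dS g u)) = 0"
      by (simp add: b_def bilinear_lsub[OF form_bilinear[OF i]] units_isotropic[OF x])
    then show ?thesis using a(2)[of "dS g u"] linear_0[OF \<beta>] by (simp add: mu_map_def)
  qed
  then have "dS g u = 0" by (rule linear_functionals_separate)
  then obtain a where a: "a \<in> algebroid G (tgt G g)" "dM (idn G (tgt G g)) g (a, 0) = u"
    by (rule right_translation[OF g]) (rule that)
  have "mu_map G \<omega> (tgt G g) a v = 0" for v
  proof -
    have "surj (dT g)" using tgt_submersion g by (simp add: submersion_def)
    then obtain w where "v = dT g w" by (metis surjD)
    then show ?thesis using right_translate_form[OF g a(1), of w] u by (simp add: a(2))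
  qed
  then have "a = 0" by (rule inj[OF tgt_in[OF g] a(1)])
  then show ?thesis using a(2) dM_zero[OF composable_idn_left[OF g]] by simp
qed

end

section \<open>Principal bundles\<close>

lemma lie_group_charted: "lie_group H \<Longrightarrow> charted (mfd H)"
  unfolding lie_group_def using smooth_manifold_charted by blast

lemma lie_group_right_translation:
  assumes H: "lie_group H" and f: "has_mderiv X (mfd H) f x D" and k: "k \<in> carrier H"
  shows "\<exists>E. has_mderiv X (mfd H) (\<lambda>y. f y \<otimes>\<^bsub>H\<^esub> k) x E"
proof -
  let ?m = "\<lambda>(h, k). h \<otimes>\<^bsub>H\<^esub> k"
  note cH = lie_group_charted[OF H]
  have pts: "points (mfd H) = carrier H"
    and sm: "smooth_map (prod_manifold (mfd H) (mfd H)) (mfd H) ?m"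
    using H unfolding lie_group_def by blast+
  have k': "k \<in> points (mfd H)" using k pts by simp
  then have "(f x, k) \<in> points (prod_manifold (mfd H) (mfd H))" using mderiv_points(2)[OF f] by simp
  note 1 = smooth_map_has_mderiv[OF charted_prod[OF cH cH] cH sm this]
  note 2 = mderiv_Pair[OF f mderiv_const[OF mderiv_charted(1)[OF f] cH mderiv_points(1)[OF f] k']]
  from mderiv_compose[OF 2 1] show ?thesis by (rule_tac exI) (simp only: prod.case)
qed

locale principal =
  fixes H :: "('h, 'eh::model_space) lie_grp"
    and M :: "('m, 'em::model_space) manifold"
    and N :: "('n, 'en::model_space) manifold"
    and act :: "'h \<Rightarrow> 'm \<Rightarrow> 'm"
    and q :: "'m \<Rightarrow> 'n"
  assumes principal: "principal_bundle H M N act q"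
begin

abbreviation "dQ \<equiv> mdiff M N q"
abbreviation "dA x \<equiv> mdiff (mfd H) M (\<lambda>h. act h x) \<one>\<^bsub>H\<^esub>"

lemma lie_group: "lie_group H" and base_manifold: "smooth_manifold N" and total_manifold: "smooth_manifold M"
  and action: "smooth_action H M act" and q_smooth: "smooth_map M N q"
  using principal unfolding principal_bundle_def by blast+

lemma group: "group H" and points_group: "points (mfd H) = carrier H"
  using lie_group unfolding lie_group_def by blast+

lemma charted_group: "charted (mfd H)" and charted_total: "charted M" and charted_base: "charted N"
  using lie_group_charted[OF lie_group] smooth_manifold_charted base_manifold total_manifold by blast+

lemma one_in: "\<one>\<^bsub>H\<^esub> \<in> carrier H"
  using group by (simp add: group.is_monoid)

lemma q_deriv: "x \<in> points M \<Longrightarrow> has_mderiv M N q x (dQ x)"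
  by (rule smooth_map_has_mderiv[OF charted_total charted_base q_smooth])

lemma q_in: "x \<in> points M \<Longrightarrow> q x \<in> points N"
  by (rule mderiv_points(2)[OF q_deriv])

lemma act_in: "h \<in> carrier H \<Longrightarrow> x \<in> points M \<Longrightarrow> act h x \<in> points M"
proof -
  assume "h \<in> carrier H" "x \<in> points M"
  then have "(h, x) \<in> points (prod_manifold (mfd H) M)" by (simp add: points_group)
  moreover have "smooth_map (prod_manifold (mfd H) M) M (\<lambda>(h, x). act h x)"
    using action unfolding smooth_action_def by blast
  ultimately show ?thesis
    using continuous_map_image_subset_topspace unfolding smooth_map_def by fastforce
qed

lemma act_one: "x \<in> points M \<Longrightarrow> act \<one>\<^bsub>H\<^esub> x = x"
  using action unfolding smooth_action_def by blast

lemma q_act: "h \<in> carrier H \<Longrightarrow> x \<in> points M \<Longrightarrow> q (act h x) = q x"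
  using principal unfolding principal_bundle_def by blast

lemma action_deriv:
  assumes x: "x \<in> points M"
  shows "has_mderiv (mfd H) M (\<lambda>h. act h x) \<one>\<^bsub>H\<^esub> (dA x)"
proof -
  have sm: "smooth_map (prod_manifold (mfd H) M) M (\<lambda>(h, x). act h x)"
    using action unfolding smooth_action_def by blast
  have o: "\<one>\<^bsub>H\<^esub> \<in> points (mfd H)" by (simp add: points_group one_in)
  then have ox: "(\<one>\<^bsub>H\<^esub>, x) \<in> points (prod_manifold (mfd H) M)" by (simp add: x)
  note 1 = smooth_map_has_mderiv[OF charted_prod[OF charted_group charted_total] charted_total sm ox]
  note 2 = mderiv_Pair[OF mderiv_ident[OF charted_group o]
      mderiv_const[OF charted_group charted_total o x]]
  from mderiv_compose[OF 2 1]
  have d: "has_mderiv (mfd H) M (\<lambda>h. act h x) \<one>\<^bsub>H\<^esub> (\<lambda>v. mdiff (prod_manifold (mfd H) M) M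
      (\<lambda>(h, x). act h x) (\<one>\<^bsub>H\<^esub>, x) (v, 0))" by simp
  show ?thesis unfolding mderiv_mdiff[OF d] by (rule d)
qed

text \<open>A local trivialization \<open>(q, \<tau>)\<close> yields the coordinate \<open>h k = \<tau> k \<cdot> (\<tau> x)\<^sup>-\<^sup>1\<close> on the orbit of \<open>x\<close>. The
  map \<open>k \<mapsto> h k \<cdot> x\<close> projects to this orbit without changing \<open>\<tau>\<close>, so its differential fixes the
  vertical vectors, while its values show them to be tangent to the orbit.\<close>

lemma orbit_coordinate:
  assumes x: "x \<in> points M"
  obtains h E where "has_mderiv M (mfd H) h x E"
    "\<And>a. a \<in> carrier H \<Longrightarrow> h (act a x) = a"
    "\<And>k. k \<in> points M \<Longrightarrow> q k = q x \<Longrightarrow> h k \<in> carrier H \<and> act (h k) x = k"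
    "\<And>X. dQ x X = 0 \<Longrightarrow> dA x (E X) = X"
proof -
  interpret group H by (rule group)
  obtain V \<tau> where V: "openin (mtop N) V" "q x \<in> V"
    and diff: "diffeomorphism (open_submanifold M {x \<in> points M. q x \<in> V})
          (prod_manifold (open_submanifold N V) (mfd H)) (\<lambda>x. (q x, \<tau> x))"
    and equi: "\<forall>h\<in>carrier H. \<forall>x\<in>points M. q x \<in> V \<longrightarrow> \<tau> (act h x) = h \<otimes>\<^bsub>H\<^esub> \<tau> x"
    using principal q_in[OF x] unfolding principal_bundle_def by blast
  define W where "W = {x \<in> points M. q x \<in> V}"
  let ?MW = "open_submanifold M W" and ?NV = "open_submanifold N V"
  let ?P = "prod_manifold ?NV (mfd H)"
  have W: "openin (mtop M) W" "x \<in> W"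
    using openin_continuous_map_preimage[of "mtop M" "mtop N" q V] q_smooth V x
    unfolding W_def smooth_map_def by auto
  have W_eq: "points ?MW = W" by (auto simp: W_def)
  have cMW: "charted ?MW" and cNV: "charted ?NV"
    using charted_open_submanifold[OF charted_total W(1)] charted_open_submanifold[OF charted_base V(1)] .
  have cP: "charted ?P" by (rule charted_prod[OF cNV charted_group])
  obtain \<Theta> where sm: "smooth_map ?MW ?P (\<lambda>x. (q x, \<tau> x))" and \<Theta>: "smooth_map ?P ?MW \<Theta>"
    and inv: "\<And>k. k \<in> W \<Longrightarrow> \<Theta> (q k, \<tau> k) = k"
    using diff unfolding diffeomorphism_def W_def[symmetric] W_eq by blast
  have pP: "(q k, \<tau> k) \<in> points ?P" if "k \<in> W" for k
    using sm that unfolding smooth_map_def continuous_map_def W_eq by blast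
  then have \<tau>H: "\<tau> k \<in> carrier H" if "k \<in> W" for k using that by (auto simp: points_group)
  have \<tau>act: "\<tau> (act h k) = h \<otimes>\<^bsub>H\<^esub> \<tau> k" if "h \<in> carrier H" "k \<in> W" for h k
    using equi that by (simp add: W_def)
  have xW: "x \<in> points ?MW" and pNV: "q x \<in> points ?NV" and pH: "\<tau> x \<in> points (mfd H)"
    using W(2) pP[OF W(2)] W_eq unfolding points_prod by blast+
  define D where "D = mdiff ?MW ?P (\<lambda>x. (q x, \<tau> x)) x"
  have D: "has_mderiv ?MW ?P (\<lambda>x. (q x, \<tau> x)) x D"
    unfolding D_def by (rule smooth_map_has_mderiv[OF cMW cP sm xW])
  note loc = mderiv_open_submanifold[OF charted_total W(1)]
  have d\<tau>: "has_mderiv M (mfd H) \<tau> x (\<lambda>v. snd (D v))"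
    using loc[OF mderiv_compose[OF D mderiv_snd[OF cNV pNV charted_group pH]]] by simp
  have "has_mderiv M N q x (\<lambda>v. fst (D v))"
    using loc[OF mderiv_open_submanifold_target[OF charted_base V(1)
        mderiv_compose[OF D mderiv_fst[OF cNV pNV charted_group pH]]]] by simp
  then have dq: "fst (D v) = dQ x v" for v using fun_cong[OF mderiv_mdiff, of M N q x _ v] by metis
  have inj: "v = 0" if v: "dQ x v = 0" "snd (D v) = 0" for v
  proof -
    note E = smooth_map_has_mderiv[OF cP cMW \<Theta> pP[OF W(2)]]
    have "mdiff ?P ?MW \<Theta> (q x, \<tau> x) (D v) = v"
      by (rule mderiv_germ_unique[OF mderiv_compose[OF D E] mderiv_ident[OF cMW xW] openin_topspace xW])
        (rule inv, simp add: W_eq)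
    moreover have "D v = 0" using v by (simp add: prod_eq_iff dq)
    ultimately show ?thesis using linear_0[OF mderiv_linear[OF E]] by simp
  qed
  note \<tau>x = \<tau>H[OF W(2)]
  define h where "h = (\<lambda>k. \<tau> k \<otimes>\<^bsub>H\<^esub> inv\<^bsub>H\<^esub> \<tau> x)"
  have hH: "h k \<in> carrier H" if "k \<in> W" for k using \<tau>H[OF that] \<tau>x by (simp add: h_def)
  have \<tau>h: "\<tau> (act (h k) x) = \<tau> k" if "k \<in> W" for k
    unfolding \<tau>act[OF hH[OF that] W(2)] using \<tau>H[OF that] \<tau>x by (simp add: h_def m_assoc)
  have hx: "h x = \<one>\<^bsub>H\<^esub>" using \<tau>x by (simp add: h_def)
  have "\<exists>E. has_mderiv M (mfd H) h x E"
    unfolding h_def by (rule lie_group_right_translation[OF lie_group d\<tau> inv_closed[OF \<tau>x]])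
  then obtain E where E: "has_mderiv M (mfd H) h x E" ..
  have 2: "h (act a x) = a" if "a \<in> carrier H" for a
    unfolding h_def \<tau>act[OF that W(2)] using that \<tau>x by (simp add: m_assoc)
  have 3: "h k \<in> carrier H \<and> act (h k) x = k" if k: "k \<in> points M" "q k = q x" for k
  proof -
    have kW: "k \<in> W" using k V(2) by (simp add: W_def)
    have q: "q (act (h k) x) = q k" using q_act[OF hH[OF kW] x] k(2) by simp
    then have "act (h k) x \<in> W" using act_in[OF hH[OF kW] x] kW by (simp add: W_def)
    from inv[OF this] have "act (h k) x = \<Theta> (q k, \<tau> k)" unfolding q \<tau>h[OF kW] by (rule sym)
    then show ?thesis using hH[OF kW] inv[OF kW] by simp
  qed
  have 4: "dA x (E X) = X" if X: "dQ x X = 0" for X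
  proof -
    have A: "has_mderiv (mfd H) M (\<lambda>a. act a x) (h x) (dA x)" using action_deriv[OF x] by (simp add: hx)
    note c = mderiv_compose[OF E A]
    have cx: "act (h x) x = x" by (simp add: hx act_one[OF x])
    have q: "has_mderiv M N q (act (h x) x) (dQ x)" and t: "has_mderiv M (mfd H) \<tau> (act (h x) x) (\<lambda>v. snd (D v))"
      unfolding cx by (rule q_deriv[OF x], rule d\<tau>)
    have "dQ x (dA x (E X)) = 0"
      by (rule mderiv_germ_unique[OF mderiv_compose[OF c q]
            mderiv_const[OF charted_total charted_base x q_in[OF x]] W q_act[OF hH x]])
    moreover have "snd (D (dA x (E X))) = snd (D X)"
      by (rule mderiv_germ_unique[OF mderiv_compose[OF c t] d\<tau> W \<tau>h])
    ultimately have "dA x (E X) - X = 0"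
      by (intro inj) (simp_all add: linear_diff[OF mderiv_linear[OF q_deriv[OF x]]] X
          linear_diff[OF mderiv_linear[OF D]])
    then show ?thesis by simp
  qed
  show ?thesis by (rule that[OF E 2 3 4])
qed

lemma fibres_are_orbits:
  assumes x: "x \<in> points M" "x' \<in> points M" "q x' = q x"
  obtains h where "h \<in> carrier H" "act h x = x'"
  using orbit_coordinate[OF x(1)] x(2,3) by metis

lemma vertical_vectors:
  assumes x: "x \<in> points M" and X: "dQ x X = 0"
  obtains u where "dA x u = X"
  using orbit_coordinate[OF x] X by metis

end

section \<open>Orbits of the double action and the kernel of the form\<close>

locale admissible_quotient =
  principal H "obj G" "obj Q" act q + multiplicative_form G \<omega> + quo: groupoid_calculus Q
  for H :: "('h, 'eh::model_space) lie_grp"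
    and G :: "('g, 'eg::model_space, 'm, 'em::model_space) groupoid"
    and Q :: "('g set, 'eq::model_space, 'n, 'en::model_space) groupoid"
    and act :: "'h \<Rightarrow> 'm \<Rightarrow> 'm"
    and q :: "'m \<Rightarrow> 'n"
    and \<omega> :: "'g \<Rightarrow> 'eg \<Rightarrow> 'eg \<Rightarrow> real" +
  fixes \<pi> :: "'n \<Rightarrow> ('en \<Rightarrow> real) \<Rightarrow> ('en \<Rightarrow> real) \<Rightarrow> real"
    and \<Psi> :: "'h \<times> 'm \<Rightarrow> 'g"
  assumes closed: "closed_form (arr G) \<omega>"
    and delta_inj: "\<And>x. x \<in> points (obj G) \<Longrightarrow> inj_on (delta_map G \<omega> x) (algebroid G x)"
    and dirac: "integrated_dirac G \<omega> = dirac_pullback (obj G) (obj Q) q (poisson_graph (obj Q) \<pi>)"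
    and poisson: "poisson_structure (obj Q) \<pi>"
    and admissible: "H_admissible H (obj G) act G \<omega> \<Psi>"
    and quotient: "quotient_groupoid H G \<Psi> (obj Q) q Q"
begin

abbreviation "p \<equiv> orbit_map H G \<Psi>"
abbreviation "dP \<equiv> mdiff (arr G) (arr Q) p"
abbreviation "dPsi x u \<equiv> mdiff (prod_manifold (mfd H) (obj G)) (arr G) \<Psi> (\<one>\<^bsub>H\<^esub>, x) (u, 0)"

lemma p_submersion: "submersion (arr G) (arr Q) p" and p_morphism: "lie_groupoid_morphism G Q p q"
  and points_quotient: "quo.Arr = p ` Arr"
  using quotient unfolding quotient_groupoid_def by blast+

lemma p_deriv: "g \<in> Arr \<Longrightarrow> has_mderiv (arr G) (arr Q) p g (dP g)"
  by (rule smooth_map_has_mderiv[OF charted_arr quo.charted_arr])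
    (use p_submersion in \<open>simp_all add: submersion_def\<close>)

lemma p_in: "g \<in> Arr \<Longrightarrow> p g \<in> quo.Arr"
  by (rule mderiv_points(2)[OF p_deriv])

lemma p_lift:
  assumes "k \<in> quo.Arr" obtains g where "g \<in> Arr" "p g = k"
  using assms unfolding points_quotient by blast

lemma dP_lift:
  assumes "g \<in> Arr" obtains u where "dP g u = v"
  using p_submersion assms unfolding submersion_def by (metis surjD)

lemma linear_dP: "g \<in> Arr \<Longrightarrow> linear (dP g)"
  by (rule mderiv_linear[OF p_deriv])

lemma src_p: "g \<in> Arr \<Longrightarrow> src Q (p g) = q (src G g)"
  and tgt_p: "g \<in> Arr \<Longrightarrow> tgt Q (p g) = q (tgt G g)"
  using p_morphism unfolding lie_groupoid_morphism_def by blast+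

lemma p_mul: "(g, h) \<in> composable G \<Longrightarrow> p (mul G g h) = mul Q (p g) (p h)"
  using p_morphism unfolding lie_groupoid_morphism_def by blast

lemma p_idn: "x \<in> Obj \<Longrightarrow> p (idn G x) = idn Q (q x)"
  using p_morphism unfolding lie_groupoid_morphism_def by blast

lemma dS_dP:
  assumes g: "g \<in> Arr"
  shows "quo.dS (p g) (dP g u) = dQ (src G g) (dS g u)"
  by (rule mderiv_germ_unique[OF mderiv_compose[OF p_deriv[OF g] quo.src_deriv[OF p_in[OF g]]]
        mderiv_compose[OF src_deriv[OF g] q_deriv[OF src_in[OF g]]] openin_topspace g src_p])

lemma dT_dP:
  assumes g: "g \<in> Arr"
  shows "quo.dT (p g) (dP g u) = dQ (tgt G g) (dT g u)"
  by (rule mderiv_germ_unique[OF mderiv_compose[OF p_deriv[OF g] quo.tgt_deriv[OF p_in[OF g]]]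
        mderiv_compose[OF tgt_deriv[OF g] q_deriv[OF tgt_in[OF g]]] openin_topspace g tgt_p])

lemma dP_dI:
  assumes x: "x \<in> Obj"
  shows "dP (idn G x) (dI x v) = quo.dI (q x) (dQ x v)"
  by (rule mderiv_germ_unique[OF mderiv_compose[OF idn_deriv[OF x] p_deriv[OF idn_in[OF x]]]
        mderiv_compose[OF q_deriv[OF x] quo.idn_deriv[OF q_in[OF x]]] openin_topspace x p_idn])

text \<open>The differential of \<open>q\<close> is onto because \<open>q \<circ> src = src \<circ> p\<close> is a composition of submersions.\<close>

lemma dQ_lift:
  assumes x: "x \<in> Obj" obtains v where "dQ x v = w"
proof -
  note i = idn_in[OF x]
  have "surj (quo.dS (p (idn G x)))"
    using quo.src_submersion p_in[OF i] unfolding submersion_def by blast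
  then obtain b where b: "w = quo.dS (p (idn G x)) b" by (rule surjE)
  obtain a where a: "dP (idn G x) a = b" by (rule dP_lift[OF i])
  have "dQ x (dS (idn G x) a) = w" using dS_dP[OF i, of a] by (simp add: a b src_idn[OF x])
  then show ?thesis by (rule that)
qed

lemma Psi_morphism: "lie_groupoid_morphism (action_groupoid H (obj G) act) G \<Psi> id"
  using admissible unfolding H_admissible_def integrates_infinitesimal_action_def by blast

lemma Psi_smooth: "smooth_map (prod_manifold (mfd H) (obj G)) (arr G) \<Psi>"
  using Psi_morphism unfolding lie_groupoid_morphism_def action_groupoid_def by simp

lemma Psi_in_src_tgt:
  assumes "h \<in> carrier H" "x \<in> Obj"
  shows Psi_in: "\<Psi> (h, x) \<in> Arr"
    and src_Psi: "src G (\<Psi> (h, x)) = x" and tgt_Psi: "tgt G (\<Psi> (h, x)) = act h x"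
proof -
  have hx: "(h, x) \<in> points (prod_manifold (mfd H) (obj G))" using assms by (simp add: points_group)
  show "\<Psi> (h, x) \<in> Arr"
    using Psi_smooth hx unfolding smooth_map_def continuous_map_def by blast
  show "src G (\<Psi> (h, x)) = x" "tgt G (\<Psi> (h, x)) = act h x"
    using Psi_morphism hx unfolding lie_groupoid_morphism_def action_groupoid_def by auto
qed

lemma Psi_one: "x \<in> Obj \<Longrightarrow> \<Psi> (\<one>\<^bsub>H\<^esub>, x) = idn G x"
  using Psi_morphism unfolding lie_groupoid_morphism_def action_groupoid_def by simp

lemma Psi_mul:
  assumes "h \<in> carrier H" "k \<in> carrier H" "x \<in> Obj"
  shows "\<Psi> (k \<otimes>\<^bsub>H\<^esub> h, x) = mul G (\<Psi> (k, act h x)) (\<Psi> (h, x))"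
proof -
  have "((k, act h x), (h, x)) \<in> composable (action_groupoid H (obj G) act)"
    using assms act_in unfolding composable_def action_groupoid_def by (simp add: points_group)
  then have "\<Psi> (mul (action_groupoid H (obj G) act) (k, act h x) (h, x)) =
      mul G (\<Psi> (k, act h x)) (\<Psi> (h, x))"
    using Psi_morphism unfolding lie_groupoid_morphism_def by blast
  then show ?thesis by (simp add: action_groupoid_def)
qed

lemma one_point: "\<one>\<^bsub>H\<^esub> \<in> points (mfd H)"
  by (simp add: points_group one_in)

lemma Psi_deriv:
  assumes x: "x \<in> Obj"
  shows "has_mderiv (mfd H) (arr G) (\<lambda>h. \<Psi> (h, x)) \<one>\<^bsub>H\<^esub> (dPsi x)"
proof -
  have "(\<one>\<^bsub>H\<^esub>, x) \<in> points (prod_manifold (mfd H) (obj G))" by (simp add: x one_point)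
  note 1 = smooth_map_has_mderiv[OF charted_prod[OF charted_group charted_total] charted_arr Psi_smooth this]
  note 2 = mderiv_Pair[OF mderiv_ident[OF charted_group one_point]
      mderiv_const[OF charted_group charted_total one_point x]]
  show ?thesis by (rule mderiv_compose[OF 2 1])
qed

lemma Psi_one_deriv:
  assumes x: "x \<in> Obj" and f: "has_mderiv (arr G) P f (idn G x) D"
  shows "has_mderiv (mfd H) P (\<lambda>h. f (\<Psi> (h, x))) \<one>\<^bsub>H\<^esub> (\<lambda>u. D (dPsi x u))"
  by (rule mderiv_compose[OF Psi_deriv[OF x]]) (simp add: Psi_one[OF x] f)

lemma dPsi_algebroid:
  assumes x: "x \<in> Obj"
  shows "dPsi x u \<in> algebroid G x"
proof -
  have "dS (idn G x) (dPsi x u) = 0"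
    by (rule mderiv_germ_unique[OF Psi_one_deriv[OF x src_deriv[OF idn_in[OF x]]]
          mderiv_const[OF charted_group charted_obj one_point x] openin_topspace one_point])
      (simp add: points_group src_Psi x)
  then show ?thesis by (simp add: algebroid_def)
qed

lemma dT_dPsi:
  assumes x: "x \<in> Obj"
  shows "dT (idn G x) (dPsi x u) = dA x u"
  by (rule mderiv_germ_unique[OF Psi_one_deriv[OF x tgt_deriv[OF idn_in[OF x]]]
        action_deriv[OF x] openin_topspace one_point])
    (simp add: points_group tgt_Psi x)

lemma mu_dPsi:
  assumes x: "x \<in> Obj"
  shows "mu_map G \<omega> x (dPsi x u) = (\<lambda>_. 0)"
  using admissible x unfolding H_admissible_def integrates_infinitesimal_action_def delta_map_def by auto

lemma vertical_lift:
  assumes x: "x \<in> Obj" and X: "dQ x X = 0"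
  obtains u where "dT (idn G x) (dPsi x u) = X"
proof -
  obtain u where "dA x u = X"
    by (rule vertical_vectors[OF x X]) (rule that)
  then show ?thesis using dT_dPsi[OF x, of u] by (intro that[of u]) simp
qed

text \<open>The orbits of \<open>\<Psi> (h, x)\<close> and of the unit at \<open>x\<close> agree, as right multiplication by \<open>h\<close> permutes
  \<open>H\<close>. Hence \<open>p\<close> sends the image of \<open>\<Psi>\<close> to units, and is constant on orbits by the morphism
  property.\<close>

lemma p_Psi:
  assumes h: "h \<in> carrier H" and x: "x \<in> Obj"
  shows "p (\<Psi> (h, x)) = idn Q (q x)"
proof -
  interpret group H by (rule group)
  have 1: "double_action G \<Psi> (k, l) (\<Psi> (h, x)) = mul G (\<Psi> (k \<otimes>\<^bsub>H\<^esub> h, x)) (ginv G (\<Psi> (l, x)))"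
    if "k \<in> carrier H" for k l
    by (simp add: double_action_def src_Psi[OF h x] tgt_Psi[OF h x] Psi_mul[OF h that x])
  have 2: "double_action G \<Psi> (k, l) (idn G x) = mul G (\<Psi> (k, x)) (ginv G (\<Psi> (l, x)))"
    if "k \<in> carrier H" for k l
    using idn_right[OF x Psi_in[OF that x] src_Psi[OF that x]]
    by (simp add: double_action_def src_idn[OF x] tgt_idn[OF x])
  have "p (\<Psi> (h, x)) = p (idn G x)" unfolding orbit_map_def
  proof (intro equalityI subsetI)
    fix y assume "y \<in> (\<lambda>k. double_action G \<Psi> k (\<Psi> (h, x))) ` (carrier H \<times> carrier H)"
    then obtain k l where kl: "k \<in> carrier H" "l \<in> carrier H" "y = double_action G \<Psi> (k, l) (\<Psi> (h, x))"
      by auto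
    then have "y = double_action G \<Psi> (k \<otimes>\<^bsub>H\<^esub> h, l) (idn G x)" using h by (simp add: 1 2)
    then show "y \<in> (\<lambda>k. double_action G \<Psi> k (idn G x)) ` (carrier H \<times> carrier H)"
      by (rule image_eqI) (use kl h in simp)
  next
    fix y assume "y \<in> (\<lambda>k. double_action G \<Psi> k (idn G x)) ` (carrier H \<times> carrier H)"
    then obtain k l where kl: "k \<in> carrier H" "l \<in> carrier H" "y = double_action G \<Psi> (k, l) (idn G x)"
      by auto
    then have "y = double_action G \<Psi> (k \<otimes>\<^bsub>H\<^esub> inv\<^bsub>H\<^esub> h, l) (\<Psi> (h, x))"
      using h by (simp add: 1 2 m_assoc)
    then show "y \<in> (\<lambda>k. double_action G \<Psi> k (\<Psi> (h, x))) ` (carrier H \<times> carrier H)"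
      by (rule image_eqI) (use kl h in simp)
  qed
  then show ?thesis by (simp add: p_idn[OF x])
qed

lemma p_ginv_Psi:
  assumes h: "h \<in> carrier H" and x: "x \<in> Obj"
  shows "p (ginv G (\<Psi> (h, x))) = idn Q (q x)"
proof -
  let ?k = "\<Psi> (h, x)"
  note k = Psi_in[OF h x] and il = inverse_laws[OF Psi_in[OF h x]]
  have "tgt Q (p (ginv G ?k)) = q x" by (simp add: tgt_p[OF ginv_in[OF k]] il src_Psi[OF h x])
  then have "p (ginv G ?k) = mul Q (p ?k) (p (ginv G ?k))"
    using quo.idn_left[OF q_in[OF x] p_in[OF ginv_in[OF k]]] by (simp add: p_Psi[OF h x])
  also have "\<dots> = p (idn G (tgt G ?k))" using p_mul[OF composable_ginv(1)[OF k]] by (simp add: il)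
  also have "\<dots> = idn Q (q x)"
    by (simp add: tgt_Psi[OF h x] p_idn[OF act_in[OF h x]] q_act[OF h x])
  finally show ?thesis .
qed

lemma double_action_composable:
  assumes g: "g \<in> Arr" and h: "h1 \<in> carrier H" "h2 \<in> carrier H"
  shows double_action_composable1: "(\<Psi> (h1, tgt G g), g) \<in> composable G"
    and double_action_composable2:
      "(mul G (\<Psi> (h1, tgt G g)) g, ginv G (\<Psi> (h2, src G g))) \<in> composable G"
proof -
  note t = tgt_in[OF g] and s = src_in[OF g]
  show 1: "(\<Psi> (h1, tgt G g), g) \<in> composable G"
    by (rule composableI[OF Psi_in[OF h(1) t] g src_Psi[OF h(1) t]])
  note k = Psi_in[OF h(2) s]
  show "(mul G (\<Psi> (h1, tgt G g)) g, ginv G (\<Psi> (h2, src G g))) \<in> composable G"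
    by (rule composableI[OF mul_closed(1)[OF 1] ginv_in[OF k]])
      (simp add: mul_closed(2)[OF 1] inverse_laws[OF k] src_Psi[OF h(2) s])
qed

lemma double_action_closed:
  assumes g: "g \<in> Arr" and h: "h1 \<in> carrier H" "h2 \<in> carrier H"
  shows "double_action G \<Psi> (h1, h2) g \<in> Arr"
    and "src G (double_action G \<Psi> (h1, h2) g) = act h2 (src G g)"
    and "tgt G (double_action G \<Psi> (h1, h2) g) = act h1 (tgt G g)"
    and "p (double_action G \<Psi> (h1, h2) g) = p g"
proof -
  note t = tgt_in[OF g] and s = src_in[OF g]
  note 1 = double_action_composable1[OF g h] and 2 = double_action_composable2[OF g h]
  note k = Psi_in[OF h(2) s]
  show "double_action G \<Psi> (h1, h2) g \<in> Arr"
    using mul_closed(1)[OF 2] by (simp add: double_action_def)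
  show "src G (double_action G \<Psi> (h1, h2) g) = act h2 (src G g)"
    using mul_closed(2)[OF 2] by (simp add: double_action_def inverse_laws[OF k] tgt_Psi[OF h(2) s])
  show "tgt G (double_action G \<Psi> (h1, h2) g) = act h1 (tgt G g)"
    using mul_closed(3)[OF 2] mul_closed(3)[OF 1] by (simp add: double_action_def tgt_Psi[OF h(1) t])
  show "p (double_action G \<Psi> (h1, h2) g) = p g"
    using quo.mul_idn_left[OF p_in[OF g]] quo.mul_idn_right[OF p_in[OF g]]
    by (simp add: double_action_def p_mul[OF 1] p_mul[OF 2] p_Psi[OF h(1) t] p_ginv_Psi[OF h(2) s]
        src_p[OF g] tgt_p[OF g])
qed

lemma double_action_one:
  assumes g: "g \<in> Arr"
  shows "double_action G \<Psi> (\<one>\<^bsub>H\<^esub>, \<one>\<^bsub>H\<^esub>) g = g"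
  using mul_idn_left[OF g] mul_idn_right[OF g]
  by (simp add: double_action_def Psi_one[OF tgt_in[OF g]] Psi_one[OF src_in[OF g]] ginv_idn[OF src_in[OF g]])

lemma same_orbit:
  assumes g: "g \<in> Arr" "g' \<in> Arr" and eq: "p g' = p g"
  obtains h1 h2 where "h1 \<in> carrier H" "h2 \<in> carrier H" "g' = double_action G \<Psi> (h1, h2) g"
proof -
  have "double_action G \<Psi> (\<one>\<^bsub>H\<^esub>, \<one>\<^bsub>H\<^esub>) g' \<in> p g'"
    unfolding orbit_map_def by (rule imageI) (simp add: one_in)
  then have "g' \<in> p g" by (simp add: double_action_one[OF g(2)] eq)
  then show ?thesis unfolding orbit_map_def using that by auto
qed

lemma dP_dPsi:
  assumes x: "x \<in> Obj"
  shows "dP (idn G x) (dPsi x u) = 0"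
  by (rule mderiv_germ_unique[OF Psi_one_deriv[OF x p_deriv[OF idn_in[OF x]]]
        mderiv_const[OF charted_group quo.charted_arr one_point quo.idn_in[OF q_in[OF x]]]
        openin_topspace one_point])
    (simp add: points_group p_Psi x)

text \<open>The right translate of \<open>dPsi\<close> to an arrow \<open>g\<close> is tangent to the orbit of \<open>g\<close>.\<close>

lemma dP_right_translate:
  assumes g: "g \<in> Arr"
  shows "dP g (dM (idn G (tgt G g)) g (dPsi (tgt G g) u, 0)) = 0"
proof -
  let ?x = "tgt G g"
  note x = tgt_in[OF g]
  have comp: "(\<Psi> (h, ?x), g) \<in> composable G" if "h \<in> points (mfd H)" for h
    using that double_action_composable1[OF g _ one_in] by (simp add: points_group)
  have m: "has_mderiv (mfd H) (arr G) (\<lambda>h. mul G (\<Psi> (h, ?x)) g) \<one>\<^bsub>H\<^esub> (\<lambda>u. dM (idn G ?x) g (dPsi ?x u, 0))"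
    using mul_has_mderiv[OF Psi_deriv[OF x] mderiv_const[OF charted_group charted_arr one_point g]
        openin_topspace one_point comp]
    by (simp add: Psi_one[OF x])
  have p: "has_mderiv (arr G) (arr Q) p (mul G (\<Psi> (\<one>\<^bsub>H\<^esub>, ?x)) g) (dP g)"
    by (simp add: Psi_one[OF x] mul_idn_left[OF g] p_deriv[OF g])
  have "p (mul G (\<Psi> (h, ?x)) g) = p g" if "h \<in> points (mfd H)" for h
    using quo.mul_idn_left[OF p_in[OF g]] that
    by (simp add: p_mul[OF comp[OF that]] p_Psi[OF _ x] tgt_p[OF g] points_group)
  then show ?thesis
    by (rule mderiv_germ_unique[OF mderiv_compose[OF m p]
          mderiv_const[OF charted_group quo.charted_arr one_point p_in[OF g]] openin_topspace one_point])
qed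

text \<open>A vector tangent to a fibre of \<open>p\<close> is the velocity of a curve in the fibre, which has the form
  \<open>h\<^sub>1 \<cdot> g \<cdot> h\<^sub>2\<^sup>-\<^sup>1\<close>. The local trivializations of the bundle at the target and source recover \<open>h\<^sub>1\<close>
  and \<open>h\<^sub>2\<close> differentiably from the curve. So the vector is a sum of translates of vectors
  \<open>dPsi x u\<close>, and these are in the kernel of \<open>\<omega>\<close> by multiplicativity.\<close>

lemma orbit_directions_in_kernel:
  assumes g: "g \<in> Arr" and u: "dP g u = 0"
  shows "\<omega> g u w = 0"
proof -
  let ?A = "arr G" and ?x = "tgt G g" and ?y = "src G g"
  note x = tgt_in[OF g] and y = src_in[OF g]
  obtain c D V where cg: "c g = g" and c: "has_mderiv ?A ?A c g D" "\<And>u. dP g u = 0 \<Longrightarrow> D u = u"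
    and V: "openin (mtop ?A) V" "g \<in> V" "\<And>k. k \<in> V \<Longrightarrow> c k \<in> points ?A \<and> p (c k) = p g"
    by (rule submersion_map_into_fibre[OF charted_arr quo.arr_manifold p_submersion g]) (rule that)
  obtain k1 K1 where k1: "has_mderiv (obj G) (mfd H) k1 ?x K1" "\<And>a. a \<in> carrier H \<Longrightarrow> k1 (act a ?x) = a"
    using orbit_coordinate[OF x] by metis
  obtain k2 K2 where k2: "has_mderiv (obj G) (mfd H) k2 ?y K2" "\<And>a. a \<in> carrier H \<Longrightarrow> k2 (act a ?y) = a"
    using orbit_coordinate[OF y] by metis
  define h1 where "h1 = (\<lambda>k. k1 (tgt G (c k)))"
  define h2 where "h2 = (\<lambda>k. k2 (src G (c k)))"
  have h1g: "h1 g = \<one>\<^bsub>H\<^esub>" and h2g: "h2 g = \<one>\<^bsub>H\<^esub>"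
    using k1(2)[OF one_in] k2(2)[OF one_in] by (simp_all add: h1_def h2_def cg act_one x y)
  define E1 where "E1 = (\<lambda>v. K1 (dT g (D v)))"
  define E2 where "E2 = (\<lambda>v. K2 (dS g (D v)))"
  have t: "has_mderiv ?A (obj G) (tgt G) (c g) (dT g)" "has_mderiv (obj G) (mfd H) k1 (tgt G (c g)) K1"
    and s: "has_mderiv ?A (obj G) (src G) (c g) (dS g)" "has_mderiv (obj G) (mfd H) k2 (src G (c g)) K2"
    by (simp_all add: cg tgt_deriv src_deriv g k1(1) k2(1))
  have E1: "has_mderiv ?A (mfd H) h1 g E1" and E2: "has_mderiv ?A (mfd H) h2 g E2"
    unfolding h1_def h2_def E1_def E2_def
    by (rule mderiv_compose[OF mderiv_compose[OF c(1) t(1)] t(2)],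
        rule mderiv_compose[OF mderiv_compose[OF c(1) s(1)] s(2)])
  \<comment> \<open>Near \<open>g\<close>, the coordinates on the orbits of target and source recover the group elements that
    move \<open>g\<close> to \<open>c k\<close>.\<close>
  have hV: "h1 k \<in> carrier H \<and> h2 k \<in> carrier H \<and> double_action G \<Psi> (h1 k, h2 k) g = c k"
    if k: "k \<in> V" for k
  proof -
    have ck: "c k \<in> points ?A" "p (c k) = p g" using V(3)[OF k] by auto
    obtain a b where ab: "a \<in> carrier H" "b \<in> carrier H" "c k = double_action G \<Psi> (a, b) g"
      by (rule same_orbit[OF g ck]) (rule that)
    have "h1 k = a" "h2 k = b"
      using k1(2)[OF ab(1)] k2(2)[OF ab(2)]
      by (simp_all add: h1_def h2_def ab(3) double_action_closed(2,3)[OF g ab(1,2)])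
    then show ?thesis using ab by simp
  qed
  define a where "a = dPsi ?x (E1 u)"
  define b where "b = dPsi ?y (E2 u)"
  have f1: "has_mderiv ?A ?A (\<lambda>k. \<Psi> (h1 k, ?x)) g (\<lambda>v. dPsi ?x (E1 v))"
    by (rule mderiv_compose[OF E1]) (simp add: h1g Psi_deriv[OF x])
  have "has_mderiv ?A ?A (\<lambda>k. \<Psi> (h2 k, ?y)) g (\<lambda>v. dPsi ?y (E2 v))"
    by (rule mderiv_compose[OF E2]) (simp add: h2g Psi_deriv[OF y])
  then have f2: "has_mderiv ?A ?A (\<lambda>k. ginv G (\<Psi> (h2 k, ?y))) g (\<lambda>v. dV (idn G ?y) (dPsi ?y (E2 v)))"
    by (rule mderiv_compose) (simp add: h2g Psi_one[OF y] ginv_deriv[OF idn_in[OF y]])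
  have comp1: "(\<Psi> (h1 k, ?x), g) \<in> composable G"
    and comp2: "(mul G (\<Psi> (h1 k, ?x)) g, ginv G (\<Psi> (h2 k, ?y))) \<in> composable G" if "k \<in> V" for k
    using double_action_composable1[OF g] double_action_composable2[OF g] hV[OF that] by blast+
  have m1: "has_mderiv ?A ?A (\<lambda>k. mul G (\<Psi> (h1 k, ?x)) g) g (\<lambda>v. dM (idn G ?x) g (dPsi ?x (E1 v), 0))"
    using mul_has_mderiv[OF f1 mderiv_const[OF charted_arr charted_arr g g] V(1,2) comp1]
    by (simp add: h1g Psi_one[OF x])
  note i2 = h1g h2g Psi_one[OF x] Psi_one[OF y] ginv_idn[OF y] mul_idn_left[OF g]
  have m2: "has_mderiv ?A ?A (\<lambda>k. mul G (mul G (\<Psi> (h1 k, ?x)) g) (ginv G (\<Psi> (h2 k, ?y)))) g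
      (\<lambda>v. dM g (idn G ?y) (dM (idn G ?x) g (dPsi ?x (E1 v), 0), dV (idn G ?y) (dPsi ?y (E2 v))))"
    using mul_has_mderiv[OF m1 f2 V(1,2) comp2] by (simp add: i2)
  have compat: "dS g (dM (idn G ?x) g (a, 0)) = dT (idn G ?y) (dV (idn G ?y) b)"
    using mul_deriv_compatible[OF m1 f2 V(1,2) comp2, of u] by (simp add: i2 a_def b_def)
  have "D u = dM g (idn G ?y) (dM (idn G ?x) g (dPsi ?x (E1 u), 0), dV (idn G ?y) (dPsi ?y (E2 u)))"
    by (rule mderiv_germ_unique[OF c(1) m2 V(1,2)]) (use hV in \<open>simp add: double_action_def\<close>)
  then have u_eq: "u = dM g (idn G ?y) (dM (idn G ?x) g (a, 0), dV (idn G ?y) b)"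
    by (simp add: c(2)[OF u] a_def b_def)
  have "dS g w = dT (idn G ?y) (dI ?y (dS g w))" by (simp add: dT_dI[OF y])
  from multD[OF composable_idn_right[OF g] compat this]
  have "\<omega> g u w = \<omega> g (dM (idn G ?x) g (a, 0)) w + \<omega> (idn G ?y) (dV (idn G ?y) b) (dI ?y (dS g w))"
    by (simp add: mul_idn_right[OF g] dM_idn_right[OF g] flip: u_eq)
  also have "\<dots> = 0"
    using dPsi_algebroid[OF x] unfolding a_def b_def
    by (simp add: right_translate_form[OF g] ginv_form[OF y] mu_dPsi[OF x] mu_dPsi[OF y])
  finally show ?thesis .
qed

lemma double_action_deriv:
  assumes g: "g \<in> Arr" and h: "h1 \<in> carrier H" "h2 \<in> carrier H"
  shows "has_mderiv (arr G) (arr G) (double_action G \<Psi> (h1, h2)) g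
    (mdiff (arr G) (arr G) (double_action G \<Psi> (h1, h2)) g)"
proof -
  let ?A = "arr G"
  have Psi: "\<exists>D. has_mderiv (obj G) ?A (\<lambda>x. \<Psi> (h, x)) x D" if "h \<in> carrier H" "x \<in> Obj" for h x
  proof -
    have hx: "(h, x) \<in> points (prod_manifold (mfd H) (obj G))" "h \<in> points (mfd H)"
      using that by (simp_all add: points_group)
    note 1 = smooth_map_has_mderiv[OF charted_prod[OF charted_group charted_total] charted_arr Psi_smooth hx(1)]
    note 2 = mderiv_Pair[OF mderiv_const[OF charted_total charted_group that(2) hx(2)]
        mderiv_ident[OF charted_total that(2)]]
    show ?thesis by (rule exI) (rule mderiv_compose[OF 2 1])
  qed
  obtain D1 where D1: "has_mderiv (obj G) ?A (\<lambda>x. \<Psi> (h1, x)) (tgt G g) D1"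
    using Psi[OF h(1) tgt_in[OF g]] ..
  obtain D2 where D2: "has_mderiv (obj G) ?A (\<lambda>x. \<Psi> (h2, x)) (src G g) D2"
    using Psi[OF h(2) src_in[OF g]] ..
  note f2 = mderiv_compose[OF mderiv_compose[OF src_deriv[OF g] D2]
      ginv_deriv[OF Psi_in[OF h(2) src_in[OF g]]]]
  note m1 = mul_has_mderiv[OF mderiv_compose[OF tgt_deriv[OF g] D1] mderiv_ident[OF charted_arr g]
      openin_topspace g double_action_composable1[OF _ h]]
  note m2 = mul_has_mderiv[OF m1 f2 openin_topspace g double_action_composable2[OF _ h]]
  have e: "(\<lambda>k. mul G (mul G (\<Psi> (h1, tgt G k)) k) (ginv G (\<Psi> (h2, src G k)))) = double_action G \<Psi> (h1, h2)"
    by (simp add: double_action_def fun_eq_iff)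
  note d = m2[unfolded e]
  show ?thesis using mderiv_mdiff[OF d] d by simp
qed

text \<open>Invariance of \<open>\<omega>\<close> transports the values at \<open>g\<close> to the point \<open>g'\<close> of the same orbit. There, two
  lifts of the same vector differ by an element of \<open>ker dp\<close>.\<close>

lemma form_descends:
  assumes g: "g \<in> Arr" "g' \<in> Arr" "p g' = p g"
    and u: "dP g' u' = dP g u" and v: "dP g' v' = dP g v"
  shows "\<omega> g' u' v' = \<omega> g u v"
proof -
  obtain h1 h2 where h: "h1 \<in> carrier H" "h2 \<in> carrier H" "g' = double_action G \<Psi> (h1, h2) g"
    by (rule same_orbit[OF g]) (rule that)
  let ?L = "double_action G \<Psi> (h1, h2)"
  let ?D = "mdiff (arr G) (arr G) ?L g"
  have "pullback_form (arr G) (arr G) ?L \<omega> = \<omega>"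
    using admissible h(1,2) unfolding H_admissible_def by blast
  then have "\<omega> g u v = pullback_form (arr G) (arr G) ?L \<omega> g u v" by simp
  then have inv: "\<omega> g u v = \<omega> g' (?D u) (?D v)"
    using g(1) h(3) by (simp add: pullback_form_def)
  have pL: "has_mderiv (arr G) (arr Q) p (?L g) (dP g')" using p_deriv[OF g(2)] h(3) by simp
  have DP: "dP g' (?D w) = dP g w" for w
    by (rule mderiv_germ_unique[OF mderiv_compose[OF double_action_deriv[OF g(1) h(1,2)] pL]
          p_deriv[OF g(1)] openin_topspace g(1) double_action_closed(4)[OF _ h(1,2)]])
  have ker: "\<omega> g' a c = \<omega> g' b c" if "dP g' a = dP g' b" for a b c
  proof -
    have "dP g' (a - b) = 0" using that by (simp add: linear_diff[OF linear_dP[OF g(2)]])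
    from orbit_directions_in_kernel[OF g(2) this, of c]
    show ?thesis by (simp add: bilinear_lsub[OF form_bilinear[OF g(2)]])
  qed
  have "\<omega> g' u' v' = \<omega> g' (?D u) v'" by (rule ker) (simp add: u DP)
  also have "\<dots> = - \<omega> g' v' (?D u)" by (rule form_anti[OF g(2)])
  also have "\<dots> = - \<omega> g' (?D v) (?D u)" by (subst ker[of v' "?D v"]) (simp_all add: v DP)
  also have "\<dots> = \<omega> g' (?D u) (?D v)" by (simp add: form_anti[OF g(2), of "?D v" "?D u"])
  finally show ?thesis by (simp add: inv)
qed

end

section \<open>The form on the quotient\<close>

lemma smooth_on_local:
  "(\<And>x. x \<in> S \<Longrightarrow> \<exists>T. open T \<and> x \<in> T \<and> smooth_on T f) \<Longrightarrow> smooth_on S f"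
  unfolding smooth_on_def by (intro allI C_k_on_local) blast

lemma bilinear_compose:
  assumes "bilinear B" "linear R"
  shows "bilinear (\<lambda>u v. B (R u) (R v))"
  using assms linear_compose[OF assms(2), unfolded o_def] unfolding bilinear_def by fast

lemma local_form_bilinear:
  assumes "smooth_manifold M" "c \<in> atlas M" "y \<in> snd c ` fst c" "bilinear (\<omega> (chart_inv c y))"
  shows "bilinear (local_form M \<omega> c y)"
  using bilinear_compose[OF assms(4) mderiv_linear[OF mderiv_chart_inv[OF assms(1-3)]]]
  unfolding local_form_def Let_def .

context admissible_quotient
begin

text \<open>A local section \<open>s\<close> of \<open>p\<close> exhibits the local expression of \<open>\<beta>\<close> as the pullback of the local
  expression of \<open>\<omega>\<close>.\<close>

lemma descended_form_in_charts:
  assumes \<beta>: "\<And>g u v. g \<in> Arr \<Longrightarrow> \<beta> (p g) (dP g u) (dP g v) = \<omega> g u v"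
    and g: "g \<in> Arr" and d: "d \<in> atlas (arr Q)" "p g \<in> fst d"
  obtains Y s where "open Y" "snd d (p g) \<in> Y" "smooth_on Y s"
    "s ` Y \<subseteq> snd (chart_at (arr G) g) ` fst (chart_at (arr G) g)"
    "s (snd d (p g)) = snd (chart_at (arr G) g) g"
    "\<And>y b c. y \<in> Y \<Longrightarrow> local_form (arr Q) \<beta> d y b c =
      local_form (arr G) \<omega> (chart_at (arr G) g) (s y)
        (frechet_derivative s (at y) b) (frechet_derivative s (at y) c)"
proof -
  let ?c = "chart_at (arr G) g"
  have c: "?c \<in> atlas (arr G)" "is_chart (arr G) ?c" "g \<in> fst ?c"
    using charted_arr g unfolding charted_def by blast+
  obtain Y s where Y: "open Y" "snd d (p g) \<in> Y" "Y \<subseteq> snd d ` fst d" "smooth_on Y s"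
    "s ` Y \<subseteq> snd ?c ` fst ?c" "s (snd d (p g)) = snd ?c g"
    "\<And>y. y \<in> Y \<Longrightarrow> p (chart_inv ?c (s y)) = chart_inv d y"
    by (rule submersion_section_in_charts[OF charted_arr quo.arr_manifold p_submersion g d]) (rule that)
  have "local_form (arr Q) \<beta> d y b z = local_form (arr G) \<omega> ?c (s y)
        (frechet_derivative s (at y) b) (frechet_derivative s (at y) z)" if y: "y \<in> Y" for y b z
  proof -
    let ?k = "chart_inv ?c (s y)" and ?x = "chart_inv d y" and ?s = "frechet_derivative s (at y)"
    let ?C = "coord_change ?c (chart_at (arr G) ?k) ?k" and ?D = "coord_change d (chart_at (arr Q) ?x) ?x"
    have sy: "s y \<in> snd ?c ` fst ?c" using Y(5) y by blast
    have k: "?k \<in> Arr"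
      using chart_inv_in[OF sy] chart_subset_points[OF c(2)] by blast
    have "has_mderiv model_manifold model_manifold s y ?s"
      by (rule mderiv_model[OF smooth_on_has_derivative[OF Y(4) y]])
    note 1 = mderiv_compose[OF this mderiv_chart_inv[OF arr_manifold c(1) sy]]
    have "y \<in> snd d ` fst d" using Y(3) y by blast
    note 2 = mderiv_chart_inv[OF quo.arr_manifold d(1) this]
    have D: "?D v = dP ?k (?C (?s v))" for v
      by (rule mderiv_germ_unique[OF 2 mderiv_compose[OF 1 p_deriv[OF k]] _ y])
        (use Y(1,7) in simp_all)
    have "local_form (arr Q) \<beta> d y b z = \<beta> ?x (?D b) (?D z)" by (simp add: local_form_def Let_def)
    also have "\<dots> = \<beta> (p ?k) (dP ?k (?C (?s b))) (dP ?k (?C (?s z)))"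
      by (simp only: D Y(7)[OF y])
    also have "\<dots> = local_form (arr G) \<omega> ?c (s y) (?s b) (?s z)"
      unfolding \<beta>[OF k] by (simp add: local_form_def Let_def)
    finally show ?thesis .
  qed
  then show ?thesis using that[OF Y(1,2,4,5,6)] by blast
qed

text \<open>The value of \<open>\<omega>\<close> at arbitrary lifts of the point and the two vectors. The value 0 elsewhere follows
  the convention for forms outside the set of points.\<close>

definition quotient_form :: "'g set \<Rightarrow> 'eq \<Rightarrow> 'eq \<Rightarrow> real" where
  "quotient_form k b c = (if k \<in> quo.Arr then
     SOME r. \<exists>g u v. g \<in> Arr \<and> p g = k \<and> dP g u = b \<and> dP g v = c \<and> r = \<omega> g u v
   else 0)"

lemma quotient_form_eq:
  assumes g: "g \<in> Arr"
  shows "quotient_form (p g) (dP g u) (dP g v) = \<omega> g u v"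
proof -
  have "(SOME r. \<exists>g' u' v'. g' \<in> Arr \<and> p g' = p g \<and> dP g' u' = dP g u \<and> dP g' v' = dP g v \<and>
      r = \<omega> g' u' v') = \<omega> g u v"
  proof (rule some_equality)
    show "\<exists>g' u' v'. g' \<in> Arr \<and> p g' = p g \<and> dP g' u' = dP g u \<and> dP g' v' = dP g v \<and>
        \<omega> g u v = \<omega> g' u' v'"
      by (intro exI conjI) (rule g refl)+
    fix r
    assume "\<exists>g' u' v'. g' \<in> Arr \<and> p g' = p g \<and> dP g' u' = dP g u \<and> dP g' v' = dP g v \<and>
        r = \<omega> g' u' v'"
    then obtain g' u' v' where g': "g' \<in> Arr" "p g' = p g" "dP g' u' = dP g u" "dP g' v' = dP g v"
      and r: "r = \<omega> g' u' v'" by (elim exE conjE) (rule that)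
    show "r = \<omega> g u v" unfolding r by (rule form_descends[OF g g'])
  qed
  then show ?thesis unfolding quotient_form_def if_P[OF p_in[OF g]] .
qed

lemma local_form_smooth:
  "c \<in> atlas (arr G) \<Longrightarrow> smooth_on (snd c ` fst c) (\<lambda>y. local_form (arr G) \<omega> c y u v)"
  using form unfolding two_form_def by blast

lemma local_form_bilinear_arr:
  assumes c: "c \<in> atlas (arr G)" "y \<in> snd c ` fst c"
  shows "bilinear (local_form (arr G) \<omega> c y)"
  using chart_inv_in[OF c(2)] chart_subset_points[OF smooth_manifold_chart[OF arr_manifold c(1)]]
  by (intro local_form_bilinear[OF arr_manifold c] form_bilinear) blast

lemma quotient_form_two_form: "two_form (arr Q) quotient_form"
  unfolding two_form_def
proof (intro conjI ballI allI impI)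
  fix k assume "k \<in> quo.Arr"
  then obtain g where g: "g \<in> Arr" "p g = k" by (rule p_lift)
  obtain R where R: "linear R" "dP g \<circ> R = id"
    using linear_surjective_right_inverse[OF linear_dP[OF g(1)]] p_submersion g(1)
    unfolding submersion_def by blast
  have PR: "dP g (R b) = b" for b using R(2) by (simp add: fun_eq_iff)
  have e: "quotient_form k b c = \<omega> g (R b) (R c)" for b c
    using quotient_form_eq[OF g(1), of "R b" "R c"] by (simp only: PR g(2))
  show "bilinear (quotient_form k)"
    using bilinear_compose[OF form_bilinear[OF g(1)] R(1)] unfolding e[abs_def] .
  show "quotient_form k v v = 0" for v unfolding e by (rule form_alt[OF g(1)])
next
  show "quotient_form k u v = 0" if "k \<notin> quo.Arr" for k u v
    using that by (simp add: quotient_form_def)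
next
  fix d u v assume d: "d \<in> atlas (arr Q)"
  show "smooth_on (snd d ` fst d) (\<lambda>y. local_form (arr Q) quotient_form d y u v)"
  proof (rule smooth_on_local)
    fix y0 assume "y0 \<in> snd d ` fst d"
    then obtain k where k: "k \<in> fst d" "y0 = snd d k" by blast
    have "k \<in> quo.Arr"
      using k(1) chart_subset_points[OF smooth_manifold_chart[OF quo.arr_manifold d]] by blast
    then obtain g where g: "g \<in> Arr" "p g = k" by (rule p_lift)
    have kd: "p g \<in> fst d" using g(2) k(1) by simp
    let ?c = "chart_at (arr G) g"
    have c: "?c \<in> atlas (arr G)" "is_chart (arr G) ?c" using charted_arr g(1) unfolding charted_def by blast+
    obtain Y s where Y: "open Y" "snd d (p g) \<in> Y" "smooth_on Y s" "s ` Y \<subseteq> snd ?c ` fst ?c"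
      "s (snd d (p g)) = snd ?c g"
      "\<And>y b z. y \<in> Y \<Longrightarrow> local_form (arr Q) quotient_form d y b z = local_form (arr G) \<omega> ?c (s y)
        (frechet_derivative s (at y) b) (frechet_derivative s (at y) z)"
      by (rule descended_form_in_charts[OF quotient_form_eq g(1) d kd]) (assumption, rule that)
    have X: "open (snd ?c ` fst ?c)" using c(2) by (simp add: is_chart_def)
    have "smooth_on Y (\<lambda>y. local_form (arr G) \<omega> ?c (s y)
        (frechet_derivative s (at y) u) (frechet_derivative s (at y) v))"
      by (rule smooth_on_pullback[OF X Y(1,3,4) local_form_bilinear_arr[OF c(1)] local_form_smooth[OF c(1)]])
    then have "smooth_on Y (\<lambda>y. local_form (arr Q) quotient_form d y u v)"
      by (rule smooth_on_cong[OF Y(1), THEN iffD1, rotated]) (rule Y(6)[symmetric])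
    then show "\<exists>T. open T \<and> y0 \<in> T \<and> smooth_on T (\<lambda>y. local_form (arr Q) quotient_form d y u v)"
      using Y(1,2) g(2) k(2) by blast
  qed
qed

lemma quotient_form_closed: "closed_form (arr Q) quotient_form"
  unfolding closed_form_def
proof (intro ballI allI)
  fix k u v w assume k: "k \<in> quo.Arr"
  then obtain g where g: "g \<in> Arr" "p g = k" by (rule p_lift)
  let ?c = "chart_at (arr G) g" and ?d = "chart_at (arr Q) k"
  have c: "?c \<in> atlas (arr G)" "is_chart (arr G) ?c" using charted_arr g(1) unfolding charted_def by blast+
  have d: "?d \<in> atlas (arr Q)" "p g \<in> fst ?d" using quo.charted_arr k g(2) unfolding charted_def by blast+
  obtain Y s where Y: "open Y" "snd ?d (p g) \<in> Y" "smooth_on Y s" "s ` Y \<subseteq> snd ?c ` fst ?c"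
    "s (snd ?d (p g)) = snd ?c g"
    "\<And>y b z. y \<in> Y \<Longrightarrow> local_form (arr Q) quotient_form ?d y b z = local_form (arr G) \<omega> ?c (s y)
      (frechet_derivative s (at y) b) (frechet_derivative s (at y) z)"
    by (rule descended_form_in_charts[OF quotient_form_eq g(1) d]) (assumption, rule that)
  let ?\<Omega> = "local_form (arr G) \<omega> ?c"
  have X: "open (snd ?c ` fst ?c)" using c(2) by (simp add: is_chart_def)
  have alt: "?\<Omega> x a a = 0" if "x \<in> snd ?c ` fst ?c" for x a
    unfolding local_form_def Let_def
    using chart_inv_in[OF that] chart_subset_points[OF c(2)] form_alt by blast
  let ?F = "\<lambda>b z y. ?\<Omega> (s y) (frechet_derivative s (at y) b) (frechet_derivative s (at y) z)"
  have sm: "smooth_on Y (?F b z)" for b z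
    by (rule smooth_on_pullback[OF X Y(1,3,4) local_form_bilinear_arr[OF c(1)] local_form_smooth[OF c(1)]])
  have eq: "frechet_derivative (\<lambda>y. local_form (arr Q) quotient_form ?d y b z) (at (snd ?d k)) =
      frechet_derivative (?F b z) (at (snd ?d (p g)))" for b z
  proof -
    have "((\<lambda>y. local_form (arr Q) quotient_form ?d y b z) has_derivative
        frechet_derivative (?F b z) (at (snd ?d (p g)))) (at (snd ?d (p g)))"
      by (rule has_derivative_transform_within_open[OF smooth_on_has_derivative[OF sm Y(2)] Y(1,2)])
        (rule Y(6)[symmetric])
    from frechet_derivative_at[OF this] show ?thesis by (simp only: g(2))
  qed
  have clos: "ext_deriv (arr G) \<omega> g a b z = 0" for a b z
    using closed g(1) unfolding closed_form_def by blast
  note cp = closed_pullback[OF X Y(1,2,3,4) local_form_bilinear_arr[OF c(1)] alt local_form_smooth[OF c(1)] refl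
      _ refl, unfolded Y(5), OF _ _ clos[unfolded ext_deriv_def Let_def]]
  show "ext_deriv (arr Q) quotient_form k u v w = 0"
    unfolding ext_deriv_def Let_def eq by (rule cp)
qed

lemma pullback_iff:
  "pullback_form (arr G) (arr Q) p \<beta> = \<omega> \<longleftrightarrow>
    (\<forall>g\<in>Arr. \<forall>u v. \<beta> (p g) (dP g u) (dP g v) = \<omega> g u v)"
proof
  assume eq: "pullback_form (arr G) (arr Q) p \<beta> = \<omega>"
  have "\<omega> g u v = pullback_form (arr G) (arr Q) p \<beta> g u v" for g u v by (simp only: eq)
  then show "\<forall>g\<in>Arr. \<forall>u v. \<beta> (p g) (dP g u) (dP g v) = \<omega> g u v"
    by (simp add: pullback_form_def)
next
  assume eq: "\<forall>g\<in>Arr. \<forall>u v. \<beta> (p g) (dP g u) (dP g v) = \<omega> g u v"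
  have "\<omega> g u v = 0" if "g \<notin> Arr" for g u v
    using form that unfolding two_form_def by blast
  with eq show "pullback_form (arr G) (arr Q) p \<beta> = \<omega>"
    by (simp add: pullback_form_def fun_eq_iff)
qed

lemma pullback_unique:
  assumes two: "two_form (arr Q) \<beta>" "two_form (arr Q) \<beta>'"
    and pull: "pullback_form (arr G) (arr Q) p \<beta> = \<omega>" "pullback_form (arr G) (arr Q) p \<beta>' = \<omega>"
  shows "\<beta> = \<beta>'"
proof (intro ext)
  fix k b c
  show "\<beta> k b c = \<beta>' k b c"
  proof (cases "k \<in> quo.Arr")
    case True
    then obtain g where g: "g \<in> Arr" "p g = k" by (rule p_lift)
    obtain u where u: "dP g u = b" by (rule dP_lift[OF g(1)])
    obtain v where v: "dP g v = c" by (rule dP_lift[OF g(1)])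
    have "\<beta> (p g) (dP g u) (dP g v) = \<beta>' (p g) (dP g u) (dP g v)"
      using pull g(1) unfolding pullback_iff by metis
    then show ?thesis by (simp only: g(2) u v)
  next
    case False
    then show ?thesis using two unfolding two_form_def by metis
  qed
qed

end

section \<open>Poisson bivectors\<close>

text \<open>Antisymmetry makes \<open>P \<alpha>\<close> a linear functional on the dual space, so a vector with the defining property
  of \<open>sharp\<close> exists.\<close>

lemma sharp_eq:
  assumes P: "bivector P" and \<alpha>: "linear \<alpha>" and \<beta>: "linear \<beta>"
  shows "\<beta> (sharp P \<alpha>) = P \<alpha> \<beta>"
proof -
  have "P \<alpha> (\<lambda>v. a * \<beta> v + b * \<gamma> v) = a * P \<alpha> \<beta> + b * P \<alpha> \<gamma>"
    if "linear \<beta>" "linear \<gamma>" for \<beta> \<gamma> a b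
  proof -
    have l: "linear (\<lambda>v. a * \<beta> v + b * \<gamma> v)"
      using that by (intro linearI) (simp_all add: linear_add linear_scale algebra_simps)
    have anti: "P \<alpha> \<xi> = - P \<xi> \<alpha>" if "linear \<xi>" for \<xi>
      using P \<alpha> that unfolding bivector_def by blast
    have "P (\<lambda>v. a * \<beta> v + b * \<gamma> v) \<alpha> = a * P \<beta> \<alpha> + b * P \<gamma> \<alpha>"
      using P \<alpha> that unfolding bivector_def by blast
    then show ?thesis unfolding anti[OF l] anti[OF that(1)] anti[OF that(2)] by simp
  qed
  then obtain v where v: "\<forall>\<beta>. linear \<beta> \<longrightarrow> \<beta> v = P \<alpha> \<beta>" using reflexive_dual[of "P \<alpha>"] by blast
  have "sharp P \<alpha> = v" unfolding sharp_def
  proof (rule the_equality)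
    show "\<forall>\<beta>. linear \<beta> \<longrightarrow> \<beta> v = P \<alpha> \<beta>" by (rule v)
    fix v' assume v': "\<forall>\<beta>. linear \<beta> \<longrightarrow> \<beta> v' = P \<alpha> \<beta>"
    show "v' = v" by (rule linear_functionals_separate) (use v v' in metis)
  qed
  then show ?thesis using v \<beta> by simp
qed

lemma sharp_zero:
  assumes P: "bivector P"
  shows "sharp P (\<lambda>_. 0) = 0"
proof (rule linear_functionals_separate)
  fix \<beta> :: "'a \<Rightarrow> real" assume \<beta>: "linear \<beta>"
  have z: "linear (\<lambda>_ :: 'a. 0 :: real)" by (intro linearI) auto
  have "P (\<lambda>v. 0 * 0 + 0 * 0) \<beta> = 0 * P (\<lambda>_. 0) \<beta> + 0 * P (\<lambda>_. 0) \<beta>"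
    using P z \<beta> unfolding bivector_def by blast
  then have "P (\<lambda>_. 0) \<beta> = 0" by simp
  then show "\<beta> (sharp P (\<lambda>_. 0)) = \<beta> 0" by (simp add: sharp_eq[OF P z \<beta>] linear_0[OF \<beta>])
qed

section \<open>The quotient is a symplectic groupoid\<close>

locale descended_form = admissible_quotient H G Q act q \<omega> \<pi> \<Psi>
  for H :: "('h, 'eh::model_space) lie_grp"
    and G :: "('g, 'eg::model_space, 'm, 'em::model_space) groupoid"
    and Q :: "('g set, 'eq::model_space, 'n, 'en::model_space) groupoid"
    and act :: "'h \<Rightarrow> 'm \<Rightarrow> 'm"
    and q :: "'m \<Rightarrow> 'n"
    and \<omega> :: "'g \<Rightarrow> 'eg \<Rightarrow> 'eg \<Rightarrow> real"
    and \<pi> :: "'n \<Rightarrow> ('en \<Rightarrow> real) \<Rightarrow> ('en \<Rightarrow> real) \<Rightarrow> real"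
    and \<Psi> :: "'h \<times> 'm \<Rightarrow> 'g" +
  fixes \<beta> :: "'g set \<Rightarrow> 'eq \<Rightarrow> 'eq \<Rightarrow> real"
  assumes two_form: "two_form (arr Q) \<beta>"
    and pullback: "pullback_form (arr G) (arr Q) p \<beta> = \<omega>"
begin

lemma descends: "g \<in> Arr \<Longrightarrow> \<beta> (p g) (dP g u) (dP g v) = \<omega> g u v"
  using pullback unfolding pullback_iff by blast

text \<open>The source and target of arbitrary lifts lie in one fibre of \<open>q\<close>, and the action moves the second
  lift within its orbit until they agree.\<close>

lemma composable_lift:
  assumes ab: "(a, b) \<in> composable Q"
  obtains g h where "(g, h) \<in> composable G" "p g = a" "p h = b"
proof -
  note pts = quo.composableD[OF ab]
  obtain g where g: "g \<in> Arr" "p g = a" using pts by (blast elim: p_lift)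
  obtain k where k: "k \<in> Arr" "p k = b" using pts by (blast elim: p_lift)
  have "q (src G g) = q (tgt G k)"
    using pts src_p[OF g(1)] tgt_p[OF k(1)] by (simp add: g(2) k(2))
  then obtain h where h: "h \<in> carrier H" "act h (tgt G k) = src G g"
    by (rule fibres_are_orbits[OF tgt_in[OF k(1)] src_in[OF g(1)]]) (rule that)
  let ?k = "double_action G \<Psi> (h, \<one>\<^bsub>H\<^esub>) k"
  note d = double_action_closed[OF k(1) h(1) one_in]
  have "(g, ?k) \<in> composable G" by (rule composableI[OF g(1) d(1)]) (simp add: d(3) h(2))
  then show ?thesis by (rule that) (simp_all add: g(2) d(4) k(2))
qed

text \<open>For arbitrary lifts, the difference of \<open>ds(a)\<close> and \<open>dt(b)\<close> is vertical. Adding to \<open>b\<close> a vector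
  tangent to the orbit removes it.\<close>

lemma tangent_lift:
  assumes gh: "(g, h) \<in> composable G" and uv: "quo.dS (p g) u = quo.dT (p h) v"
  obtains a b where "dP g a = u" "dP h b = v" "dS g a = dT h b"
proof -
  note pts = composableD[OF gh]
  have g: "g \<in> Arr" and h: "h \<in> Arr" and st: "src G g = tgt G h" using pts by auto
  let ?x = "tgt G h"
  note x = tgt_in[OF h]
  obtain a where a: "dP g a = u" by (rule dP_lift[OF g])
  obtain b where b: "dP h b = v" by (rule dP_lift[OF h])
  have "dQ ?x (dS g a) = dQ ?x (dT h b)"
    using uv dS_dP[OF g, of a] dT_dP[OF h, of b] by (simp add: a b st)
  then have "dQ ?x (dS g a - dT h b) = 0" by (simp add: linear_diff[OF mderiv_linear[OF q_deriv[OF x]]])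
  then obtain w where w: "dT (idn G ?x) (dPsi ?x w) = dS g a - dT h b"
    by (rule vertical_lift[OF x]) (rule that)
  let ?c = "dM (idn G ?x) h (dPsi ?x w, 0)"
  have "dT h ?c = dT (idn G ?x) (dPsi ?x w)"
    using dT_dM(1)[OF composable_idn_left[OF h] algebroid_composable[OF h dPsi_algebroid[OF x]]]
    by (simp add: mul_idn_left[OF h])
  then have "dS g a = dT h (b + ?c)" by (simp add: linear_add[OF linear_dT[OF h]] w)
  moreover have "dP h (b + ?c) = v" by (simp add: linear_add[OF linear_dP[OF h]] dP_right_translate[OF h] b)
  ultimately show ?thesis using a by (intro that[of a "b + ?c"])
qed

lemma dP_dM:
  assumes gh: "(g, h) \<in> composable G" and uv: "dS g u = dT h v"
  shows "dP (mul G g h) (dM g h (u, v)) = quo.dM (p g) (p h) (dP g u, dP h v)"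
proof -
  let ?A = "arr G" and ?P = "prod_manifold (arr G) (arr G)"
  have g: "g \<in> points ?A" and h: "h \<in> points ?A" using composableD[OF gh] by auto
  obtain f D U where f: "has_mderiv ?P ?A f (g, h) D" "f (g, h) = g" "openin (mtop ?P) U" "(g, h) \<in> U"
    "\<And>k. k \<in> U \<Longrightarrow> (f k, snd k) \<in> composable G" "\<And>u v. dS g u = dT h v \<Longrightarrow> D (u, v) = u"
    by (rule composable_adjustment[OF gh]) (rule that)
  have s: "has_mderiv ?P ?A snd (g, h) snd" by (rule mderiv_snd[OF charted_arr g charted_arr h])
  have m: "has_mderiv ?P ?A (\<lambda>k. mul G (f k) (snd k)) (g, h) (\<lambda>w. dM g h (D w, snd w))"
    using mul_has_mderiv[OF f(1) s f(3,4,5)] by (simp add: f(2))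
  have p: "has_mderiv ?A (arr Q) p (mul G (f (g, h)) (snd (g, h))) (dP (mul G g h))"
    "has_mderiv ?A (arr Q) p (f (g, h)) (dP g)" "has_mderiv ?A (arr Q) p (snd (g, h)) (dP h)"
    by (simp_all add: f(2) p_deriv g h mul_closed(1)[OF gh])
  have comp: "(p (f k), p (snd k)) \<in> composable Q" if "k \<in> U" for k
    using composableD[OF f(5)[OF that]] p_in src_p tgt_p by (intro quo.composableI) auto
  have m': "has_mderiv ?P (arr Q) (\<lambda>k. mul Q (p (f k)) (p (snd k))) (g, h)
      (\<lambda>w. quo.dM (p g) (p h) (dP g (D w), dP h (snd w)))"
    using quo.mul_has_mderiv[OF mderiv_compose[OF f(1) p(2)] mderiv_compose[OF s p(3)] f(3,4) comp]
    by (simp add: f(2))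
  have "dP (mul G g h) (dM g h (D (u, v), snd (u, v))) =
      quo.dM (p g) (p h) (dP g (D (u, v)), dP h (snd (u, v)))"
    by (rule mderiv_germ_unique[OF mderiv_compose[OF m p(1)] m' f(3,4) p_mul[OF f(5)]])
  then show ?thesis by (simp add: f(6)[OF uv])
qed

lemma quotient_multiplicative: "multiplicative Q \<beta>"
proof -
  have main: "\<beta> (mul Q a b) (quo.dM a b (u, v)) (quo.dM a b (u', v')) = \<beta> a u u' + \<beta> b v v'"
    if ab: "(a, b) \<in> composable Q" and uv: "quo.dS a u = quo.dT b v" and uv': "quo.dS a u' = quo.dT b v'"
    for a b u v u' v'
  proof -
    obtain g h where gh: "(g, h) \<in> composable G" "p g = a" "p h = b" by (rule composable_lift[OF ab])
    have g: "g \<in> Arr" and h: "h \<in> Arr" using composableD[OF gh(1)] by auto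
    have "quo.dS (p g) u = quo.dT (p h) v" "quo.dS (p g) u' = quo.dT (p h) v'" using uv uv' gh by simp_all
    then obtain c d c' d' where cd: "dP g c = u" "dP h d = v" "dS g c = dT h d"
      and cd': "dP g c' = u'" "dP h d' = v'" "dS g c' = dT h d'"
      using tangent_lift[OF gh(1)] by metis
    have 1: "\<beta> (p (mul G g h)) (dP (mul G g h) (dM g h (c, d))) (dP (mul G g h) (dM g h (c', d'))) =
        \<omega> (mul G g h) (dM g h (c, d)) (dM g h (c', d'))"
      by (rule descends[OF mul_closed(1)[OF gh(1)]])
    have "\<beta> (mul Q a b) (quo.dM a b (u, v)) (quo.dM a b (u', v')) =
        \<omega> (mul G g h) (dM g h (c, d)) (dM g h (c', d'))"
      using 1 by (simp only: dP_dM[OF gh(1) cd(3)] dP_dM[OF gh(1) cd'(3)] cd cd' gh p_mul[OF gh(1)])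
    also have "\<dots> = \<omega> g c c' + \<omega> h d d'" by (rule multD[OF gh(1) cd(3) cd'(3)])
    also have "\<dots> = \<beta> a u u' + \<beta> b v v'"
      using descends[OF g, of c c'] descends[OF h, of d d'] by (simp only: cd cd' gh)
    finally show ?thesis .
  qed
  show ?thesis unfolding multiplicative_def Let_def using main by auto
qed

sublocale quo: multiplicative_form Q \<beta>
  by unfold_locales (rule two_form quotient_multiplicative)+

lemma base_lift:
  assumes "y \<in> quo.Obj" obtains x where "x \<in> Obj" "q x = y"
proof -
  obtain g where g: "g \<in> Arr" "p g = idn Q y" by (rule p_lift[OF quo.idn_in[OF assms]])
  have "q (src G g) = y" using src_p[OF g(1)] by (simp add: g(2) quo.src_idn[OF assms])
  then show ?thesis by (rule that[OF src_in[OF g(1)]])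
qed

lemma algebroid_descends:
  assumes x: "x \<in> Obj" and a: "a \<in> algebroid G x"
  shows "dP (idn G x) a \<in> algebroid Q (q x)"
    and "mu_map Q \<beta> (q x) (dP (idn G x) a) (dQ x v) = mu_map G \<omega> x a v"
    and "anchor Q (q x) (dP (idn G x) a) = dQ x (anchor G x a)"
proof -
  note i = idn_in[OF x]
  have "quo.dS (p (idn G x)) (dP (idn G x) a) = dQ x 0"
    using dS_dP[OF i, of a] a by (simp add: algebroid_def src_idn[OF x])
  then show "dP (idn G x) a \<in> algebroid Q (q x)"
    by (simp add: algebroid_def p_idn[OF x] linear_0[OF mderiv_linear[OF q_deriv[OF x]]])
  show "mu_map Q \<beta> (q x) (dP (idn G x) a) (dQ x v) = mu_map G \<omega> x a v"
    using descends[OF i, of a "dI x v"] by (simp add: mu_map_def p_idn[OF x] dP_dI[OF x])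
  show "anchor Q (q x) (dP (idn G x) a) = dQ x (anchor G x a)"
    using dT_dP[OF i, of a] by (simp add: anchor_def p_idn[OF x] tgt_idn[OF x])
qed

lemma poisson_bivector: "y \<in> quo.Obj \<Longrightarrow> bivector (\<pi> y)"
  using poisson unfolding poisson_structure_def bivector_field_def by blast

lemma dirac_iff:
  assumes x: "x \<in> Obj"
  shows "(\<exists>a\<in>algebroid G x. anchor G x a = X \<and> mu_map G \<omega> x a = \<alpha>) \<longleftrightarrow>
    (\<exists>\<gamma>. linear \<gamma> \<and> \<alpha> = \<gamma> \<circ> dQ x \<and> dQ x X = sharp (\<pi> (q x)) \<gamma>)"
proof -
  have "(x, X, \<alpha>) \<in> integrated_dirac G \<omega> \<longleftrightarrow> (\<exists>a\<in>algebroid G x. anchor G x a = X \<and> mu_map G \<omega> x a = \<alpha>)"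
    unfolding integrated_dirac_def delta_map_def using x by auto
  moreover have "(x, X, \<alpha>) \<in> dirac_pullback (obj G) (obj Q) q (poisson_graph (obj Q) \<pi>) \<longleftrightarrow>
      (\<exists>\<gamma>. linear \<gamma> \<and> \<alpha> = \<gamma> \<circ> dQ x \<and> dQ x X = sharp (\<pi> (q x)) \<gamma>)"
    unfolding dirac_pullback_def poisson_graph_def using x q_in[OF x] by auto
  ultimately show ?thesis unfolding dirac by blast
qed

text \<open>The vectors \<open>(X, \<gamma> \<circ> dq)\<close> with \<open>dq(X) = \<pi>\<^sup>\<sharp>(\<gamma>)\<close> belong to the Dirac structure, and so
  come from the algebroid of \<open>G\<close>.\<close>

lemma mu_surjective:
  assumes y: "y \<in> quo.Obj" and \<gamma>: "linear \<gamma>"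
  shows "\<exists>a\<in>algebroid Q y. mu_map Q \<beta> y a = \<gamma> \<and> anchor Q y a = sharp (\<pi> y) \<gamma>"
proof -
  obtain x where x: "x \<in> Obj" "q x = y" by (rule base_lift[OF y])
  obtain X where X: "dQ x X = sharp (\<pi> y) \<gamma>" by (rule dQ_lift[OF x(1)])
  have "\<exists>\<gamma>'. linear \<gamma>' \<and> \<gamma> \<circ> dQ x = \<gamma>' \<circ> dQ x \<and> dQ x X = sharp (\<pi> (q x)) \<gamma>'"
    using \<gamma> X x(2) by blast
  then obtain a where a: "a \<in> algebroid G x" "anchor G x a = X" "mu_map G \<omega> x a = \<gamma> \<circ> dQ x"
    unfolding dirac_iff[OF x(1), symmetric] by blast
  note d = algebroid_descends[OF x(1) a(1), unfolded x(2)]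
  have "mu_map Q \<beta> y (dP (idn G x) a) w = \<gamma> w" for w
  proof -
    obtain v where v: "dQ x v = w" by (rule dQ_lift[OF x(1)])
    show ?thesis using d(2)[of v] by (simp add: a(3) v)
  qed
  then have "mu_map Q \<beta> y (dP (idn G x) a) = \<gamma>" by (rule ext)
  moreover have "anchor Q y (dP (idn G x) a) = sharp (\<pi> y) \<gamma>" by (simp add: d(3) a(2) X)
  ultimately show ?thesis using d(1) by blast
qed

text \<open>An algebroid element of the quotient lifts to one of \<open>G\<close>, after a correction along \<open>\<Psi>\<close>. If
  \<open>\<mu>\<close> vanishes on it then the anchor of the lift is vertical, so the lift is \<open>dPsi x w\<close> by
  injectivity of \<open>\<delta>\<close>, and \<open>p\<close> collapses it.\<close>

lemma mu_injective:
  assumes y: "y \<in> quo.Obj" and b: "b \<in> algebroid Q y" and mu: "\<And>w. mu_map Q \<beta> y b w = 0"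
  shows "b = 0"
proof -
  obtain x where x: "x \<in> Obj" "q x = y" by (rule base_lift[OF y])
  note i = idn_in[OF x(1)]
  obtain c where c: "dP (idn G x) c = b" by (rule dP_lift[OF i])
  let ?X = "dS (idn G x) c"
  have "dQ x ?X = 0"
    using dS_dP[OF i, of c] b by (simp add: c algebroid_def p_idn[OF x(1)] x(2) src_idn[OF x(1)])
  then obtain w where w: "dT (idn G x) (dPsi x w) = ?X" by (rule vertical_lift[OF x(1)]) (rule that)
  define a where "a = c - dI x ?X"
  have "dS (idn G x) a = 0" by (simp add: a_def linear_diff[OF linear_dS[OF i]] dS_dI[OF x(1)])
  then have aA: "a \<in> algebroid G x" by (simp add: algebroid_def)
  have "dP (idn G x) (dI x ?X) = 0"
    by (simp add: dP_dI[OF x(1)] \<open>dQ x ?X = 0\<close> linear_0[OF quo.linear_dI[OF q_in[OF x(1)]]])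
  then have ab: "dP (idn G x) a = b" by (simp add: a_def linear_diff[OF linear_dP[OF i]] c)
  have "mu_map G \<omega> x a v = 0" for v
    using algebroid_descends(2)[OF x(1) aA, of v] by (simp add: ab x(2) mu)
  then have mu0: "mu_map G \<omega> x a = (\<lambda>_. 0)" by (rule ext)
  have "\<exists>\<gamma>. linear \<gamma> \<and> (\<lambda>_. 0) = \<gamma> \<circ> dQ x \<and> dQ x (anchor G x a) = sharp (\<pi> (q x)) \<gamma>"
    unfolding dirac_iff[OF x(1), symmetric] using aA mu0 by blast
  then obtain \<gamma> where \<gamma>: "(\<lambda>_. 0) = \<gamma> \<circ> dQ x" "dQ x (anchor G x a) = sharp (\<pi> y) \<gamma>"
    unfolding x(2) by blast
  have "\<gamma> w = 0" for w
  proof -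
    obtain v where v: "dQ x v = w" by (rule dQ_lift[OF x(1)])
    show ?thesis using fun_cong[OF \<gamma>(1), of v] by (simp add: v)
  qed
  then have "\<gamma> = (\<lambda>_. 0)" by (rule ext)
  then have "dQ x (anchor G x a) = 0" by (simp add: \<gamma>(2) sharp_zero[OF poisson_bivector[OF y]])
  then obtain w' where w': "dT (idn G x) (dPsi x w') = anchor G x a"
    by (rule vertical_lift[OF x(1)]) (rule that)
  have "delta_map G \<omega> x (dPsi x w') = delta_map G \<omega> x a"
    using w' by (simp add: delta_map_def mu0 mu_dPsi[OF x(1)] anchor_def)
  then have "dPsi x w' = a"
    by (rule inj_onD[OF delta_inj[OF x(1)] _ dPsi_algebroid[OF x(1)] aA])
  then show ?thesis using dP_dPsi[OF x(1), of w'] ab by simp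
qed

lemma quotient_nondegenerate:
  assumes k: "k \<in> quo.Arr" and u: "\<And>w. \<beta> k u w = 0"
  shows "u = 0"
proof (rule quo.nondegenerate[OF _ _ k u])
  show "a = 0" if "y \<in> quo.Obj" "a \<in> algebroid Q y" "\<And>v. mu_map Q \<beta> y a v = 0" for y a
    using mu_injective that by blast
  show "\<exists>a\<in>algebroid Q y. \<forall>v. mu_map Q \<beta> y a v = \<gamma> v" if "y \<in> quo.Obj" "linear \<gamma>" for y \<gamma>
    using mu_surjective[OF that] by metis
qed

text \<open>The Hamiltonian vector field of \<open>f \<circ> tgt\<close> is right invariant: it is the right translate of the
  algebroid element \<open>a\<close> with \<open>\<mu> a = df\<close>, which \<open>tgt\<close> maps to the anchor \<open>\<pi>\<^sup>\<sharp> (df)\<close>.\<close>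

lemma target_poisson_map: "poisson_map (arr Q) (symplectic_bivector \<beta>) (obj Q) \<pi> (tgt Q)"
  unfolding poisson_map_def
proof (intro conjI allI impI ballI)
  show "smooth_map (arr Q) (obj Q) (tgt Q)" using quo.tgt_submersion by (simp add: submersion_def)
  fix f h k
  assume f: "smooth_map (obj Q) real_line f" and h: "smooth_map (obj Q) real_line h"
    and k: "k \<in> quo.Arr"
  let ?y = "tgt Q k"
  note y = quo.tgt_in[OF k]
  let ?\<alpha> = "mdiff (obj Q) real_line f ?y" and ?\<gamma> = "mdiff (obj Q) real_line h ?y"
  note df = smooth_map_has_mderiv[OF quo.charted_obj charted_model f y]
    and dh = smooth_map_has_mderiv[OF quo.charted_obj charted_model h y]
  note lin = mderiv_linear[OF df] mderiv_linear[OF dh]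
  have chain: "mdiff (arr Q) real_line (f \<circ> tgt Q) k = (\<lambda>w. ?\<alpha> (quo.dT k w))"
    "mdiff (arr Q) real_line (h \<circ> tgt Q) k = (\<lambda>w. ?\<gamma> (quo.dT k w))"
    unfolding o_def
    by (rule mderiv_mdiff[OF mderiv_compose[OF quo.tgt_deriv[OF k] df]],
        rule mderiv_mdiff[OF mderiv_compose[OF quo.tgt_deriv[OF k] dh]])
  obtain a where a: "a \<in> algebroid Q ?y" "mu_map Q \<beta> ?y a = ?\<alpha>" "anchor Q ?y a = sharp (\<pi> ?y) ?\<alpha>"
    using mu_surjective[OF y lin(1)] by blast
  let ?X = "quo.dM (idn Q ?y) k (a, 0)"
  have X: "\<beta> k ?X w = ?\<alpha> (quo.dT k w)" for w
    using quo.right_translate_form[OF k a(1), of w] by (simp add: a(2))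
  have "(THE v. \<forall>w. \<beta> k v w = ?\<alpha> (quo.dT k w)) = ?X"
  proof (rule the_equality)
    show "\<forall>w. \<beta> k ?X w = ?\<alpha> (quo.dT k w)" using X by blast
    fix v assume v: "\<forall>w. \<beta> k v w = ?\<alpha> (quo.dT k w)"
    have "\<beta> k (v - ?X) w = 0" for w
      using v X by (simp add: bilinear_lsub[OF quo.form_bilinear[OF k]])
    then have "v - ?X = 0" by (rule quotient_nondegenerate[OF k])
    then show "v = ?X" by simp
  qed
  moreover have "quo.dT k ?X = sharp (\<pi> ?y) ?\<alpha>"
    using quo.dT_dM(1)[OF quo.composable_idn_left[OF k] quo.algebroid_composable[OF k a(1)]] a(3)
    by (simp add: quo.mul_idn_left[OF k] anchor_def)
  ultimately have "poisson_bracket (arr Q) (symplectic_bivector \<beta>) (f \<circ> tgt Q) (h \<circ> tgt Q) k =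
      ?\<gamma> (sharp (\<pi> ?y) ?\<alpha>)"
    by (simp add: poisson_bracket_def symplectic_bivector_def chain)
  also have "\<dots> = poisson_bracket (obj Q) \<pi> f h ?y"
    by (simp add: poisson_bracket_def sharp_eq[OF poisson_bivector[OF y] lin])
  finally show "poisson_bracket (arr Q) (symplectic_bivector \<beta>) (f \<circ> tgt Q) (h \<circ> tgt Q) k =
      poisson_bracket (obj Q) \<pi> f h (tgt Q k)" .
qed

end

theorem corollary4p9:
  fixes H :: "('h, 'eh::model_space) lie_grp"
    and M :: "('m, 'em::model_space) manifold"
    and N :: "('n, 'en::model_space) manifold"
    and act :: "'h \<Rightarrow> 'm \<Rightarrow> 'm"
    and q :: "'m \<Rightarrow> 'n"
    and \<pi> :: "'n \<Rightarrow> ('en \<Rightarrow> real) \<Rightarrow> ('en \<Rightarrow> real) \<Rightarrow> real"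
    and E :: "('m, 'em) gtangent set"
    and G :: "('g, 'eg::model_space, 'm, 'em) groupoid"
    and \<omega> :: "'g \<Rightarrow> 'eg \<Rightarrow> 'eg \<Rightarrow> real"
    and \<Psi> :: "'h \<times> 'm \<Rightarrow> 'g"
    and Q :: "('g set, 'eq::model_space, 'n, 'en) groupoid"
    and p :: "'g \<Rightarrow> 'g set"
  assumes principal: "principal_bundle H M N act q"
    and poisson: "poisson_structure N \<pi>"
    and E_eq: "E = dirac_pullback M N q (poisson_graph N \<pi>)"
    and presymplectic: "presymplectic_groupoid G \<omega>" "obj G = M"
    and integrates: "integrated_dirac G \<omega> = E"
    and admissible: "H_admissible H M act G \<omega> \<Psi>"
    and quotient: "quotient_groupoid H G \<Psi> N q Q"
    and p_eq: "p = orbit_map H G \<Psi>"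
  shows "(\<exists>!\<omega>Q. symplectic_form (arr Q) \<omega>Q \<and> pullback_form (arr G) (arr Q) p \<omega>Q = \<omega>) \<and>
    (\<forall>\<omega>Q. symplectic_form (arr Q) \<omega>Q \<and> pullback_form (arr G) (arr Q) p \<omega>Q = \<omega> \<longrightarrow>
      symplectic_groupoid_integrating Q \<omega>Q N \<pi>)"
proof -
  have M: "M = obj G" using presymplectic(2) by simp
  have N: "N = obj Q" using quotient unfolding quotient_groupoid_def by simp
  interpret admissible_quotient H G Q act q \<omega> \<pi> \<Psi>
    using principal poisson presymplectic(1) integrates admissible quotient
    unfolding M N E_eq presymplectic_groupoid_def quotient_groupoid_def
    by unfold_locales (auto simp: quotient_groupoid_def)
  have descended: "descended_form H G Q act q \<omega> \<pi> \<Psi> \<beta>"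
    if "two_form (arr Q) \<beta>" "pullback_form (arr G) (arr Q) p \<beta> = \<omega>" for \<beta>
    by unfold_locales (use that p_eq in simp_all)
  have pull: "pullback_form (arr G) (arr Q) p quotient_form = \<omega>"
    unfolding p_eq pullback_iff using quotient_form_eq by blast
  have symp: "symplectic_form (arr Q) quotient_form"
    unfolding symplectic_form_def
    using quotient_form_two_form quotient_form_closed
      descended_form.quotient_nondegenerate[OF descended[OF quotient_form_two_form pull]] by blast
  have "\<exists>!\<omega>Q. symplectic_form (arr Q) \<omega>Q \<and> pullback_form (arr G) (arr Q) p \<omega>Q = \<omega>"
  proof (rule ex1I[of _ quotient_form])
    fix \<beta> assume "symplectic_form (arr Q) \<beta> \<and> pullback_form (arr G) (arr Q) p \<beta> = \<omega>"
    then have "two_form (arr Q) \<beta>" "pullback_form (arr G) (arr Q) p \<beta> = \<omega>"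
      by (simp_all add: symplectic_form_def)
    then show "\<beta> = quotient_form"
      using pullback_unique[OF _ quotient_form_two_form] pull unfolding p_eq by simp
  qed (use symp pull in simp)
  moreover have "symplectic_groupoid_integrating Q \<beta> N \<pi>"
    if \<beta>: "symplectic_form (arr Q) \<beta>" "pullback_form (arr G) (arr Q) p \<beta> = \<omega>" for \<beta>
  proof -
    have "two_form (arr Q) \<beta>" using \<beta>(1) by (simp add: symplectic_form_def)
    then interpret D: descended_form H G Q act q \<omega> \<pi> \<Psi> \<beta> by (rule descended[OF _ \<beta>(2)])
    show ?thesis
      unfolding symplectic_groupoid_integrating_def N
      using quo.lie \<beta>(1) D.quotient_multiplicative D.target_poisson_map by simp
  qed
  ultimately show ?thesis by blast
qed

end
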